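(* Let $k$ be a commutative ring, let $I$ be a small category, let $A$ be a functor from $I$ to commutative $k$-algebras and let $M$ be an $A$-module. Then $$H^1_{\mathbb G_I}(A,M)\cong\mathfrak{Ext}(A,M),$$ where $\mathfrak{Ext}(A,M)$ is the set of equivalence classes of extensions of $A$ by $M$.
   Context: Commutative algebras are unital. **Modules.** An $A$-module is a functor $M:I\to\mathfrak{Ab}$ such that each $M(i)$ is an $A(i)$-module and $M(\alpha)(a m)=A(\alpha)(a)\,M(\alpha)(m)$ for every $\alpha:i\to j$, $a\in A(i)$, $m\in M(i)$. **Derivations.** If $B\to A$ is a map of diagrams of commutative $k$-algebras, $\mathfrak{Der}(B,M)$ is the abelian group of families $(d_i)_{i\in I}$ of $k$-derivations $d_i:B(i)\to M(i)$ (with $B(i)$ acting on $M(i)$ through $A(i)$) such that $M(\alpha)d_i=d_jB(\alpha)$ for all $\alpha:i\to j$. **Cohomology.** Let $I_0$ be the category with the objects of $I$ and only identity morphisms. The forgetful functor from diagrams of commutative $k$-algebras of shape $I$ to $\mathfrak{Sets}^{I_0}$ has a left adjoint; let $\mathbb G_I=(G_I,\varepsilon,\delta)$ be the resulting comonad on diagrams of commutative $k$-algebras. $H^n_{\mathbb G_I}(A,M)$ is the $n$-th cohomology of the complex with $\mathfrak{Der}(G_I^{n+1}(A),M)$ in degree $n\ge0$ and coboundary the alternating sum of the maps induced by $G_I^i\varepsilon G_I^{n-i}$. **Extensions.** An extension of $A$ by $M$ is an exact sequence of functors $0\to M\xrightarrow{q}X\xrightarrow{p}A\to0$, where $X$ is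 a functor from $I$ to commutative $k$-algebras, such that for every $i$ the sequence $0\to M(i)\to X(i)\to A(i)\to0$ is an extension of commutative $k$-algebras: $p(i)$ is a $k$-algebra homomorphism, $q(i)$ is $k$-linear, the sequence is exact, and $x\,q(i)(m)=q(i)(p(i)(x)m)$ for $x\in X(i)$, $m\in M(i)$. Two extensions $X,X'$ are equivalent if there is a map of diagrams of algebras $X\to X'$ inducing the identity on $M$ and on $A$. Since $\mathfrak{Ext}(A,M)$ is defined as a set, $\cong$ means a bijection. *)

theory Defs
  imports "HOL-Algebra.Module" "HOL-Algebra.Coset"
    "HOL-Library.Multiset" "HOL-Library.Equipollence"
begin

section \<open>Small categories and diagrams of algebras\<close>

record ('o, 'r) small_cat =
  Obj :: "'o set"
  Arr :: "'r set"
  Dom :: "'r \<Rightarrow> 'o"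
  Cod :: "'r \<Rightarrow> 'o"
  Ident :: "'o \<Rightarrow> 'r"
  Comp :: "'r \<Rightarrow> 'r \<Rightarrow> 'r"  \<comment> \<open>\<open>Comp I g f\<close> is "first \<open>f\<close>, then \<open>g\<close>"\<close>

definition small_category :: "('o, 'r) small_cat \<Rightarrow> bool" where
  "small_category I \<longleftrightarrow>
     (\<forall>f\<in>Arr I. Dom I f \<in> Obj I \<and> Cod I f \<in> Obj I) \<and>
     (\<forall>i\<in>Obj I. Ident I i \<in> Arr I \<and> Dom I (Ident I i) = i \<and> Cod I (Ident I i) = i) \<and>
     (\<forall>f\<in>Arr I. \<forall>g\<in>Arr I. Dom I g = Cod I f \<longrightarrow>
        Comp I g f \<in> Arr I \<and> Dom I (Comp I g f) = Dom I f \<and> Cod I (Comp I g f) = Cod I g) \<and>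
     (\<forall>f\<in>Arr I. Comp I f (Ident I (Dom I f)) = f \<and> Comp I (Ident I (Cod I f)) f = f) \<and>
     (\<forall>f\<in>Arr I. \<forall>g\<in>Arr I. \<forall>h\<in>Arr I. Dom I g = Cod I f \<longrightarrow> Dom I h = Cod I g \<longrightarrow>
        Comp I h (Comp I g f) = Comp I (Comp I h g) f)"

text \<open>
  The values of a diagram are records of type \<^typ>\<open>('s, 'a) module\<close>.  The same type serves for
  diagrams of \<open>k\<close>-algebras (scalars in \<open>k\<close>) and for modules over a diagram (scalars at \<open>i\<close> in
  \<open>A(i)\<close>; the multiplicative fields of the record are then ignored).
\<close>

record ('o, 'r, 's, 'a) diagram =
  ob :: "'o \<Rightarrow> ('s, 'a) module"
  ar :: "'r \<Rightarrow> 'a \<Rightarrow> 'a"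

definition functorial :: "('o, 'r) small_cat \<Rightarrow> ('o, 'r, 's, 'a) diagram \<Rightarrow> bool" where
  "functorial I D \<longleftrightarrow>
     (\<forall>f\<in>Arr I. ar D f \<in> carrier (ob D (Dom I f)) \<rightarrow> carrier (ob D (Cod I f))) \<and>
     (\<forall>i\<in>Obj I. \<forall>x\<in>carrier (ob D i). ar D (Ident I i) x = x) \<and>
     (\<forall>f\<in>Arr I. \<forall>g\<in>Arr I. Dom I g = Cod I f \<longrightarrow>
        (\<forall>x\<in>carrier (ob D (Dom I f)). ar D (Comp I g f) x = ar D g (ar D f x)))"

definition natural ::
    "('o, 'r) small_cat \<Rightarrow> ('o, 'r, 's, 'a) diagram \<Rightarrow> ('o, 'r, 't, 'b) diagram \<Rightarrow>
     ('o \<Rightarrow> 'a \<Rightarrow> 'b) \<Rightarrow> bool" where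
  "natural I D E h \<longleftrightarrow>
     (\<forall>f\<in>Arr I. \<forall>x\<in>carrier (ob D (Dom I f)).
        ar E f (h (Dom I f) x) = h (Cod I f) (ar D f x))"

text \<open>\<^const>\<open>ring_hom\<close> preserves \<open>\<one>\<close>.\<close>

definition alg_hom :: "'k ring \<Rightarrow> ('k, 'a) module \<Rightarrow> ('k, 'b) module \<Rightarrow> ('a \<Rightarrow> 'b) set" where
  "alg_hom K X Y =
     {h \<in> ring_hom X Y.
        \<forall>c\<in>carrier K. \<forall>x\<in>carrier X. h (c \<odot>\<^bsub>X\<^esub> x) = c \<odot>\<^bsub>Y\<^esub> h x}"

definition algebra_diagram ::
    "'k ring \<Rightarrow> ('o, 'r) small_cat \<Rightarrow> ('o, 'r, 'k, 'a) diagram \<Rightarrow> bool" where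
  "algebra_diagram K I A \<longleftrightarrow>
     (\<forall>i\<in>Obj I. algebra K (ob A i)) \<and>
     (\<forall>f\<in>Arr I. ar A f \<in> alg_hom K (ob A (Dom I f)) (ob A (Cod I f))) \<and>
     functorial I A"

definition diagram_hom ::
    "'k ring \<Rightarrow> ('o, 'r) small_cat \<Rightarrow> ('o, 'r, 'k, 'a) diagram \<Rightarrow> ('o, 'r, 'k, 'b) diagram \<Rightarrow>
     ('o \<Rightarrow> 'a \<Rightarrow> 'b) \<Rightarrow> bool" where
  "diagram_hom K I B C h \<longleftrightarrow>
     (\<forall>i\<in>Obj I. h i \<in> alg_hom K (ob B i) (ob C i)) \<and> natural I B C h"

definition diagram_module ::
    "('o, 'r) small_cat \<Rightarrow> ('o, 'r, 'k, 'a) diagram \<Rightarrow> ('o, 'r, 'a, 'm) diagram \<Rightarrow> bool" where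
  "diagram_module I A M \<longleftrightarrow>
     (\<forall>i\<in>Obj I. module (ob A i) (ob M i)) \<and>
     functorial I M \<and>
     (\<forall>f\<in>Arr I. \<forall>x\<in>carrier (ob M (Dom I f)). \<forall>y\<in>carrier (ob M (Dom I f)).
        ar M f (x \<oplus>\<^bsub>ob M (Dom I f)\<^esub> y) = ar M f x \<oplus>\<^bsub>ob M (Cod I f)\<^esub> ar M f y) \<and>
     (\<forall>f\<in>Arr I. \<forall>a\<in>carrier (ob A (Dom I f)). \<forall>x\<in>carrier (ob M (Dom I f)).
        ar M f (a \<odot>\<^bsub>ob M (Dom I f)\<^esub> x) = ar A f a \<odot>\<^bsub>ob M (Cod I f)\<^esub> ar M f x)"

text \<open>The \<open>k\<close>-module structure of an \<open>A\<close>-module \<open>M\<close>, for a \<open>k\<close>-algebra \<open>A\<close>: \<open>c m = (c 1\<^sub>A) m\<close>.\<close>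

definition kscale :: "('k, 'a) module \<Rightarrow> ('a, 'm) module \<Rightarrow> 'k \<Rightarrow> 'm \<Rightarrow> 'm" where
  "kscale A M c m = (c \<odot>\<^bsub>A\<^esub> \<one>\<^bsub>A\<^esub>) \<odot>\<^bsub>M\<^esub> m"


section \<open>Extensions\<close>

record ('o, 'r, 'k, 'a, 'm, 'x) extension =
  mid :: "('o, 'r, 'k, 'x) diagram"
  incl :: "'o \<Rightarrow> 'm \<Rightarrow> 'x"
  proj :: "'o \<Rightarrow> 'x \<Rightarrow> 'a"

definition algebra_extension ::
    "'k ring \<Rightarrow> ('k, 'a) module \<Rightarrow> ('a, 'm) module \<Rightarrow> ('k, 'x) module \<Rightarrow>
     ('m \<Rightarrow> 'x) \<Rightarrow> ('x \<Rightarrow> 'a) \<Rightarrow> bool" where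
  "algebra_extension K A M X q p \<longleftrightarrow>
     p \<in> alg_hom K X A \<and>
     q \<in> carrier M \<rightarrow> carrier X \<and>
     (\<forall>m\<in>carrier M. \<forall>n\<in>carrier M. q (m \<oplus>\<^bsub>M\<^esub> n) = q m \<oplus>\<^bsub>X\<^esub> q n) \<and>
     (\<forall>c\<in>carrier K. \<forall>m\<in>carrier M. q (kscale A M c m) = c \<odot>\<^bsub>X\<^esub> q m) \<and>
     inj_on q (carrier M) \<and>
     q ` carrier M = {x \<in> carrier X. p x = \<zero>\<^bsub>A\<^esub>} \<and>
     p ` carrier X = carrier A \<and>
     (\<forall>x\<in>carrier X. \<forall>m\<in>carrier M. x \<otimes>\<^bsub>X\<^esub> q m = q (p x \<odot>\<^bsub>M\<^esub> m))"

definition is_extension ::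
    "'k ring \<Rightarrow> ('o, 'r) small_cat \<Rightarrow> ('o, 'r, 'k, 'a) diagram \<Rightarrow> ('o, 'r, 'a, 'm) diagram \<Rightarrow>
     ('o, 'r, 'k, 'a, 'm, 'x) extension \<Rightarrow> bool" where
  "is_extension K I A M E \<longleftrightarrow>
     algebra_diagram K I (mid E) \<and>
     (\<forall>i\<in>Obj I. algebra_extension K (ob A i) (ob M i) (ob (mid E) i) (incl E i) (proj E i)) \<and>
     natural I M (mid E) (incl E) \<and>
     natural I (mid E) A (proj E)"

definition extension_equiv ::
    "'k ring \<Rightarrow> ('o, 'r) small_cat \<Rightarrow> ('o, 'r, 'k, 'a) diagram \<Rightarrow> ('o, 'r, 'a, 'm) diagram \<Rightarrow>
     (('o, 'r, 'k, 'a, 'm, 'x) extension \<times> ('o, 'r, 'k, 'a, 'm, 'x) extension) set" where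
  "extension_equiv K I A M =
     {(E, E'). is_extension K I A M E \<and> is_extension K I A M E' \<and>
        (\<exists>h. diagram_hom K I (mid E) (mid E') h \<and>
          (\<forall>i\<in>Obj I. \<forall>m\<in>carrier (ob M i). h i (incl E i m) = incl E' i m) \<and>
          (\<forall>i\<in>Obj I. \<forall>x\<in>carrier (ob (mid E) i). proj E' i (h i x) = proj E i x))}"

text \<open>
  The type \<open>'x\<close> bounds the size of the carriers of the extensions under consideration.  As the set
  \<open>X(i)\<close> is in bijection with \<open>M(i) \<times> A(i)\<close>, every extension is isomorphic to one with carriers in
  \<open>'x\<close> as soon as \<open>'m \<times> 'a\<close> embeds into \<open>'x\<close>, so that no equivalence class is lost.
\<close>

definition Ext ::
    "'k ring \<Rightarrow> ('o, 'r) small_cat \<Rightarrow> ('o, 'r, 'k, 'a) diagram \<Rightarrow> ('o, 'r, 'a, 'm) diagram \<Rightarrow>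
     ('o, 'r, 'k, 'a, 'm, 'x) extension set set" where
  "Ext K I A M = {E. is_extension K I A M E} // extension_equiv K I A M"


section \<open>Polynomial algebras\<close>

text \<open>
  \<open>poly_alg K V\<close> is the polynomial algebra \<open>K[V]\<close>.  Monomials are multisets of variables, and a
  polynomial is its coefficient function.
\<close>

definition poly_alg :: "'k ring \<Rightarrow> 'v set \<Rightarrow> ('k, 'v multiset \<Rightarrow> 'k) module" where
  "poly_alg K V =
     \<lparr>carrier = {p. (\<forall>m. p m \<in> carrier K) \<and> finite {m. p m \<noteq> \<zero>\<^bsub>K\<^esub>} \<and>
                    (\<forall>m. p m \<noteq> \<zero>\<^bsub>K\<^esub> \<longrightarrow> set_mset m \<subseteq> V)},
      monoid.mult = (\<lambda>p q m. \<Oplus>\<^bsub>K\<^esub>a\<in>{a. a \<subseteq># m}. p a \<otimes>\<^bsub>K\<^esub> q (m - a)),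
      one = (\<lambda>m. if m = {#} then \<one>\<^bsub>K\<^esub> else \<zero>\<^bsub>K\<^esub>),
      zero = (\<lambda>m. \<zero>\<^bsub>K\<^esub>),
      add = (\<lambda>p q m. p m \<oplus>\<^bsub>K\<^esub> q m),
      smult = (\<lambda>c p m. c \<otimes>\<^bsub>K\<^esub> p m)\<rparr>"

definition poly_var :: "'k ring \<Rightarrow> 'v \<Rightarrow> 'v multiset \<Rightarrow> 'k" where
  "poly_var K v = (\<lambda>m. if m = {#v#} then \<one>\<^bsub>K\<^esub> else \<zero>\<^bsub>K\<^esub>)"

definition mon_eval :: "('k, 'b) module \<Rightarrow> ('v \<Rightarrow> 'b) \<Rightarrow> 'v multiset \<Rightarrow> 'b" where
  "mon_eval B \<phi> m = (\<Otimes>\<^bsub>B\<^esub>v\<in>set_mset m. \<phi> v [^]\<^bsub>B\<^esub> count m v)"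

definition poly_eval ::
    "'k ring \<Rightarrow> ('k, 'b) module \<Rightarrow> ('v \<Rightarrow> 'b) \<Rightarrow> ('v multiset \<Rightarrow> 'k) \<Rightarrow> 'b" where
  "poly_eval K B \<phi> p = (\<Oplus>\<^bsub>B\<^esub>m\<in>{m. p m \<noteq> \<zero>\<^bsub>K\<^esub>}. p m \<odot>\<^bsub>B\<^esub> mon_eval B \<phi> m)"


section \<open>The comonad \<open>G\<^sub>I\<close>\<close>

text \<open>
  The left adjoint of the forgetful functor sends a family of sets \<open>(S(i))\<^sub>i\<close> to the diagram with
  value at \<open>i\<close> the polynomial algebra on the pairs \<open>(f, s)\<close> of an arrow \<open>f : j \<rightarrow> i\<close> and an element
  \<open>s \<in> S(j)\<close>; an arrow \<open>g\<close> sends the variable \<open>(f, s)\<close> to \<open>(g f, s)\<close>.  The adjunction is proved at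
  the end of this theory.
\<close>

definition free_gens :: "('o, 'r) small_cat \<Rightarrow> ('o \<Rightarrow> 's set) \<Rightarrow> 'o \<Rightarrow> ('r \<times> 's) set" where
  "free_gens I S i = {(f, s). f \<in> Arr I \<and> Cod I f = i \<and> s \<in> S (Dom I f)}"

definition free_diagram ::
    "'k ring \<Rightarrow> ('o, 'r) small_cat \<Rightarrow> ('o \<Rightarrow> 's set) \<Rightarrow>
     ('o, 'r, 'k, ('r \<times> 's) multiset \<Rightarrow> 'k) diagram" where
  "free_diagram K I S =
     \<lparr>ob = (\<lambda>i. poly_alg K (free_gens I S i)),
      ar = (\<lambda>g. poly_eval K (poly_alg K (free_gens I S (Cod I g)))
                  (\<lambda>(f, s). poly_var K (Comp I g f, s)))\<rparr>"

definition free_unit ::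
    "'k ring \<Rightarrow> ('o, 'r) small_cat \<Rightarrow> 'o \<Rightarrow> 's \<Rightarrow> ('r \<times> 's) multiset \<Rightarrow> 'k" where
  "free_unit K I i s = poly_var K (Ident I i, s)"

text \<open>The map of diagrams out of a free diagram adjoint to a family of maps \<open>u\<^sub>i : S(i) \<rightarrow> B(i)\<close>.\<close>

definition free_lift ::
    "'k ring \<Rightarrow> ('o, 'r) small_cat \<Rightarrow> ('o, 'r, 'k, 'b) diagram \<Rightarrow> ('o \<Rightarrow> 's \<Rightarrow> 'b) \<Rightarrow>
     'o \<Rightarrow> (('r \<times> 's) multiset \<Rightarrow> 'k) \<Rightarrow> 'b" where
  "free_lift K I B u i = poly_eval K (ob B i) (\<lambda>(f, s). ar B f (u (Dom I f) s))"

type_synonym ('r, 'k, 'b) gpoly = "('r \<times> 'b) multiset \<Rightarrow> 'k"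

definition G_obj ::
    "'k ring \<Rightarrow> ('o, 'r) small_cat \<Rightarrow> ('o, 'r, 'k, 'b) diagram \<Rightarrow>
     ('o, 'r, 'k, ('r, 'k, 'b) gpoly) diagram" where
  "G_obj K I B = free_diagram K I (\<lambda>i. carrier (ob B i))"

definition G_map ::
    "'k ring \<Rightarrow> ('o, 'r) small_cat \<Rightarrow> ('o, 'r, 'k, 'c) diagram \<Rightarrow> ('o \<Rightarrow> 'b \<Rightarrow> 'c) \<Rightarrow>
     'o \<Rightarrow> ('r, 'k, 'b) gpoly \<Rightarrow> ('r, 'k, 'c) gpoly" where
  "G_map K I C h = free_lift K I (G_obj K I C) (\<lambda>i x. free_unit K I i (h i x))"

definition G_counit ::
    "'k ring \<Rightarrow> ('o, 'r) small_cat \<Rightarrow> ('o, 'r, 'k, 'b) diagram \<Rightarrow>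
     'o \<Rightarrow> ('r, 'k, 'b) gpoly \<Rightarrow> 'b" where
  "G_counit K I B = free_lift K I B (\<lambda>i x. x)"


section \<open>Derivations\<close>

definition derivation ::
    "'k ring \<Rightarrow> ('k, 'a) module \<Rightarrow> ('a, 'm) module \<Rightarrow> ('k, 'b) module \<Rightarrow> ('b \<Rightarrow> 'a) \<Rightarrow>
     ('b \<Rightarrow> 'm) \<Rightarrow> bool" where
  "derivation K A M B \<pi> d \<longleftrightarrow>
     d \<in> carrier B \<rightarrow> carrier M \<and>
     (\<forall>x\<in>carrier B. \<forall>y\<in>carrier B. d (x \<oplus>\<^bsub>B\<^esub> y) = d x \<oplus>\<^bsub>M\<^esub> d y) \<and>
     (\<forall>c\<in>carrier K. \<forall>x\<in>carrier B. d (c \<odot>\<^bsub>B\<^esub> x) = kscale A M c (d x)) \<and>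
     (\<forall>x\<in>carrier B. \<forall>y\<in>carrier B.
        d (x \<otimes>\<^bsub>B\<^esub> y) = \<pi> x \<odot>\<^bsub>M\<^esub> d y \<oplus>\<^bsub>M\<^esub> \<pi> y \<odot>\<^bsub>M\<^esub> d x)"

text \<open>
  The abelian group of derivations from \<open>B\<close> to \<open>M\<close> along \<open>\<pi> : B \<rightarrow> A\<close>, written multiplicatively as
  usual in \<^theory>\<open>HOL-Algebra.Group\<close>; the operation is pointwise addition.  Families are
  extensional, i.e. undefined off the objects and off the carriers, so that equality of group
  elements is equality of derivations.
\<close>

definition Der ::
    "'k ring \<Rightarrow> ('o, 'r) small_cat \<Rightarrow> ('o, 'r, 'k, 'a) diagram \<Rightarrow> ('o, 'r, 'a, 'm) diagram \<Rightarrow>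
     ('o, 'r, 'k, 'b) diagram \<Rightarrow> ('o \<Rightarrow> 'b \<Rightarrow> 'a) \<Rightarrow> ('o \<Rightarrow> 'b \<Rightarrow> 'm) monoid" where
  "Der K I A M B \<pi> =
     \<lparr>carrier = {d \<in> (\<Pi>\<^sub>E i\<in>Obj I. carrier (ob B i) \<rightarrow>\<^sub>E carrier (ob M i)).
                   (\<forall>i\<in>Obj I. derivation K (ob A i) (ob M i) (ob B i) (\<pi> i) (d i)) \<and>
                   natural I B M d},
      monoid.mult = (\<lambda>d e. \<lambda>i\<in>Obj I. \<lambda>x\<in>carrier (ob B i). d i x \<oplus>\<^bsub>ob M i\<^esub> e i x),
      one = (\<lambda>i\<in>Obj I. \<lambda>x\<in>carrier (ob B i). \<zero>\<^bsub>ob M i\<^esub>)\<rparr>"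

definition der_pull ::
    "('o, 'r) small_cat \<Rightarrow> ('o, 'r, 'k, 'c) diagram \<Rightarrow> ('o \<Rightarrow> 'c \<Rightarrow> 'b) \<Rightarrow>
     ('o \<Rightarrow> 'b \<Rightarrow> 'm) \<Rightarrow> 'o \<Rightarrow> 'c \<Rightarrow> 'm" where
  "der_pull I C h d = (\<lambda>i\<in>Obj I. \<lambda>x\<in>carrier (ob C i). d i (h i x))"


section \<open>The first cohomology group\<close>

text \<open>
  The maps \<open>G\<^sup>n\<^sup>+\<^sup>1(A) \<rightarrow> A\<close>.  They are composites of counits; which ones is immaterial, by
  naturality.
\<close>

definition aug1 ::
    "'k ring \<Rightarrow> ('o, 'r) small_cat \<Rightarrow> ('o, 'r, 'k, 'a) diagram \<Rightarrow>
     'o \<Rightarrow> ('r, 'k, 'a) gpoly \<Rightarrow> 'a" where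
  "aug1 K I A = G_counit K I A"

definition aug2 ::
    "'k ring \<Rightarrow> ('o, 'r) small_cat \<Rightarrow> ('o, 'r, 'k, 'a) diagram \<Rightarrow>
     'o \<Rightarrow> ('r, 'k, ('r, 'k, 'a) gpoly) gpoly \<Rightarrow> 'a" where
  "aug2 K I A = (\<lambda>i x. aug1 K I A i (G_counit K I (G_obj K I A) i x))"

definition aug3 ::
    "'k ring \<Rightarrow> ('o, 'r) small_cat \<Rightarrow> ('o, 'r, 'k, 'a) diagram \<Rightarrow>
     'o \<Rightarrow> ('r, 'k, ('r, 'k, ('r, 'k, 'a) gpoly) gpoly) gpoly \<Rightarrow> 'a" where
  "aug3 K I A = (\<lambda>i x. aug2 K I A i (G_counit K I (G_obj K I (G_obj K I A)) i x))"

definition Der0 ::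
    "'k ring \<Rightarrow> ('o, 'r) small_cat \<Rightarrow> ('o, 'r, 'k, 'a) diagram \<Rightarrow> ('o, 'r, 'a, 'm) diagram \<Rightarrow>
     ('o \<Rightarrow> ('r, 'k, 'a) gpoly \<Rightarrow> 'm) monoid" where
  "Der0 K I A M = Der K I A M (G_obj K I A) (aug1 K I A)"

definition Der1 ::
    "'k ring \<Rightarrow> ('o, 'r) small_cat \<Rightarrow> ('o, 'r, 'k, 'a) diagram \<Rightarrow> ('o, 'r, 'a, 'm) diagram \<Rightarrow>
     ('o \<Rightarrow> ('r, 'k, ('r, 'k, 'a) gpoly) gpoly \<Rightarrow> 'm) monoid" where
  "Der1 K I A M = Der K I A M (G_obj K I (G_obj K I A)) (aug2 K I A)"

definition Der2 ::
    "'k ring \<Rightarrow> ('o, 'r) small_cat \<Rightarrow> ('o, 'r, 'k, 'a) diagram \<Rightarrow> ('o, 'r, 'a, 'm) diagram \<Rightarrow>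
     ('o \<Rightarrow> ('r, 'k, ('r, 'k, ('r, 'k, 'a) gpoly) gpoly) gpoly \<Rightarrow> 'm) monoid" where
  "Der2 K I A M = Der K I A M (G_obj K I (G_obj K I (G_obj K I A))) (aug3 K I A)"

text \<open>
  \<open>face1 j : G\<^sup>2(A) \<rightarrow> G(A)\<close> is \<open>G\<^sup>j \<epsilon> G\<^sup>1\<^sup>-\<^sup>j\<close> at \<open>A\<close>, and \<open>face2 j : G\<^sup>3(A) \<rightarrow> G\<^sup>2(A)\<close> is
  \<open>G\<^sup>j \<epsilon> G\<^sup>2\<^sup>-\<^sup>j\<close> at \<open>A\<close>.
\<close>

definition face1_0 ::
    "'k ring \<Rightarrow> ('o, 'r) small_cat \<Rightarrow> ('o, 'r, 'k, 'a) diagram \<Rightarrow>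
     'o \<Rightarrow> ('r, 'k, ('r, 'k, 'a) gpoly) gpoly \<Rightarrow> ('r, 'k, 'a) gpoly" where
  "face1_0 K I A = G_counit K I (G_obj K I A)"

definition face1_1 ::
    "'k ring \<Rightarrow> ('o, 'r) small_cat \<Rightarrow> ('o, 'r, 'k, 'a) diagram \<Rightarrow>
     'o \<Rightarrow> ('r, 'k, ('r, 'k, 'a) gpoly) gpoly \<Rightarrow> ('r, 'k, 'a) gpoly" where
  "face1_1 K I A = G_map K I A (G_counit K I A)"

definition face2_0 ::
    "'k ring \<Rightarrow> ('o, 'r) small_cat \<Rightarrow> ('o, 'r, 'k, 'a) diagram \<Rightarrow>
     'o \<Rightarrow> ('r, 'k, ('r, 'k, ('r, 'k, 'a) gpoly) gpoly) gpoly \<Rightarrow> ('r, 'k, ('r, 'k, 'a) gpoly) gpoly" where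
  "face2_0 K I A = G_counit K I (G_obj K I (G_obj K I A))"

definition face2_1 ::
    "'k ring \<Rightarrow> ('o, 'r) small_cat \<Rightarrow> ('o, 'r, 'k, 'a) diagram \<Rightarrow>
     'o \<Rightarrow> ('r, 'k, ('r, 'k, ('r, 'k, 'a) gpoly) gpoly) gpoly \<Rightarrow> ('r, 'k, ('r, 'k, 'a) gpoly) gpoly" where
  "face2_1 K I A = G_map K I (G_obj K I A) (G_counit K I (G_obj K I A))"

definition face2_2 ::
    "'k ring \<Rightarrow> ('o, 'r) small_cat \<Rightarrow> ('o, 'r, 'k, 'a) diagram \<Rightarrow>
     'o \<Rightarrow> ('r, 'k, ('r, 'k, ('r, 'k, 'a) gpoly) gpoly) gpoly \<Rightarrow> ('r, 'k, ('r, 'k, 'a) gpoly) gpoly" where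
  "face2_2 K I A = G_map K I (G_obj K I A) (G_map K I A (G_counit K I A))"

definition cobd0 ::
    "'k ring \<Rightarrow> ('o, 'r) small_cat \<Rightarrow> ('o, 'r, 'k, 'a) diagram \<Rightarrow> ('o, 'r, 'a, 'm) diagram \<Rightarrow>
     ('o \<Rightarrow> ('r, 'k, 'a) gpoly \<Rightarrow> 'm) \<Rightarrow>
     ('o \<Rightarrow> ('r, 'k, ('r, 'k, 'a) gpoly) gpoly \<Rightarrow> 'm)" where
  "cobd0 K I A M d =
     der_pull I (G_obj K I (G_obj K I A)) (face1_0 K I A) d
       \<otimes>\<^bsub>Der1 K I A M\<^esub> inv\<^bsub>Der1 K I A M\<^esub> der_pull I (G_obj K I (G_obj K I A)) (face1_1 K I A) d"

definition cobd1 ::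
    "'k ring \<Rightarrow> ('o, 'r) small_cat \<Rightarrow> ('o, 'r, 'k, 'a) diagram \<Rightarrow> ('o, 'r, 'a, 'm) diagram \<Rightarrow>
     ('o \<Rightarrow> ('r, 'k, ('r, 'k, 'a) gpoly) gpoly \<Rightarrow> 'm) \<Rightarrow>
     ('o \<Rightarrow> ('r, 'k, ('r, 'k, ('r, 'k, 'a) gpoly) gpoly) gpoly \<Rightarrow> 'm)" where
  "cobd1 K I A M d =
     der_pull I (G_obj K I (G_obj K I (G_obj K I A))) (face2_0 K I A) d
       \<otimes>\<^bsub>Der2 K I A M\<^esub> inv\<^bsub>Der2 K I A M\<^esub> der_pull I (G_obj K I (G_obj K I (G_obj K I A))) (face2_1 K I A) d
       \<otimes>\<^bsub>Der2 K I A M\<^esub> der_pull I (G_obj K I (G_obj K I (G_obj K I A))) (face2_2 K I A) d"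

definition H1 ::
    "'k ring \<Rightarrow> ('o, 'r) small_cat \<Rightarrow> ('o, 'r, 'k, 'a) diagram \<Rightarrow> ('o, 'r, 'a, 'm) diagram \<Rightarrow>
     ('o \<Rightarrow> ('r, 'k, ('r, 'k, 'a) gpoly) gpoly \<Rightarrow> 'm) set monoid" where
  "H1 K I A M =
     (Der1 K I A M\<lparr>carrier := kernel (Der1 K I A M) (Der2 K I A M) (cobd1 K I A M)\<rparr>)
       Mod (cobd0 K I A M ` carrier (Der0 K I A M))"


section \<open>The free--forgetful adjunction\<close>

lemma (in comm_monoid) finprod_Sigma':
  assumes "finite S" "\<And>a. a \<in> S \<Longrightarrow> finite (T a)"
    "\<And>a b. a \<in> S \<Longrightarrow> b \<in> T a \<Longrightarrow> f a b \<in> carrier G"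
  shows "(\<Otimes>a\<in>S. \<Otimes>b\<in>T a. f a b) = (\<Otimes>x\<in>Sigma S T. f (fst x) (snd x))"
proof -
  have "(\<Otimes>x\<in>Sigma S T. f (fst x) (snd x)) = (\<Otimes>x\<in>(\<Union>a\<in>S. Pair a ` T a). f (fst x) (snd x))"
    by (rule finprod_cong') (use assms in auto)
  also have "\<dots> = (\<Otimes>a\<in>S. \<Otimes>x\<in>Pair a ` T a. f (fst x) (snd x))"
    by (rule finprod_UN_disjoint) (use assms in \<open>auto simp: pairwise_def disjnt_def\<close>)
  also have "\<dots> = (\<Otimes>a\<in>S. \<Otimes>b\<in>T a. f a b)"
  proof (rule finprod_cong')
    fix a assume a: "a \<in> S"
    show "(\<Otimes>x\<in>Pair a ` T a. f (fst x) (snd x)) = (\<Otimes>b\<in>T a. f a b)"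
      by (subst finprod_reindex) (use assms a in \<open>auto simp: inj_on_def\<close>)
  qed (use assms in \<open>auto intro!: finprod_closed\<close>)
  finally show ?thesis ..
qed

lemma (in abelian_monoid) finsum_Sigma':
  assumes "finite S" "\<And>a. a \<in> S \<Longrightarrow> finite (T a)"
    "\<And>a b. a \<in> S \<Longrightarrow> b \<in> T a \<Longrightarrow> f a b \<in> carrier G"
  shows "(\<Oplus>a\<in>S. \<Oplus>b\<in>T a. f a b) = (\<Oplus>x\<in>Sigma S T. f (fst x) (snd x))"
  using add.finprod_Sigma'[of S T f] assms by (simp add: finsum_def)

lemma mon_eval_closed:
  assumes "comm_monoid B" "\<And>v. v \<in># m \<Longrightarrow> \<phi> v \<in> carrier B"
  shows "mon_eval B \<phi> m \<in> carrier B"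
proof -
  interpret comm_monoid B by fact
  show ?thesis unfolding mon_eval_def by (rule finprod_closed) (use assms in auto)
qed

lemma mon_eval_empty: "comm_monoid B \<Longrightarrow> mon_eval B \<phi> {#} = \<one>\<^bsub>B\<^esub>"
  by (simp add: mon_eval_def comm_monoid.finprod_empty)

lemma mon_eval_single:
  assumes "comm_monoid B" "\<phi> v \<in> carrier B"
  shows "mon_eval B \<phi> {#v#} = \<phi> v"
proof -
  interpret comm_monoid B by fact
  show ?thesis using assms by (simp add: mon_eval_def)
qed

lemma mon_eval_union:
  assumes B: "comm_monoid B" and 1: "\<And>v. v \<in># m \<Longrightarrow> \<phi> v \<in> carrier B"
    and 2: "\<And>v. v \<in># n \<Longrightarrow> \<phi> v \<in> carrier B"
  shows "mon_eval B \<phi> (m + n) = mon_eval B \<phi> m \<otimes>\<^bsub>B\<^esub> mon_eval B \<phi> n"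
proof -
  interpret comm_monoid B by fact
  let ?S = "set_mset m \<union> set_mset n"
  have ext: "mon_eval B \<phi> k = (\<Otimes>\<^bsub>B\<^esub>v\<in>?S. \<phi> v [^]\<^bsub>B\<^esub> count k v)" if "set_mset k \<subseteq> ?S" for k
    unfolding mon_eval_def
    by (rule finprod_mono_neutral_cong_left)
       (use that 1 2 in \<open>auto simp: not_in_iff\<close>)
  have "mon_eval B \<phi> (m + n) = (\<Otimes>\<^bsub>B\<^esub>v\<in>?S. \<phi> v [^]\<^bsub>B\<^esub> count m v \<otimes>\<^bsub>B\<^esub> \<phi> v [^]\<^bsub>B\<^esub> count n v)"
    by (subst ext, simp, rule finprod_cong') (use 1 2 in \<open>auto simp: nat_pow_mult\<close>)
  also have "\<dots> = mon_eval B \<phi> m \<otimes>\<^bsub>B\<^esub> mon_eval B \<phi> n"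
    by (subst ext, simp, subst ext, simp, rule finprod_multf) (use 1 2 in auto)
  finally show ?thesis .
qed

lemma finite_submset: "finite {a. a \<subseteq># (m :: 'v multiset)}"
proof (induction m)
  case (add x m)
  have "{a. a \<subseteq># add_mset x m} \<subseteq> {a. a \<subseteq># m} \<union> add_mset x ` {a. a \<subseteq># m}"
  proof
    fix a assume a: "a \<in> {a. a \<subseteq># add_mset x m}"
    show "a \<in> {a. a \<subseteq># m} \<union> add_mset x ` {a. a \<subseteq># m}"
    proof (cases "x \<in># a")
      case True
      then obtain b where "a = add_mset x b" by (metis insert_DiffM)
      then show ?thesis using a by auto
    next
      case False
      then show ?thesis using a
        by (auto simp: subseteq_mset_def not_in_iff split: if_splits) (metis le0)
    qed
  qed
  then show ?case by (rule finite_subset) (use add in auto)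
qed auto

definition splits :: "'v multiset \<Rightarrow> ('v multiset \<times> 'v multiset) set" where
  "splits m = {x. fst x + snd x = m}"

lemma splits_eq: "splits m = (\<lambda>a. (a, m - a)) ` {a. a \<subseteq># m}"
  by (force simp: splits_def image_iff)

lemma finite_splits: "finite (splits m)"
  unfolding splits_eq by (rule finite_imageI, rule finite_submset)

context
  fixes K :: "'k ring"
  assumes K: "cring K"
begin

interpretation K: cring K by (rule K)

lemma poly_mult_splits:
  assumes "\<And>m. p m \<in> carrier K" "\<And>m. q m \<in> carrier K"
  shows "(p \<otimes>\<^bsub>poly_alg K V\<^esub> q) m = (\<Oplus>\<^bsub>K\<^esub>x\<in>splits m. p (fst x) \<otimes>\<^bsub>K\<^esub> q (snd x))"
  unfolding splits_eq
  by (subst K.finsum_reindex) (use assms in \<open>auto simp: poly_alg_def inj_on_def\<close>)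

lemma poly_mult_fin:
  assumes "\<And>m. p m \<in> carrier K" "\<And>m. q m \<in> carrier K"
    and "\<And>m. p m \<noteq> \<zero>\<^bsub>K\<^esub> \<Longrightarrow> m \<in> P" "\<And>m. q m \<noteq> \<zero>\<^bsub>K\<^esub> \<Longrightarrow> m \<in> Q"
  shows "(p \<otimes>\<^bsub>poly_alg K V\<^esub> q) m = (\<Oplus>\<^bsub>K\<^esub>x\<in>{x\<in>P \<times> Q. fst x + snd x = m}. p (fst x) \<otimes>\<^bsub>K\<^esub> q (snd x))"
  unfolding poly_mult_splits[OF assms(1,2)]
proof (rule K.add.finprod_mono_neutral_cong_right[OF finite_splits], goal_cases)
  case (2 x)
  then have "fst x \<notin> P \<or> snd x \<notin> Q" by (auto simp: splits_def mem_Times_iff)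
  then have "p (fst x) = \<zero>\<^bsub>K\<^esub> \<or> q (snd x) = \<zero>\<^bsub>K\<^esub>" using assms(3,4) by blast
  then show ?case using assms(1,2) by auto
qed (use assms in \<open>auto simp: splits_def\<close>)

lemma poly_carrier:
  "p \<in> carrier (poly_alg K V) \<longleftrightarrow> (\<forall>m. p m \<in> carrier K) \<and> finite {m. p m \<noteq> \<zero>\<^bsub>K\<^esub>} \<and>
     (\<forall>m. p m \<noteq> \<zero>\<^bsub>K\<^esub> \<longrightarrow> set_mset m \<subseteq> V)"
  by (simp add: poly_alg_def)

lemma poly_ops:
  "p \<oplus>\<^bsub>poly_alg K V\<^esub> q = (\<lambda>m. p m \<oplus>\<^bsub>K\<^esub> q m)"
  "c \<odot>\<^bsub>poly_alg K V\<^esub> p = (\<lambda>m. c \<otimes>\<^bsub>K\<^esub> p m)"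
  "\<zero>\<^bsub>poly_alg K V\<^esub> = (\<lambda>m. \<zero>\<^bsub>K\<^esub>)"
  "\<one>\<^bsub>poly_alg K V\<^esub> = (\<lambda>m. if m = {#} then \<one>\<^bsub>K\<^esub> else \<zero>\<^bsub>K\<^esub>)"
  by (simp_all add: poly_alg_def)

lemma poly_mult_closed:
  assumes p: "p \<in> carrier (poly_alg K V)" and q: "q \<in> carrier (poly_alg K V)"
  shows "p \<otimes>\<^bsub>poly_alg K V\<^esub> q \<in> carrier (poly_alg K V)"
proof -
  let ?P = "{m. p m \<noteq> \<zero>\<^bsub>K\<^esub>}" and ?Q = "{m. q m \<noteq> \<zero>\<^bsub>K\<^esub>}"
  have c: "\<And>m. p m \<in> carrier K" "\<And>m. q m \<in> carrier K" using p q by (auto simp: poly_carrier)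
  have eq: "(p \<otimes>\<^bsub>poly_alg K V\<^esub> q) m = (\<Oplus>\<^bsub>K\<^esub>x\<in>{x\<in>?P \<times> ?Q. fst x + snd x = m}. p (fst x) \<otimes>\<^bsub>K\<^esub> q (snd x))" for m
    by (rule poly_mult_fin) (use c in auto)
  have *: "m \<in> (\<lambda>x. fst x + snd x) ` (?P \<times> ?Q)" if "(p \<otimes>\<^bsub>poly_alg K V\<^esub> q) m \<noteq> \<zero>\<^bsub>K\<^esub>" for m
  proof (rule ccontr)
    assume "m \<notin> (\<lambda>x. fst x + snd x) ` (?P \<times> ?Q)"
    then have e: "{x\<in>?P \<times> ?Q. fst x + snd x = m} = {}" by blast
    show False using that unfolding eq e by simp
  qed
  have "finite {m. (p \<otimes>\<^bsub>poly_alg K V\<^esub> q) m \<noteq> \<zero>\<^bsub>K\<^esub>}"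
    by (rule finite_subset[of _ "(\<lambda>x. fst x + snd x) ` (?P \<times> ?Q)"])
       (use p q * in \<open>auto simp: poly_carrier\<close>)
  moreover have "set_mset m \<subseteq> V" if "(p \<otimes>\<^bsub>poly_alg K V\<^esub> q) m \<noteq> \<zero>\<^bsub>K\<^esub>" for m
    using *[OF that] p q unfolding poly_carrier by fastforce
  moreover have "(p \<otimes>\<^bsub>poly_alg K V\<^esub> q) m \<in> carrier K" for m
    unfolding eq by (rule K.finsum_closed) (use c in auto)
  ultimately show ?thesis unfolding poly_carrier by blast
qed

lemma poly_mult_comm:
  fixes V :: "'v set"
  assumes "p \<in> carrier (poly_alg K V)" "q \<in> carrier (poly_alg K V)"
  shows "p \<otimes>\<^bsub>poly_alg K V\<^esub> q = q \<otimes>\<^bsub>poly_alg K V\<^esub> p"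
proof
  fix m :: "'v multiset"
  have c: "\<And>m. p m \<in> carrier K" "\<And>m. q m \<in> carrier K" using assms by (auto simp: poly_carrier)
  have s: "splits m = prod.swap ` splits m" by (force simp: splits_def add.commute)
  have "(p \<otimes>\<^bsub>poly_alg K V\<^esub> q) m = (\<Oplus>\<^bsub>K\<^esub>x\<in>prod.swap ` splits m. p (fst x) \<otimes>\<^bsub>K\<^esub> q (snd x))"
    using s poly_mult_splits[of p q] c by auto
  also have "\<dots> = (q \<otimes>\<^bsub>poly_alg K V\<^esub> p) m"
    using c by (subst K.finsum_reindex)
      (auto simp: poly_mult_splits K.m_comm intro!: K.finsum_cong')
  finally show "(p \<otimes>\<^bsub>poly_alg K V\<^esub> q) m = (q \<otimes>\<^bsub>poly_alg K V\<^esub> p) m" .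
qed

lemma poly_mult_assoc:
  fixes V :: "'v set"
  assumes p: "p \<in> carrier (poly_alg K V)" and q: "q \<in> carrier (poly_alg K V)"
    and r: "r \<in> carrier (poly_alg K V)"
  shows "p \<otimes>\<^bsub>poly_alg K V\<^esub> q \<otimes>\<^bsub>poly_alg K V\<^esub> r = p \<otimes>\<^bsub>poly_alg K V\<^esub> (q \<otimes>\<^bsub>poly_alg K V\<^esub> r)"
proof
  fix m :: "'v multiset"
  have c: "\<And>m. p m \<in> carrier K" "\<And>m. q m \<in> carrier K" "\<And>m. r m \<in> carrier K"
    using assms by (auto simp: poly_carrier)
  have pq: "\<And>m. (p \<otimes>\<^bsub>poly_alg K V\<^esub> q) m \<in> carrier K"
    and qr: "\<And>m. (q \<otimes>\<^bsub>poly_alg K V\<^esub> r) m \<in> carrier K"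
    using poly_mult_closed[OF p q] poly_mult_closed[OF q r] by (auto simp: poly_carrier)
  let ?L = "SIGMA x:splits m. splits (fst x)" and ?R = "SIGMA x:splits m. splits (snd x)"
  let ?h = "\<lambda>y. ((fst (snd y), snd (snd y) + snd (fst y)), (snd (snd y), snd (fst y)))"
  have h: "bij_betw ?h ?L ?R"
    by (rule bij_betw_byWitness[where f' = "\<lambda>y. ((fst (fst y) + fst (snd y), snd (snd y)), (fst (fst y), fst (snd y)))"])
       (auto simp: splits_def add.assoc)
  have "(p \<otimes>\<^bsub>poly_alg K V\<^esub> q \<otimes>\<^bsub>poly_alg K V\<^esub> r) m
      = (\<Oplus>\<^bsub>K\<^esub>x\<in>splits m. (\<Oplus>\<^bsub>K\<^esub>z\<in>splits (fst x). p (fst z) \<otimes>\<^bsub>K\<^esub> q (snd z)) \<otimes>\<^bsub>K\<^esub> r (snd x))"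
    using c pq by (simp add: poly_mult_splits)
  also have "\<dots> = (\<Oplus>\<^bsub>K\<^esub>x\<in>splits m. \<Oplus>\<^bsub>K\<^esub>z\<in>splits (fst x). p (fst z) \<otimes>\<^bsub>K\<^esub> q (snd z) \<otimes>\<^bsub>K\<^esub> r (snd x))"
    by (rule K.finsum_cong') (use c in \<open>auto intro!: K.finsum_ldistr finite_splits K.finsum_closed\<close>)
  also have "\<dots> = (\<Oplus>\<^bsub>K\<^esub>y\<in>?L. p (fst (snd y)) \<otimes>\<^bsub>K\<^esub> q (snd (snd y)) \<otimes>\<^bsub>K\<^esub> r (snd (fst y)))"
    by (rule K.finsum_Sigma') (use c in \<open>auto intro!: finite_splits\<close>)
  also have "\<dots> = (\<Oplus>\<^bsub>K\<^esub>y\<in>?L. (\<lambda>w. p (fst (fst w)) \<otimes>\<^bsub>K\<^esub> (q (fst (snd w)) \<otimes>\<^bsub>K\<^esub> r (snd (snd w)))) (?h y))"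
    by (rule K.finsum_cong') (use c in \<open>auto simp: K.m_assoc\<close>)
  also have "\<dots> = (\<Oplus>\<^bsub>K\<^esub>w\<in>?h ` ?L. p (fst (fst w)) \<otimes>\<^bsub>K\<^esub> (q (fst (snd w)) \<otimes>\<^bsub>K\<^esub> r (snd (snd w))))"
    by (rule K.finsum_reindex[symmetric]) (use c h in \<open>auto simp: bij_betw_def\<close>)
  also have "?h ` ?L = ?R" using h by (simp add: bij_betw_def)
  also have "(\<Oplus>\<^bsub>K\<^esub>w\<in>?R. p (fst (fst w)) \<otimes>\<^bsub>K\<^esub> (q (fst (snd w)) \<otimes>\<^bsub>K\<^esub> r (snd (snd w))))
      = (\<Oplus>\<^bsub>K\<^esub>x\<in>splits m. \<Oplus>\<^bsub>K\<^esub>z\<in>splits (snd x). p (fst x) \<otimes>\<^bsub>K\<^esub> (q (fst z) \<otimes>\<^bsub>K\<^esub> r (snd z)))"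
    by (rule K.finsum_Sigma'[symmetric]) (use c in \<open>auto intro!: finite_splits\<close>)
  also have "\<dots> = (\<Oplus>\<^bsub>K\<^esub>x\<in>splits m. p (fst x) \<otimes>\<^bsub>K\<^esub> (\<Oplus>\<^bsub>K\<^esub>z\<in>splits (snd x). q (fst z) \<otimes>\<^bsub>K\<^esub> r (snd z)))"
    by (rule K.finsum_cong')
       (use c in \<open>auto intro!: K.finsum_rdistr[symmetric] finite_splits K.finsum_closed\<close>)
  also have "\<dots> = (p \<otimes>\<^bsub>poly_alg K V\<^esub> (q \<otimes>\<^bsub>poly_alg K V\<^esub> r)) m"
    using c qr by (simp add: poly_mult_splits)
  finally show "(p \<otimes>\<^bsub>poly_alg K V\<^esub> q \<otimes>\<^bsub>poly_alg K V\<^esub> r) m = (p \<otimes>\<^bsub>poly_alg K V\<^esub> (q \<otimes>\<^bsub>poly_alg K V\<^esub> r)) m" .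
qed

lemma poly_one_mult:
  fixes V :: "'v set"
  assumes "p \<in> carrier (poly_alg K V)"
  shows "\<one>\<^bsub>poly_alg K V\<^esub> \<otimes>\<^bsub>poly_alg K V\<^esub> p = p"
proof
  fix m :: "'v multiset"
  have c: "\<And>m. p m \<in> carrier K" using assms by (auto simp: poly_carrier)
  have "(\<one>\<^bsub>poly_alg K V\<^esub> \<otimes>\<^bsub>poly_alg K V\<^esub> p) m = (\<Oplus>\<^bsub>K\<^esub>x\<in>splits m. \<one>\<^bsub>poly_alg K V\<^esub> (fst x) \<otimes>\<^bsub>K\<^esub> p (snd x))"
    by (rule poly_mult_splits) (use c in \<open>auto simp: poly_ops\<close>)
  also have "\<dots> = (\<Oplus>\<^bsub>K\<^esub>x\<in>{({#} :: 'v multiset, m)}. p (snd x))"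
    by (rule K.add.finprod_mono_neutral_cong_right[OF finite_splits])
       (use c in \<open>auto simp: splits_def poly_ops\<close>)
  also have "\<dots> = p m" using c by simp
  finally show "(\<one>\<^bsub>poly_alg K V\<^esub> \<otimes>\<^bsub>poly_alg K V\<^esub> p) m = p m" .
qed

lemma poly_add_closed:
  assumes "p \<in> carrier (poly_alg K V)" "q \<in> carrier (poly_alg K V)"
  shows "p \<oplus>\<^bsub>poly_alg K V\<^esub> q \<in> carrier (poly_alg K V)"
proof -
  have "{m. p m \<oplus>\<^bsub>K\<^esub> q m \<noteq> \<zero>\<^bsub>K\<^esub>} \<subseteq> {m. p m \<noteq> \<zero>\<^bsub>K\<^esub>} \<union> {m. q m \<noteq> \<zero>\<^bsub>K\<^esub>}" by auto
  moreover have "finite ({m. p m \<noteq> \<zero>\<^bsub>K\<^esub>} \<union> {m. q m \<noteq> \<zero>\<^bsub>K\<^esub>})"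
    using assms by (auto simp: poly_carrier)
  ultimately have "finite {m. p m \<oplus>\<^bsub>K\<^esub> q m \<noteq> \<zero>\<^bsub>K\<^esub>}" by (rule finite_subset)
  moreover have "set_mset m \<subseteq> V" if "p m \<oplus>\<^bsub>K\<^esub> q m \<noteq> \<zero>\<^bsub>K\<^esub>" for m
  proof -
    have "p m \<noteq> \<zero>\<^bsub>K\<^esub> \<or> q m \<noteq> \<zero>\<^bsub>K\<^esub>" using that by auto
    then show ?thesis using assms unfolding poly_carrier by blast
  qed
  ultimately show ?thesis using assms unfolding poly_carrier poly_ops by blast
qed

lemma poly_smult_closed:
  assumes "c \<in> carrier K" "p \<in> carrier (poly_alg K V)"
  shows "c \<odot>\<^bsub>poly_alg K V\<^esub> p \<in> carrier (poly_alg K V)"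
proof -
  have *: "{m. c \<otimes>\<^bsub>K\<^esub> p m \<noteq> \<zero>\<^bsub>K\<^esub>} \<subseteq> {m. p m \<noteq> \<zero>\<^bsub>K\<^esub>}" using assms by auto
  moreover have "finite {m. p m \<noteq> \<zero>\<^bsub>K\<^esub>}"
    using assms by (auto simp: poly_carrier)
  ultimately have "finite {m. c \<otimes>\<^bsub>K\<^esub> p m \<noteq> \<zero>\<^bsub>K\<^esub>}" by (rule finite_subset)
  then show ?thesis using assms * unfolding poly_carrier poly_ops by blast
qed

lemma poly_algebra: "algebra K (poly_alg K (V :: 'v set))"
proof -
  let ?P = "poly_alg K V"
  have one: "\<one>\<^bsub>?P\<^esub> \<in> carrier ?P"
  proof -
    have "finite {m. (if m = {#} then \<one>\<^bsub>K\<^esub> else \<zero>\<^bsub>K\<^esub>) \<noteq> \<zero>\<^bsub>K\<^esub>}"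
      by (rule finite_subset[of _ "{{#}}"]) auto
    then show ?thesis by (auto simp: poly_carrier poly_ops split: if_splits)
  qed
  have ag: "abelian_group ?P"
  proof (rule abelian_groupI, goal_cases)
    case (6 x)
    show ?case
      by (rule bexI[of _ "(\<ominus>\<^bsub>K\<^esub> \<one>\<^bsub>K\<^esub>) \<odot>\<^bsub>?P\<^esub> x"])
         (use 6 in \<open>auto intro!: poly_smult_closed simp: poly_ops poly_carrier K.l_minus K.l_neg\<close>)
  qed (auto intro!: poly_add_closed, auto simp: poly_ops poly_carrier K.a_ac)
  have ld: "(x \<oplus>\<^bsub>?P\<^esub> y) \<otimes>\<^bsub>?P\<^esub> z = x \<otimes>\<^bsub>?P\<^esub> z \<oplus>\<^bsub>?P\<^esub> y \<otimes>\<^bsub>?P\<^esub> z"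
    if xyz: "x \<in> carrier ?P" "y \<in> carrier ?P" "z \<in> carrier ?P" for x y z
  proof
    fix m :: "'v multiset"
    have c: "\<And>m. x m \<in> carrier K" "\<And>m. y m \<in> carrier K" "\<And>m. z m \<in> carrier K"
      using xyz by (auto simp: poly_carrier)
    have "((x \<oplus>\<^bsub>?P\<^esub> y) \<otimes>\<^bsub>?P\<^esub> z) m
        = (\<Oplus>\<^bsub>K\<^esub>w\<in>splits m. x (fst w) \<otimes>\<^bsub>K\<^esub> z (snd w) \<oplus>\<^bsub>K\<^esub> y (fst w) \<otimes>\<^bsub>K\<^esub> z (snd w))"
      using c by (subst poly_mult_splits) (auto simp: poly_ops K.l_distr intro!: K.finsum_cong')
    also have "\<dots> = (x \<otimes>\<^bsub>?P\<^esub> z \<oplus>\<^bsub>?P\<^esub> y \<otimes>\<^bsub>?P\<^esub> z) m"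
      using c by (simp add: poly_ops(1) poly_mult_splits)
    finally show "((x \<oplus>\<^bsub>?P\<^esub> y) \<otimes>\<^bsub>?P\<^esub> z) m = (x \<otimes>\<^bsub>?P\<^esub> z \<oplus>\<^bsub>?P\<^esub> y \<otimes>\<^bsub>?P\<^esub> z) m" .
  qed
  have sm: "(a \<odot>\<^bsub>?P\<^esub> x) \<otimes>\<^bsub>?P\<^esub> y = a \<odot>\<^bsub>?P\<^esub> (x \<otimes>\<^bsub>?P\<^esub> y)"
    if axy: "a \<in> carrier K" "x \<in> carrier ?P" "y \<in> carrier ?P" for a x y
  proof
    fix m :: "'v multiset"
    have c: "\<And>m. x m \<in> carrier K" "\<And>m. y m \<in> carrier K"
      using axy by (auto simp: poly_carrier)
    have "((a \<odot>\<^bsub>?P\<^esub> x) \<otimes>\<^bsub>?P\<^esub> y) m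
        = (\<Oplus>\<^bsub>K\<^esub>w\<in>splits m. a \<otimes>\<^bsub>K\<^esub> (x (fst w) \<otimes>\<^bsub>K\<^esub> y (snd w)))"
      using c axy by (subst poly_mult_splits) (auto simp: poly_ops K.m_assoc intro!: K.finsum_cong')
    also have "\<dots> = (a \<odot>\<^bsub>?P\<^esub> (x \<otimes>\<^bsub>?P\<^esub> y)) m"
      using c axy finite_splits[of m] by (simp add: poly_ops(2) poly_mult_splits K.finsum_rdistr)
    finally show "((a \<odot>\<^bsub>?P\<^esub> x) \<otimes>\<^bsub>?P\<^esub> y) m = (a \<odot>\<^bsub>?P\<^esub> (x \<otimes>\<^bsub>?P\<^esub> y)) m" .
  qed
  have "cring ?P"
    by (intro cringI ag comm_monoidI)
       (use one ld in \<open>auto intro!: poly_mult_closed poly_mult_assoc poly_mult_comm poly_one_mult\<close>)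
  then show ?thesis
    by (intro algebraI K sm)
       (auto intro!: poly_smult_closed, auto simp: poly_ops poly_carrier K.l_distr K.r_distr K.m_assoc)
qed

lemma poly_var_closed:
  assumes "v \<in> V"
  shows "poly_var K v \<in> carrier (poly_alg K V)"
proof -
  have "finite {m. poly_var K v m \<noteq> \<zero>\<^bsub>K\<^esub>}"
    by (rule finite_subset[of _ "{{#v#}}"]) (auto simp: poly_var_def)
  then show ?thesis using assms by (auto simp: poly_carrier poly_var_def split: if_splits)
qed

lemma mon_eval_closed_on:
  assumes "algebra K B" "\<phi> \<in> V \<rightarrow> carrier B" "set_mset m \<subseteq> V"
  shows "mon_eval B \<phi> m \<in> carrier B"
proof -
  interpret B: algebra K B by fact
  show ?thesis by (rule mon_eval_closed) (use assms in \<open>auto intro: B.comm_monoid_axioms\<close>)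
qed

lemma poly_eval_on:
  assumes B: "algebra K B" and \<phi>: "\<phi> \<in> V \<rightarrow> carrier B"
    and F: "finite F" "\<And>m. p m \<noteq> \<zero>\<^bsub>K\<^esub> \<Longrightarrow> m \<in> F" "\<And>m. m \<in> F \<Longrightarrow> set_mset m \<subseteq> V"
    and p: "\<And>m. p m \<in> carrier K"
  shows "poly_eval K B \<phi> p = (\<Oplus>\<^bsub>B\<^esub>m\<in>F. p m \<odot>\<^bsub>B\<^esub> mon_eval B \<phi> m)"
proof -
  interpret B: algebra K B by fact
  have c: "\<And>m. m \<in> F \<Longrightarrow> mon_eval B \<phi> m \<in> carrier B"
    using mon_eval_closed_on[OF B \<phi>] F by blast
  show ?thesis unfolding poly_eval_def
    by (rule B.add.finprod_mono_neutral_cong_left[OF F(1)])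
       (use F p c in auto)
qed

lemma poly_eval_cong:
  assumes B: "algebra K B" and \<phi>: "\<phi> \<in> V \<rightarrow> carrier B" and eq: "\<And>v. v \<in> V \<Longrightarrow> \<phi> v = \<psi> v"
    and p: "p \<in> carrier (poly_alg K V)"
  shows "poly_eval K B \<phi> p = poly_eval K B \<psi> p"
proof -
  interpret B: algebra K B by fact
  have m: "mon_eval B \<phi> m = mon_eval B \<psi> m" if "set_mset m \<subseteq> V" for m
    unfolding mon_eval_def by (rule B.finprod_cong') (use that eq \<phi> in \<open>auto simp: eq[symmetric] subset_iff Pi_def\<close>)
  show ?thesis unfolding poly_eval_def
    by (rule B.M.finsum_cong')
       (use p m mon_eval_closed_on[OF B \<phi>] in \<open>auto simp: poly_carrier m[symmetric]\<close>)
qed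

lemma poly_eval_hom:
  fixes V :: "'v set"
  assumes B: "algebra K B" and \<phi>: "\<phi> \<in> V \<rightarrow> carrier B"
  shows "poly_eval K B \<phi> \<in> alg_hom K (poly_alg K V) B"
proof -
  interpret B: algebra K B by fact
  let ?P = "poly_alg K V" and ?e = "poly_eval K B \<phi>" and ?m = "mon_eval B \<phi>"
  let ?s = "\<lambda>p. {m. p m \<noteq> \<zero>\<^bsub>K\<^esub>}"
  note ev = poly_eval_on[OF B \<phi>] and mc = mon_eval_closed_on[OF B \<phi>]
  have c: "p m \<in> carrier K" "finite (?s p)" "p m \<noteq> \<zero>\<^bsub>K\<^esub> \<Longrightarrow> set_mset m \<subseteq> V"
    if "p \<in> carrier ?P" for p m using that by (auto simp: poly_carrier)
  have cl: "?e p \<in> carrier B" if "p \<in> carrier ?P" for p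
    unfolding poly_eval_def by (rule B.M.finsum_closed) (use c[OF that] mc in auto)
  have one: "?e \<one>\<^bsub>?P\<^esub> = \<one>\<^bsub>B\<^esub>"
  proof -
    have "?e \<one>\<^bsub>?P\<^esub> = (\<Oplus>\<^bsub>B\<^esub>m\<in>{{#}}. \<one>\<^bsub>?P\<^esub> m \<odot>\<^bsub>B\<^esub> ?m m)"
      by (rule ev) (auto simp: poly_ops split: if_splits)
    also have "\<dots> = \<one>\<^bsub>B\<^esub>"
      by (simp add: poly_ops mon_eval_empty B.comm_monoid_axioms)
    finally show ?thesis .
  qed
  have add: "?e (p \<oplus>\<^bsub>?P\<^esub> q) = ?e p \<oplus>\<^bsub>B\<^esub> ?e q" if pq: "p \<in> carrier ?P" "q \<in> carrier ?P" for p q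
  proof -
    let ?F = "?s p \<union> ?s q"
    have F: "finite ?F" "\<And>m. m \<in> ?F \<Longrightarrow> set_mset m \<subseteq> V" using c[OF pq(1)] c[OF pq(2)] by blast+
    have "?e (p \<oplus>\<^bsub>?P\<^esub> q) = (\<Oplus>\<^bsub>B\<^esub>m\<in>?F. (p m \<oplus>\<^bsub>K\<^esub> q m) \<odot>\<^bsub>B\<^esub> ?m m)"
      unfolding poly_ops by (rule ev[OF F(1) _ F(2)]) (use c pq in auto)
    also have "\<dots> = (\<Oplus>\<^bsub>B\<^esub>m\<in>?F. p m \<odot>\<^bsub>B\<^esub> ?m m \<oplus>\<^bsub>B\<^esub> q m \<odot>\<^bsub>B\<^esub> ?m m)"
      by (rule B.M.finsum_cong') (use F c pq mc in \<open>auto simp: B.smult_l_distr\<close>)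
    also have "\<dots> = (\<Oplus>\<^bsub>B\<^esub>m\<in>?F. p m \<odot>\<^bsub>B\<^esub> ?m m) \<oplus>\<^bsub>B\<^esub> (\<Oplus>\<^bsub>B\<^esub>m\<in>?F. q m \<odot>\<^bsub>B\<^esub> ?m m)"
      by (rule B.M.finsum_addf) (use F c pq mc in auto)
    also have "(\<Oplus>\<^bsub>B\<^esub>m\<in>?F. p m \<odot>\<^bsub>B\<^esub> ?m m) = ?e p"
      by (rule ev[OF F(1) _ F(2), symmetric]) (use c pq in auto)
    also have "(\<Oplus>\<^bsub>B\<^esub>m\<in>?F. q m \<odot>\<^bsub>B\<^esub> ?m m) = ?e q"
      by (rule ev[OF F(1) _ F(2), symmetric]) (use c pq in auto)
    finally show ?thesis .
  qed
  have smult: "?e (k \<odot>\<^bsub>?P\<^esub> p) = k \<odot>\<^bsub>B\<^esub> ?e p" if kp: "k \<in> carrier K" "p \<in> carrier ?P" for k p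
  proof -
    have "?e (k \<odot>\<^bsub>?P\<^esub> p) = (\<Oplus>\<^bsub>B\<^esub>m\<in>?s p. (k \<otimes>\<^bsub>K\<^esub> p m) \<odot>\<^bsub>B\<^esub> ?m m)"
      unfolding poly_ops by (rule ev) (use c kp in auto)
    also have "\<dots> = (\<Oplus>\<^bsub>B\<^esub>m\<in>?s p. k \<odot>\<^bsub>B\<^esub> (p m \<odot>\<^bsub>B\<^esub> ?m m))"
      by (rule B.M.finsum_cong') (use c kp mc in \<open>auto simp: B.smult_assoc1\<close>)
    also have "\<dots> = k \<odot>\<^bsub>B\<^esub> ?e p"
      unfolding poly_eval_def
      by (rule B.finsum_smult_ldistr[symmetric]) (use c kp mc in auto)
    finally show ?thesis .
  qed
  have mult: "?e (p \<otimes>\<^bsub>?P\<^esub> q) = ?e p \<otimes>\<^bsub>B\<^esub> ?e q" if pq: "p \<in> carrier ?P" "q \<in> carrier ?P" for p q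
  proof -
    let ?S = "?s p \<times> ?s q" and ?add = "\<lambda>x. fst x + snd x"
    let ?F = "?add ` ?S" and ?T = "\<lambda>m. {x \<in> ?S. ?add x = m}"
    note cp = c[OF pq(1)] and cq = c[OF pq(2)]
    have fin: "finite ?S" using cp cq by auto
    have SV: "set_mset (fst x) \<subseteq> V" "set_mset (snd x) \<subseteq> V" if "x \<in> ?S" for x
      using that cp(3)[of "fst x"] cq(3)[of "snd x"] by auto
    have F: "finite ?F" using fin by blast
    have FV: "set_mset m \<subseteq> V" if m: "m \<in> ?F" for m
    proof -
      obtain x where "x \<in> ?S" "m = ?add x" using m by (elim imageE)
      then show ?thesis using SV[of x] by simp
    qed
    have mF: "?m m \<in> carrier B" if "m \<in> ?F" for m using mc FV[OF that] by blast
    have m12: "?m (fst x) \<in> carrier B" "?m (snd x) \<in> carrier B" if "x \<in> ?S" for x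
      using mc SV[OF that] by blast+
    have mS: "?m (a + b) \<in> carrier B" if "p a \<noteq> \<zero>\<^bsub>K\<^esub>" "q b \<noteq> \<zero>\<^bsub>K\<^esub>" for a b
      by (rule mF) (use that in force)
    have pqc: "(p \<otimes>\<^bsub>?P\<^esub> q) m \<in> carrier K" for m
      using poly_mult_closed[OF pq] by (auto simp: poly_carrier)
    have eq: "(p \<otimes>\<^bsub>?P\<^esub> q) m = (\<Oplus>\<^bsub>K\<^esub>x\<in>?T m. p (fst x) \<otimes>\<^bsub>K\<^esub> q (snd x))" for m
      by (rule poly_mult_fin) (use cp cq in auto)
    have supp: "m \<in> ?F" if "(p \<otimes>\<^bsub>?P\<^esub> q) m \<noteq> \<zero>\<^bsub>K\<^esub>" for m
    proof (rule ccontr)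
      assume "m \<notin> ?F"
      then have e: "?T m = {}" by blast
      show False using that unfolding eq e by simp
    qed
    have term1: "finsum K f X \<odot>\<^bsub>B\<^esub> b = (\<Oplus>\<^bsub>B\<^esub>x\<in>X. f x \<odot>\<^bsub>B\<^esub> b)"
      if "finite X" "b \<in> carrier B" "f \<in> X \<rightarrow> carrier K" for X b
        and f :: "'v multiset \<times> 'v multiset \<Rightarrow> 'k"
      using that(1,3)
    proof induction
      case (insert x X)
      then have "f x \<in> carrier K" "f \<in> X \<rightarrow> carrier K" "(\<lambda>x. f x \<odot>\<^bsub>B\<^esub> b) \<in> X \<rightarrow> carrier B"
        using that(2) by auto
      then show ?case using insert that(2)
        by (simp add: B.smult_l_distr K.finsum_closed)
    qed (use that in simp)
    have "?e (p \<otimes>\<^bsub>?P\<^esub> q) = (\<Oplus>\<^bsub>B\<^esub>m\<in>?F. (p \<otimes>\<^bsub>?P\<^esub> q) m \<odot>\<^bsub>B\<^esub> ?m m)"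
      by (rule ev[OF F _ FV]) (use supp pqc in auto)
    also have "\<dots> = (\<Oplus>\<^bsub>B\<^esub>m\<in>?F. \<Oplus>\<^bsub>B\<^esub>x\<in>?T m. (p (fst x) \<otimes>\<^bsub>K\<^esub> q (snd x)) \<odot>\<^bsub>B\<^esub> ?m m)"
    proof (rule B.M.finsum_cong')
      fix m assume m: "m \<in> ?F"
      show "(p \<otimes>\<^bsub>?P\<^esub> q) m \<odot>\<^bsub>B\<^esub> ?m m = (\<Oplus>\<^bsub>B\<^esub>x\<in>?T m. (p (fst x) \<otimes>\<^bsub>K\<^esub> q (snd x)) \<odot>\<^bsub>B\<^esub> ?m m)"
        unfolding eq by (rule term1) (use fin mF[OF m] cp cq in auto)
    qed (use cp cq mF in \<open>auto intro!: B.M.finsum_closed\<close>)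
    also have "\<dots> = (\<Oplus>\<^bsub>B\<^esub>y\<in>(SIGMA m:?F. ?T m). (p (fst (snd y)) \<otimes>\<^bsub>K\<^esub> q (snd (snd y))) \<odot>\<^bsub>B\<^esub> ?m (fst y))"
      by (rule B.M.finsum_Sigma'[OF F]) (use fin cp cq mF in auto)
    also have "(SIGMA m:?F. ?T m) = (\<lambda>x. (?add x, x)) ` ?S" by (auto simp: image_iff)
    also have "(\<Oplus>\<^bsub>B\<^esub>y\<in>(\<lambda>x. (?add x, x)) ` ?S. (p (fst (snd y)) \<otimes>\<^bsub>K\<^esub> q (snd (snd y))) \<odot>\<^bsub>B\<^esub> ?m (fst y))
        = (\<Oplus>\<^bsub>B\<^esub>x\<in>?S. (p (fst x) \<otimes>\<^bsub>K\<^esub> q (snd x)) \<odot>\<^bsub>B\<^esub> ?m (?add x))"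
      by (subst B.M.finsum_reindex) (use cp cq mS in \<open>auto simp: inj_on_def\<close>)
    also have "\<dots> = (\<Oplus>\<^bsub>B\<^esub>x\<in>?S. (p (fst x) \<odot>\<^bsub>B\<^esub> ?m (fst x)) \<otimes>\<^bsub>B\<^esub> (q (snd x) \<odot>\<^bsub>B\<^esub> ?m (snd x)))"
    proof (rule B.M.finsum_cong')
      fix x assume x: "x \<in> ?S"
      have u: "?m (?add x) = ?m (fst x) \<otimes>\<^bsub>B\<^esub> ?m (snd x)"
        by (rule mon_eval_union[OF B.comm_monoid_axioms]) (use SV[OF x] \<phi> in auto)
      have k: "p (fst x) \<in> carrier K" "q (snd x) \<in> carrier K" using cp cq by auto
      have "(p (fst x) \<odot>\<^bsub>B\<^esub> ?m (fst x)) \<otimes>\<^bsub>B\<^esub> (q (snd x) \<odot>\<^bsub>B\<^esub> ?m (snd x))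
          = p (fst x) \<odot>\<^bsub>B\<^esub> (?m (fst x) \<otimes>\<^bsub>B\<^esub> (q (snd x) \<odot>\<^bsub>B\<^esub> ?m (snd x)))"
        using k m12[OF x] by (simp add: B.smult_assoc2)
      also have "?m (fst x) \<otimes>\<^bsub>B\<^esub> (q (snd x) \<odot>\<^bsub>B\<^esub> ?m (snd x)) = q (snd x) \<odot>\<^bsub>B\<^esub> (?m (fst x) \<otimes>\<^bsub>B\<^esub> ?m (snd x))"
        using k m12[OF x] by (metis B.m_comm B.smult_assoc2 B.smult_closed)
      finally show "(p (fst x) \<otimes>\<^bsub>K\<^esub> q (snd x)) \<odot>\<^bsub>B\<^esub> ?m (?add x)
          = (p (fst x) \<odot>\<^bsub>B\<^esub> ?m (fst x)) \<otimes>\<^bsub>B\<^esub> (q (snd x) \<odot>\<^bsub>B\<^esub> ?m (snd x))"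
        using k m12[OF x] unfolding u by (simp add: B.smult_assoc1)
    qed (use cp cq m12 in auto)
    also have "\<dots> = (\<Oplus>\<^bsub>B\<^esub>m\<in>?s p. \<Oplus>\<^bsub>B\<^esub>n\<in>?s q. (p m \<odot>\<^bsub>B\<^esub> ?m m) \<otimes>\<^bsub>B\<^esub> (q n \<odot>\<^bsub>B\<^esub> ?m n))"
      by (rule B.M.finsum_Sigma'[symmetric]) (use cp cq mc in auto)
    also have "\<dots> = (\<Oplus>\<^bsub>B\<^esub>m\<in>?s p. (p m \<odot>\<^bsub>B\<^esub> ?m m) \<otimes>\<^bsub>B\<^esub> ?e q)"
      unfolding poly_eval_def
      by (rule B.M.finsum_cong')
         (use cp cq mc in \<open>auto intro!: B.M.finsum_closed B.finsum_rdistr[symmetric]\<close>)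
    also have "\<dots> = ?e p \<otimes>\<^bsub>B\<^esub> ?e q"
      using cl[OF pq(2)] cp mc unfolding poly_eval_def[of K B \<phi> p]
      by (intro B.finsum_ldistr[symmetric]) auto
    finally show ?thesis .
  qed
  show ?thesis
    unfolding alg_hom_def using cl one add smult mult by (auto intro!: ring_hom_memI)
qed

lemma poly_eval_var:
  assumes B: "algebra K B" and \<phi>: "\<phi> \<in> V \<rightarrow> carrier B" and v: "v \<in> V"
  shows "poly_eval K B \<phi> (poly_var K v) = \<phi> v"
proof -
  interpret B: algebra K B by fact
  have \<phi>v: "\<phi> v \<in> carrier B" using \<phi> v by auto
  have "poly_eval K B \<phi> (poly_var K v) = (\<Oplus>\<^bsub>B\<^esub>m\<in>{{#v#}}. poly_var K v m \<odot>\<^bsub>B\<^esub> mon_eval B \<phi> m)"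
    by (rule poly_eval_on[OF B \<phi>]) (use v in \<open>auto simp: poly_var_def split: if_splits\<close>)
  also have "\<dots> = \<phi> v"
    using \<phi>v by (simp add: poly_var_def mon_eval_single B.comm_monoid_axioms)
  finally show ?thesis .
qed

lemma alg_hom_poly_eval:
  assumes B: "algebra K B" and C: "algebra K C" and h: "h \<in> alg_hom K B C"
    and \<phi>: "\<phi> \<in> V \<rightarrow> carrier B" and p: "p \<in> carrier (poly_alg K V)"
  shows "h (poly_eval K B \<phi> p) = poly_eval K C (\<lambda>v. h (\<phi> v)) p"
proof -
  interpret B: algebra K B by fact
  interpret C: algebra K C by fact
  interpret h: ring_hom_cring B C h
    by unfold_locales (use h in \<open>simp add: alg_hom_def\<close>)
  have pow: "h (x [^]\<^bsub>B\<^esub> n) = h x [^]\<^bsub>C\<^esub> n" if "x \<in> carrier B" for x and n :: nat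
    using that by (induction n) auto
  have mc: "mon_eval B \<phi> m \<in> carrier B" if "p m \<noteq> \<zero>\<^bsub>K\<^esub>" for m
    using mon_eval_closed_on[OF B \<phi>] p that by (auto simp: poly_carrier)
  have m: "h (mon_eval B \<phi> m) = mon_eval C (\<lambda>v. h (\<phi> v)) m" if "p m \<noteq> \<zero>\<^bsub>K\<^esub>" for m
  proof -
    have V: "set_mset m \<subseteq> V" using p that by (auto simp: poly_carrier)
    have "h (mon_eval B \<phi> m) = (\<Otimes>\<^bsub>C\<^esub>v\<in>set_mset m. (h \<circ> (\<lambda>v. \<phi> v [^]\<^bsub>B\<^esub> count m v)) v)"
      unfolding mon_eval_def by (rule h.hom_finprod) (use V \<phi> in auto)
    also have "\<dots> = mon_eval C (\<lambda>v. h (\<phi> v)) m"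
      unfolding mon_eval_def by (rule C.finprod_cong') (use V \<phi> in \<open>auto simp: pow subset_iff Pi_def\<close>)
    finally show ?thesis .
  qed
  have "h (poly_eval K B \<phi> p) = (\<Oplus>\<^bsub>C\<^esub>m\<in>{m. p m \<noteq> \<zero>\<^bsub>K\<^esub>}. (h \<circ> (\<lambda>m. p m \<odot>\<^bsub>B\<^esub> mon_eval B \<phi> m)) m)"
    unfolding poly_eval_def by (rule h.hom_finsum) (use p mc in \<open>auto simp: poly_carrier\<close>)
  also have "\<dots> = poly_eval K C (\<lambda>v. h (\<phi> v)) p"
    unfolding poly_eval_def
  proof (rule C.M.finsum_cong')
    fix n assume "n \<in> {m. p m \<noteq> \<zero>\<^bsub>K\<^esub>}"
    then show "(h \<circ> (\<lambda>m. p m \<odot>\<^bsub>B\<^esub> mon_eval B \<phi> m)) n = p n \<odot>\<^bsub>C\<^esub> mon_eval C (\<lambda>v. h (\<phi> v)) n"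
      using h p mc by (auto simp: alg_hom_def poly_carrier m[symmetric])
  qed (use p mc in \<open>auto simp: m[symmetric] poly_carrier\<close>)
  finally show ?thesis .
qed

lemma mon_eval_poly_var:
  assumes "set_mset m \<subseteq> (V :: 'v set)"
  shows "mon_eval (poly_alg K V) (poly_var K) m = (\<lambda>n. if n = m then \<one>\<^bsub>K\<^esub> else \<zero>\<^bsub>K\<^esub>)"
  using assms
proof (induction m)
  case empty
  interpret P: algebra K "poly_alg K V" by (rule poly_algebra)
  show ?case by (simp add: mon_eval_empty P.comm_monoid_axioms poly_ops)
next
  case (add v m)
  interpret P: algebra K "poly_alg K V" by (rule poly_algebra)
  have "mon_eval (poly_alg K V) (poly_var K) ({#v#} + m)
      = poly_var K v \<otimes>\<^bsub>poly_alg K V\<^esub> (\<lambda>n. if n = m then \<one>\<^bsub>K\<^esub> else \<zero>\<^bsub>K\<^esub>)"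
    by (subst mon_eval_union[OF P.comm_monoid_axioms])
       (use add in \<open>auto simp: mon_eval_single P.comm_monoid_axioms poly_var_closed\<close>)
  also have "\<dots> = (\<lambda>n. if n = add_mset v m then \<one>\<^bsub>K\<^esub> else \<zero>\<^bsub>K\<^esub>)"
  proof
    fix n :: "'v multiset"
    have "(poly_var K v \<otimes>\<^bsub>poly_alg K V\<^esub> (\<lambda>n. if n = m then \<one>\<^bsub>K\<^esub> else \<zero>\<^bsub>K\<^esub>)) n
       = (\<Oplus>\<^bsub>K\<^esub>x\<in>{x\<in>{{#v#}} \<times> {m}. fst x + snd x = n}. poly_var K v (fst x) \<otimes>\<^bsub>K\<^esub> (if snd x = m then \<one>\<^bsub>K\<^esub> else \<zero>\<^bsub>K\<^esub>))"
      by (rule poly_mult_fin) (auto simp: poly_var_def split: if_splits)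
    also have "{x\<in>{{#v#}} \<times> {m}. fst x + snd x = n} = (if n = add_mset v m then {({#v#}, m)} else {})"
      by auto
    finally show "(poly_var K v \<otimes>\<^bsub>poly_alg K V\<^esub> (\<lambda>n. if n = m then \<one>\<^bsub>K\<^esub> else \<zero>\<^bsub>K\<^esub>)) n
       = (if n = add_mset v m then \<one>\<^bsub>K\<^esub> else \<zero>\<^bsub>K\<^esub>)"
      by (simp add: poly_var_def)
  qed
  finally show ?case by simp
qed

lemma poly_expand:
  assumes p: "p \<in> carrier (poly_alg K (V :: 'v set))"
  shows "poly_eval K (poly_alg K V) (poly_var K) p = p"
proof
  fix n :: "'v multiset"
  interpret P: algebra K "poly_alg K V" by (rule poly_algebra)
  have fs: "(finsum (poly_alg K V) f F) n = (\<Oplus>\<^bsub>K\<^esub>x\<in>F. f x n)"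
    if "finite F" "f \<in> F \<rightarrow> carrier (poly_alg K V)" for f :: "'v multiset \<Rightarrow> _" and F
    using that
  proof (induction F)
    case (insert x F)
    then have "\<And>y. y \<in> insert x F \<Longrightarrow> f y n \<in> carrier K" by (auto simp: poly_carrier Pi_def)
    with insert show ?case by (auto simp: Pi_def poly_ops)
  qed (simp add: poly_ops)
  let ?s = "{m. p m \<noteq> \<zero>\<^bsub>K\<^esub>}"
  have s: "finite ?s" "\<And>m. m \<in> ?s \<Longrightarrow> set_mset m \<subseteq> V" "\<And>m. p m \<in> carrier K"
    using p by (auto simp: poly_carrier)
  have v: "poly_var K \<in> V \<rightarrow> carrier (poly_alg K V)" by (auto intro: poly_var_closed)
  have "poly_eval K (poly_alg K V) (poly_var K) p n
      = (\<Oplus>\<^bsub>K\<^esub>m\<in>?s. (p m \<odot>\<^bsub>poly_alg K V\<^esub> mon_eval (poly_alg K V) (poly_var K) m) n)"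
    unfolding poly_eval_def
    by (rule fs[OF s(1)]) (use s mon_eval_closed_on[OF poly_algebra v] in auto)
  also have "\<dots> = (\<Oplus>\<^bsub>K\<^esub>m\<in>?s. if n = m then p m else \<zero>\<^bsub>K\<^esub>)"
    by (rule K.finsum_cong') (use s in \<open>auto simp: poly_ops mon_eval_poly_var\<close>)
  also have "\<dots> = p n"
  proof (cases "p n = \<zero>\<^bsub>K\<^esub>")
    case True
    then have "(\<Oplus>\<^bsub>K\<^esub>m\<in>?s. if n = m then p m else \<zero>\<^bsub>K\<^esub>) = (\<Oplus>\<^bsub>K\<^esub>m\<in>?s. \<zero>\<^bsub>K\<^esub>)"
      by (intro K.finsum_cong') auto
    then show ?thesis using True by simp
  next
    case False
    then show ?thesis using s by (intro K.finsum_singleton) auto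
  qed
  finally show "poly_eval K (poly_alg K V) (poly_var K) p n = p n" .
qed

lemma poly_hom_unique:
  assumes B: "algebra K B" and h: "h \<in> alg_hom K (poly_alg K V) B" "h' \<in> alg_hom K (poly_alg K V) B"
    and eq: "\<And>v. v \<in> V \<Longrightarrow> h (poly_var K v) = h' (poly_var K v)"
    and p: "p \<in> carrier (poly_alg K V)"
  shows "h p = h' p"
proof -
  have v: "poly_var K \<in> V \<rightarrow> carrier (poly_alg K V)" by (auto intro: poly_var_closed)
  have *: "g p = poly_eval K B (\<lambda>v. g (poly_var K v)) p" if "g \<in> alg_hom K (poly_alg K V) B" for g
    using alg_hom_poly_eval[OF poly_algebra B that v p] by (simp add: poly_expand[OF p])
  show ?thesis unfolding *[OF h(1)] *[OF h(2)]
    by (rule poly_eval_cong[OF B _ eq p])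
       (use h(1) v in \<open>auto simp: alg_hom_def ring_hom_def\<close>)
qed

lemma alg_hom_comp:
  assumes "g \<in> alg_hom K X Y" "h \<in> alg_hom K Y Z"
  shows "(\<lambda>x. h (g x)) \<in> alg_hom K X Z"
proof -
  have "g \<in> carrier X \<rightarrow> carrier Y" using assms by (auto simp: alg_hom_def ring_hom_def)
  then show ?thesis
    using assms ring_hom_trans[of g X Y h Z] by (auto simp: alg_hom_def comp_def Pi_def)
qed

context
  fixes I :: "('o, 'r) small_cat" and S :: "'o \<Rightarrow> 's set"
  assumes I: "small_category I"
begin

lemma small_categoryD:
  "f \<in> Arr I \<Longrightarrow> Dom I f \<in> Obj I" "f \<in> Arr I \<Longrightarrow> Cod I f \<in> Obj I"
  "i \<in> Obj I \<Longrightarrow> Ident I i \<in> Arr I" "i \<in> Obj I \<Longrightarrow> Dom I (Ident I i) = i"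
  "i \<in> Obj I \<Longrightarrow> Cod I (Ident I i) = i"
  "f \<in> Arr I \<Longrightarrow> g \<in> Arr I \<Longrightarrow> Dom I g = Cod I f \<Longrightarrow> Comp I g f \<in> Arr I"
  "f \<in> Arr I \<Longrightarrow> g \<in> Arr I \<Longrightarrow> Dom I g = Cod I f \<Longrightarrow> Dom I (Comp I g f) = Dom I f"
  "f \<in> Arr I \<Longrightarrow> g \<in> Arr I \<Longrightarrow> Dom I g = Cod I f \<Longrightarrow> Cod I (Comp I g f) = Cod I g"
  "f \<in> Arr I \<Longrightarrow> Comp I f (Ident I (Dom I f)) = f"
  "f \<in> Arr I \<Longrightarrow> Comp I (Ident I (Cod I f)) f = f"
  "f \<in> Arr I \<Longrightarrow> g \<in> Arr I \<Longrightarrow> h \<in> Arr I \<Longrightarrow> Dom I g = Cod I f \<Longrightarrow> Dom I h = Cod I g \<Longrightarrow>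
     Comp I h (Comp I g f) = Comp I (Comp I h g) f"
  using I unfolding small_category_def by auto

lemma free_gens_shift:
  assumes "g \<in> Arr I"
  shows "(\<lambda>(f, s). poly_var K (Comp I g f, s))
           \<in> free_gens I S (Dom I g) \<rightarrow> carrier (poly_alg K (free_gens I S (Cod I g)))"
  using assms by (auto simp: free_gens_def small_categoryD intro!: poly_var_closed)

lemma free_ar_var:
  assumes "g \<in> Arr I" "(f, s) \<in> free_gens I S (Dom I g)"
  shows "ar (free_diagram K I S) g (poly_var K (f, s)) = poly_var K (Comp I g f, s)"
  using poly_eval_var[OF poly_algebra free_gens_shift[OF assms(1)] assms(2)]
  by (simp add: free_diagram_def)

lemma free_ar_hom:
  assumes "g \<in> Arr I"
  shows "ar (free_diagram K I S) g
    \<in> alg_hom K (ob (free_diagram K I S) (Dom I g)) (ob (free_diagram K I S) (Cod I g))"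
  using poly_eval_hom[OF poly_algebra free_gens_shift[OF assms]]
  by (simp add: free_diagram_def)

lemma free_ob: "ob (free_diagram K I S) i = poly_alg K (free_gens I S i)"
  by (simp add: free_diagram_def)

lemma free_diagram_algebra: "algebra_diagram K I (free_diagram K I S)"
proof -
  let ?F = "free_diagram K I S"
  note hom = free_ar_hom[unfolded free_ob]
  have id: "ar ?F (Ident I i) x = x" if i: "i \<in> Obj I" and x: "x \<in> carrier (ob ?F i)" for i x
  proof (rule poly_hom_unique[OF poly_algebra _ _ _ x[unfolded free_ob], where h' = "\<lambda>x. x"])
    show "ar ?F (Ident I i) \<in> alg_hom K (poly_alg K (free_gens I S i)) (poly_alg K (free_gens I S i))"
      using hom[of "Ident I i"] i by (simp add: small_categoryD)
    show "(\<lambda>x. x) \<in> alg_hom K (poly_alg K (free_gens I S i)) (poly_alg K (free_gens I S i))"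
      by (auto simp: alg_hom_def intro!: ring_hom_memI)
    fix v assume "v \<in> free_gens I S i"
    then obtain f s where v: "v = (f, s)" "(f, s) \<in> free_gens I S i" by (cases v) auto
    then show "ar ?F (Ident I i) (poly_var K v) = poly_var K v"
      using i free_ar_var[of "Ident I i" f s] small_categoryD(10)[of f] by (auto simp: small_categoryD free_gens_def)
  qed
  have comp: "ar ?F (Comp I g f) x = ar ?F g (ar ?F f x)"
    if f: "f \<in> Arr I" and g: "g \<in> Arr I" and d: "Dom I g = Cod I f"
      and x: "x \<in> carrier (ob ?F (Dom I f))" for f g x
  proof (rule poly_hom_unique[OF poly_algebra _ _ _ x[unfolded free_ob]])
    show "ar ?F (Comp I g f)
        \<in> alg_hom K (poly_alg K (free_gens I S (Dom I f))) (poly_alg K (free_gens I S (Cod I g)))"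
      using hom[of "Comp I g f"] f g d by (simp add: small_categoryD)
    show "(\<lambda>x. ar ?F g (ar ?F f x))
        \<in> alg_hom K (poly_alg K (free_gens I S (Dom I f))) (poly_alg K (free_gens I S (Cod I g)))"
      using alg_hom_comp[OF hom[OF f]] hom[OF g] d by simp
    fix v assume "v \<in> free_gens I S (Dom I f)"
    then obtain k s where v: "v = (k, s)" "(k, s) \<in> free_gens I S (Dom I f)" by (cases v) auto
    then have "(Comp I f k, s) \<in> free_gens I S (Dom I g)"
      using f g d by (auto simp: free_gens_def small_categoryD)
    moreover have "Comp I (Comp I g f) k = Comp I g (Comp I f k)"
      using v f g d by (auto simp: free_gens_def small_categoryD)
    ultimately show "ar ?F (Comp I g f) (poly_var K v) = ar ?F g (ar ?F f (poly_var K v))"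
      using f g d v by (simp add: free_ar_var small_categoryD)
  qed
  show ?thesis
    unfolding algebra_diagram_def functorial_def
    using id comp free_ar_hom poly_algebra
    by (auto simp: free_ob alg_hom_def ring_hom_def)
qed

theorem free_diagram_adjunction:
  assumes B: "algebra_diagram K I B"
    and u: "\<And>i. i \<in> Obj I \<Longrightarrow> u i \<in> S i \<rightarrow> carrier (ob B i)"
  shows "diagram_hom K I (free_diagram K I S) B (free_lift K I B u)"
    and "\<And>i s. i \<in> Obj I \<Longrightarrow> s \<in> S i \<Longrightarrow> free_lift K I B u i (free_unit K I i s) = u i s"
    and "\<And>h i x. \<lbrakk>diagram_hom K I (free_diagram K I S) B h;
            \<And>i s. i \<in> Obj I \<Longrightarrow> s \<in> S i \<Longrightarrow> h i (free_unit K I i s) = u i s;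
            i \<in> Obj I; x \<in> carrier (ob (free_diagram K I S) i)\<rbrakk>
          \<Longrightarrow> h i x = free_lift K I B u i x"
proof -
  let ?F = "free_diagram K I S" and ?l = "free_lift K I B u"
  have Bi: "algebra K (ob B i)" if "i \<in> Obj I" for i using B that by (auto simp: algebra_diagram_def)
  have Bf: "ar B f \<in> alg_hom K (ob B (Dom I f)) (ob B (Cod I f))" if "f \<in> Arr I" for f
    using B that by (auto simp: algebra_diagram_def)
  have Bm: "ar B f x \<in> carrier (ob B (Cod I f))" if "f \<in> Arr I" "x \<in> carrier (ob B (Dom I f))" for f x
    using Bf[OF that(1)] that by (auto simp: alg_hom_def ring_hom_def)
  have v: "(\<lambda>(f, s). ar B f (u (Dom I f) s)) \<in> free_gens I S i \<rightarrow> carrier (ob B i)" for i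
    using u small_categoryD(1) by (fastforce simp: free_gens_def intro!: Bm)
  have l: "?l i \<in> alg_hom K (poly_alg K (free_gens I S i)) (ob B i)" if "i \<in> Obj I" for i
    unfolding free_lift_def by (rule poly_eval_hom[OF Bi[OF that] v])
  have lv: "?l i (poly_var K (f, s)) = ar B f (u (Dom I f) s)"
    if "i \<in> Obj I" "(f, s) \<in> free_gens I S i" for i f s
    using poly_eval_var[OF Bi[OF that(1)] v that(2)] by (simp add: free_lift_def)
  have nat: "ar B g (?l (Dom I g) x) = ?l (Cod I g) (ar ?F g x)"
    if g: "g \<in> Arr I" and x: "x \<in> carrier (ob ?F (Dom I g))" for g x
  proof (rule poly_hom_unique[OF Bi[OF small_categoryD(2)[OF g]] _ _ _ x[unfolded free_ob]])
    show "(\<lambda>x. ar B g (?l (Dom I g) x)) \<in> alg_hom K (poly_alg K (free_gens I S (Dom I g))) (ob B (Cod I g))"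
      by (rule alg_hom_comp[OF l[OF small_categoryD(1)[OF g]] Bf[OF g]])
    show "(\<lambda>x. ?l (Cod I g) (ar ?F g x)) \<in> alg_hom K (poly_alg K (free_gens I S (Dom I g))) (ob B (Cod I g))"
      by (rule alg_hom_comp[OF free_ar_hom[OF g, unfolded free_ob] l[OF small_categoryD(2)[OF g]]])
    fix w assume "w \<in> free_gens I S (Dom I g)"
    then obtain f s where w: "w = (f, s)" "(f, s) \<in> free_gens I S (Dom I g)" by (cases w) auto
    then have f: "f \<in> Arr I" "Cod I f = Dom I g" "s \<in> S (Dom I f)" by (auto simp: free_gens_def)
    then have us: "u (Dom I f) s \<in> carrier (ob B (Dom I f))" using u small_categoryD(1) by fastforce
    have gf: "(Comp I g f, s) \<in> free_gens I S (Cod I g)"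
      using f g by (auto simp: free_gens_def small_categoryD)
    have "ar B (Comp I g f) (u (Dom I f) s) = ar B g (ar B f (u (Dom I f) s))"
      using B f g us unfolding algebra_diagram_def functorial_def by metis
    then show "ar B g (?l (Dom I g) (poly_var K w)) = ?l (Cod I g) (ar ?F g (poly_var K w))"
      using w f g gf by (simp add: free_ar_var lv small_categoryD)
  qed
  show "diagram_hom K I ?F B ?l"
    unfolding diagram_hom_def natural_def using l nat by (simp add: free_ob)
  show "?l i (free_unit K I i s) = u i s" if "i \<in> Obj I" "s \<in> S i" for i s
  proof -
    have "(Ident I i, s) \<in> free_gens I S i" using that by (simp add: free_gens_def small_categoryD)
    moreover have "u i s \<in> carrier (ob B i)" using u that by blast
    ultimately show ?thesis
      using that B by (simp add: free_unit_def lv small_categoryD algebra_diagram_def functorial_def)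
  qed
  show "h i x = ?l i x"
    if h: "diagram_hom K I ?F B h"
      and hu: "\<And>i s. i \<in> Obj I \<Longrightarrow> s \<in> S i \<Longrightarrow> h i (free_unit K I i s) = u i s"
      and i: "i \<in> Obj I" and x: "x \<in> carrier (ob ?F i)" for h i x
  proof (rule poly_hom_unique[OF Bi[OF i] _ l[OF i] _ x[unfolded free_ob]])
    show "h i \<in> alg_hom K (poly_alg K (free_gens I S i)) (ob B i)"
      using h i by (auto simp: diagram_hom_def free_ob)
    fix w assume "w \<in> free_gens I S i"
    then obtain f s where w: "w = (f, s)" "(f, s) \<in> free_gens I S i" by (cases w) auto
    then have f: "f \<in> Arr I" "Cod I f = i" "s \<in> S (Dom I f)" by (auto simp: free_gens_def)
    have e: "(Ident I (Dom I f), s) \<in> free_gens I S (Dom I f)"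
      using f by (auto simp: free_gens_def small_categoryD)
    then have "poly_var K w = ar ?F f (free_unit K I (Dom I f) s)"
      using w f by (simp add: free_unit_def free_ar_var small_categoryD)
    moreover have "free_unit K I (Dom I f) s \<in> carrier (ob ?F (Dom I f))"
      using e by (simp add: free_ob free_unit_def poly_var_closed)
    ultimately have "h i (poly_var K w) = ar B f (h (Dom I f) (free_unit K I (Dom I f) s))"
      using h f unfolding diagram_hom_def natural_def by metis
    then show "h i (poly_var K w) = ?l i (poly_var K w)"
      using w f hu i by (simp add: lv small_categoryD)
  qed
qed

end

end

end

theory Submission
  imports Defs
begin

text \<open>
  Let \<open>X\<close> be an extension of \<open>A\<close> by \<open>M\<close>.  As \<open>G(A)\<close> is free, the counit \<open>G(A) \<rightarrow> A\<close> lifts to a map of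
  diagrams \<open>\<phi> : G(A) \<rightarrow> X\<close>; the two composites of \<open>\<phi>\<close> with the faces \<open>\<partial>\<^sub>0, \<partial>\<^sub>1 : G\<^sup>2(A) \<rightarrow> G(A)\<close> agree in
  \<open>A\<close>, so \<open>\<phi> \<partial>\<^sub>0 = q d + \<phi> \<partial>\<^sub>1\<close> for a derivation \<open>d\<close> of \<open>G\<^sup>2(A)\<close>, which is a cocycle by the simplicial
  identities.  Changing \<open>\<phi>\<close> adds to it a derivation of \<open>G(A)\<close> and changes \<open>d\<close> by a coboundary.

  Let \<open>\<eta>\<close> be the (set-theoretic) insertion of generators.  Evaluating the cocycle condition on
  \<open>\<eta> z\<close> gives \<open>d z = u (\<partial>\<^sub>0 z) - u (\<partial>\<^sub>1 z)\<close> with \<open>u y = d (\<eta> y)\<close>.  Consequently the lift satisfies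
  \<open>\<phi> y = q (u y) + \<phi> (\<eta> (\<epsilon> y))\<close>, so \<open>d\<close> determines \<open>X\<close> up to equivalence; conversely, as \<open>d\<close> is a
  natural derivation, \<open>(m, y) \<mapsto> (m + u y, \<epsilon> y)\<close> exhibits \<open>M \<times> A\<close> as a quotient algebra of the
  semidirect product of \<open>G(A)\<close> by \<open>M\<close>, and this quotient is an extension with cocycle \<open>d\<close>.
\<close>

section \<open>Extensions and derivations\<close>

lemma kscale_closed:
  assumes "algebra K A" "module A M" "c \<in> carrier K" "m \<in> carrier M"
  shows "kscale A M c m \<in> carrier M"
proof -
  interpret A: algebra K A by fact
  interpret M: module A M by fact
  show ?thesis using assms by (simp add: kscale_def)
qed

lemma alg_homD:
  assumes "h \<in> alg_hom K X Y"
  shows "x \<in> carrier X \<Longrightarrow> h x \<in> carrier Y"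
    and "x \<in> carrier X \<Longrightarrow> y \<in> carrier X \<Longrightarrow> h (x \<oplus>\<^bsub>X\<^esub> y) = h x \<oplus>\<^bsub>Y\<^esub> h y"
    and "x \<in> carrier X \<Longrightarrow> y \<in> carrier X \<Longrightarrow> h (x \<otimes>\<^bsub>X\<^esub> y) = h x \<otimes>\<^bsub>Y\<^esub> h y"
    and "h \<one>\<^bsub>X\<^esub> = \<one>\<^bsub>Y\<^esub>"
    and "c \<in> carrier K \<Longrightarrow> x \<in> carrier X \<Longrightarrow> h (c \<odot>\<^bsub>X\<^esub> x) = c \<odot>\<^bsub>Y\<^esub> h x"
  using assms by (auto simp: alg_hom_def ring_hom_def)

lemma alg_homI:
  assumes "\<And>x. x \<in> carrier X \<Longrightarrow> h x \<in> carrier Y"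
    and "\<And>x y. x \<in> carrier X \<Longrightarrow> y \<in> carrier X \<Longrightarrow> h (x \<oplus>\<^bsub>X\<^esub> y) = h x \<oplus>\<^bsub>Y\<^esub> h y"
    and "\<And>x y. x \<in> carrier X \<Longrightarrow> y \<in> carrier X \<Longrightarrow> h (x \<otimes>\<^bsub>X\<^esub> y) = h x \<otimes>\<^bsub>Y\<^esub> h y"
    and "h \<one>\<^bsub>X\<^esub> = \<one>\<^bsub>Y\<^esub>"
    and "\<And>c x. c \<in> carrier K \<Longrightarrow> x \<in> carrier X \<Longrightarrow> h (c \<odot>\<^bsub>X\<^esub> x) = c \<odot>\<^bsub>Y\<^esub> h x"
  shows "h \<in> alg_hom K X Y"
  using assms by (auto simp: alg_hom_def intro!: ring_hom_memI)

lemma alg_hom_zero: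
  assumes "algebra K X" "algebra K Y" "h \<in> alg_hom K X Y"
  shows "h \<zero>\<^bsub>X\<^esub> = \<zero>\<^bsub>Y\<^esub>"
proof -
  interpret X: algebra K X by fact
  interpret Y: algebra K Y by fact
  interpret h: ring_hom_cring X Y h
    by unfold_locales (use assms in \<open>simp add: alg_hom_def\<close>)
  show ?thesis by simp
qed

lemma alg_hom_a_inv:
  assumes "algebra K X" "algebra K Y" "h \<in> alg_hom K X Y" "x \<in> carrier X"
  shows "h (\<ominus>\<^bsub>X\<^esub> x) = \<ominus>\<^bsub>Y\<^esub> h x"
proof -
  interpret X: algebra K X by fact
  interpret Y: algebra K Y by fact
  interpret h: ring_hom_cring X Y h
    by unfold_locales (use assms in \<open>simp add: alg_hom_def\<close>)
  show ?thesis using assms by simp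
qed

lemma derivationD:
  assumes "derivation K A M B \<pi> d"
  shows "x \<in> carrier B \<Longrightarrow> d x \<in> carrier M"
    and "x \<in> carrier B \<Longrightarrow> y \<in> carrier B \<Longrightarrow> d (x \<oplus>\<^bsub>B\<^esub> y) = d x \<oplus>\<^bsub>M\<^esub> d y"
    and "x \<in> carrier B \<Longrightarrow> y \<in> carrier B \<Longrightarrow>
           d (x \<otimes>\<^bsub>B\<^esub> y) = \<pi> x \<odot>\<^bsub>M\<^esub> d y \<oplus>\<^bsub>M\<^esub> \<pi> y \<odot>\<^bsub>M\<^esub> d x"
    and "c \<in> carrier K \<Longrightarrow> x \<in> carrier B \<Longrightarrow> d (c \<odot>\<^bsub>B\<^esub> x) = kscale A M c (d x)"
  using assms by (auto simp: derivation_def)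

text \<open>Leibniz on \<open>1 = 1 * 1\<close> reads \<open>d 1 = d 1 + d 1\<close>, and
  cancellation in \<open>M\<close> does the rest. This is what keeps the unit fixed when a
  derivation is added to an algebra map.\<close>

lemma derivation_one:
  assumes "module A M" "algebra K B" "\<pi> \<in> alg_hom K B A" "derivation K A M B \<pi> d"
  shows "d \<one>\<^bsub>B\<^esub> = \<zero>\<^bsub>M\<^esub>"
proof -
  interpret M: module A M by fact
  interpret B: algebra K B by fact
  have "d \<one>\<^bsub>B\<^esub> \<in> carrier M" using assms(4) by (auto dest: derivationD(1))
  moreover have "d (\<one>\<^bsub>B\<^esub> \<otimes>\<^bsub>B\<^esub> \<one>\<^bsub>B\<^esub>) = \<one>\<^bsub>A\<^esub> \<odot>\<^bsub>M\<^esub> d \<one>\<^bsub>B\<^esub> \<oplus>\<^bsub>M\<^esub> \<one>\<^bsub>A\<^esub> \<odot>\<^bsub>M\<^esub> d \<one>\<^bsub>B\<^esub>"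
    using derivationD(3)[OF assms(4), of "\<one>\<^bsub>B\<^esub>" "\<one>\<^bsub>B\<^esub>"] alg_homD(4)[OF assms(3)] by simp
  ultimately show ?thesis by simp
qed

section \<open>Arithmetic in an extension of a single algebra\<close>

locale alg_extension =
  fixes K :: "'k ring" and A :: "('k, 'a) module" and M :: "('a, 'm) module"
    and X :: "('k, 'x) module" and q :: "'m \<Rightarrow> 'x" and p :: "'x \<Rightarrow> 'a"
  assumes A: "algebra K A" and X: "algebra K X" and M: "module A M"
    and ext: "algebra_extension K A M X q p"
begin

sublocale A: algebra K A by (rule A)
sublocale X: algebra K X by (rule X)
sublocale M: module A M by (rule M)

lemma p_hom: "p \<in> alg_hom K X A"
  using ext by (simp add: algebra_extension_def)

lemmas p_simps [simp] = alg_homD[OF p_hom] alg_hom_zero[OF X A p_hom]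

lemma q_simps [simp]:
  "m \<in> carrier M \<Longrightarrow> q m \<in> carrier X"
  "m \<in> carrier M \<Longrightarrow> p (q m) = \<zero>\<^bsub>A\<^esub>"
  using ext by (auto simp: algebra_extension_def)

lemma q_add: "m \<in> carrier M \<Longrightarrow> n \<in> carrier M \<Longrightarrow> q (m \<oplus>\<^bsub>M\<^esub> n) = q m \<oplus>\<^bsub>X\<^esub> q n"
  and q_smult: "c \<in> carrier K \<Longrightarrow> m \<in> carrier M \<Longrightarrow> q (kscale A M c m) = c \<odot>\<^bsub>X\<^esub> q m"
  and q_inj [simp]: "m \<in> carrier M \<Longrightarrow> n \<in> carrier M \<Longrightarrow> q m = q n \<longleftrightarrow> m = n"
  and q_mult: "x \<in> carrier X \<Longrightarrow> m \<in> carrier M \<Longrightarrow> x \<otimes>\<^bsub>X\<^esub> q m = q (p x \<odot>\<^bsub>M\<^esub> m)"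
  using ext by (auto simp: algebra_extension_def inj_on_eq_iff)

lemma q_exact:
  assumes "x \<in> carrier X" "p x = \<zero>\<^bsub>A\<^esub>"
  shows "\<exists>m\<in>carrier M. q m = x"
proof -
  have "x \<in> q ` carrier M" using ext assms by (simp add: algebra_extension_def)
  then show ?thesis by blast
qed

lemma q_mult': "x \<in> carrier X \<Longrightarrow> m \<in> carrier M \<Longrightarrow> q m \<otimes>\<^bsub>X\<^esub> x = q (p x \<odot>\<^bsub>M\<^esub> m)"
  by (simp add: X.m_comm q_mult)

lemma q_zero [simp]: "q \<zero>\<^bsub>M\<^esub> = \<zero>\<^bsub>X\<^esub>"
  using q_add[of "\<zero>\<^bsub>M\<^esub>" "\<zero>\<^bsub>M\<^esub>"] by simp

text \<open>The difference of \<open>x\<close> and \<open>y\<close> lies in the kernel of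
  \<open>p\<close>, which exactness identifies with the image of \<open>q\<close>. Derivations
  comparing two lifts take their values from this \<open>m\<close>.\<close>

lemma same_fibre:
  assumes "x \<in> carrier X" "y \<in> carrier X" "p x = p y"
  shows "\<exists>m\<in>carrier M. x = q m \<oplus>\<^bsub>X\<^esub> y"
proof -
  have "p (x \<ominus>\<^bsub>X\<^esub> y) = \<zero>\<^bsub>A\<^esub>"
    using assms by (simp add: X.minus_eq alg_hom_a_inv[OF X A p_hom] A.r_neg)
  then obtain m where "m \<in> carrier M" "q m = x \<ominus>\<^bsub>X\<^esub> y" using q_exact assms by blast
  then have "x = q m \<oplus>\<^bsub>X\<^esub> y" using assms by (simp add: X.minus_eq X.a_assoc X.l_neg)
  then show ?thesis using \<open>m \<in> carrier M\<close> by blast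
qed

text \<open>The product of \<open>q m\<close> and \<open>q n\<close> vanishes because
  \<open>p (q m) = 0\<close>: the image of \<open>M\<close> is a square-zero ideal, so besides
  \<open>x y\<close> only the two cross terms survive.\<close>

lemma plus_mult:
  assumes "m \<in> carrier M" "n \<in> carrier M" "x \<in> carrier X" "y \<in> carrier X"
  shows "(q m \<oplus>\<^bsub>X\<^esub> x) \<otimes>\<^bsub>X\<^esub> (q n \<oplus>\<^bsub>X\<^esub> y)
       = q (p x \<odot>\<^bsub>M\<^esub> n \<oplus>\<^bsub>M\<^esub> p y \<odot>\<^bsub>M\<^esub> m) \<oplus>\<^bsub>X\<^esub> x \<otimes>\<^bsub>X\<^esub> y"
proof -
  have "(q m \<oplus>\<^bsub>X\<^esub> x) \<otimes>\<^bsub>X\<^esub> (q n \<oplus>\<^bsub>X\<^esub> y)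
      = q m \<otimes>\<^bsub>X\<^esub> q n \<oplus>\<^bsub>X\<^esub> q m \<otimes>\<^bsub>X\<^esub> y \<oplus>\<^bsub>X\<^esub> (x \<otimes>\<^bsub>X\<^esub> q n \<oplus>\<^bsub>X\<^esub> x \<otimes>\<^bsub>X\<^esub> y)"
    using assms by (simp add: X.l_distr X.r_distr X.a_ac)
  then show ?thesis using assms by (simp add: q_mult q_mult' q_add X.a_ac)
qed

lemma plus_add:
  assumes "m \<in> carrier M" "n \<in> carrier M" "x \<in> carrier X" "y \<in> carrier X"
  shows "(q m \<oplus>\<^bsub>X\<^esub> x) \<oplus>\<^bsub>X\<^esub> (q n \<oplus>\<^bsub>X\<^esub> y) = q (m \<oplus>\<^bsub>M\<^esub> n) \<oplus>\<^bsub>X\<^esub> (x \<oplus>\<^bsub>X\<^esub> y)"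
  using assms by (simp add: q_add X.a_ac)

lemma plus_smult:
  assumes "c \<in> carrier K" "m \<in> carrier M" "x \<in> carrier X"
  shows "c \<odot>\<^bsub>X\<^esub> (q m \<oplus>\<^bsub>X\<^esub> x) = q (kscale A M c m) \<oplus>\<^bsub>X\<^esub> c \<odot>\<^bsub>X\<^esub> x"
  using assms by (simp add: q_smult X.smult_r_distr)

text \<open>Each homomorphism law of \<open>f\<close> is rewritten with
  \<open>f b = q (d b) + g b\<close> and expanded by the \<open>plus_\<close> rules. The
  \<open>g\<close> parts cancel because \<open>g\<close> obeys the same law, and injectivity of
  \<open>q\<close> leaves the law for \<open>d\<close>.\<close>

lemma difference_derivation:
  assumes B: "algebra K B" and f: "f \<in> alg_hom K B X" and g: "g \<in> alg_hom K B X"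
    and d: "d \<in> carrier B \<rightarrow> carrier M"
    and fg: "\<And>b. b \<in> carrier B \<Longrightarrow> f b = q (d b) \<oplus>\<^bsub>X\<^esub> g b"
    and \<pi>: "\<And>b. b \<in> carrier B \<Longrightarrow> p (f b) = \<pi> b"
  shows "derivation K A M B \<pi> d"
proof -
  interpret B: algebra K B by fact
  note f' [simp] = alg_homD[OF f] and g' [simp] = alg_homD[OF g]
  have [simp]: "d b \<in> carrier M" if "b \<in> carrier B" for b using d that by blast
  have [simp]: "p (g b) = \<pi> b" "\<pi> b \<in> carrier A" if "b \<in> carrier B" for b
  proof -
    show "\<pi> b \<in> carrier A" using \<pi>[OF that] that f'(1) p_simps(1) by metis
    show "p (g b) = \<pi> b" using \<pi>[OF that] that by (simp add: fg)
  qed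
  show ?thesis unfolding derivation_def
  proof (intro conjI ballI d)
    fix x y assume xy [simp]: "x \<in> carrier B" "y \<in> carrier B"
    have "q (d (x \<oplus>\<^bsub>B\<^esub> y)) \<oplus>\<^bsub>X\<^esub> g (x \<oplus>\<^bsub>B\<^esub> y) = (q (d x) \<oplus>\<^bsub>X\<^esub> g x) \<oplus>\<^bsub>X\<^esub> (q (d y) \<oplus>\<^bsub>X\<^esub> g y)"
      using fg[of "x \<oplus>\<^bsub>B\<^esub> y"] f'(2)[OF xy] by (simp add: fg[of x] fg[of y])
    then show "d (x \<oplus>\<^bsub>B\<^esub> y) = d x \<oplus>\<^bsub>M\<^esub> d y" by (simp add: plus_add)
    have "q (d (x \<otimes>\<^bsub>B\<^esub> y)) \<oplus>\<^bsub>X\<^esub> g (x \<otimes>\<^bsub>B\<^esub> y) = (q (d x) \<oplus>\<^bsub>X\<^esub> g x) \<otimes>\<^bsub>X\<^esub> (q (d y) \<oplus>\<^bsub>X\<^esub> g y)"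
      using fg[of "x \<otimes>\<^bsub>B\<^esub> y"] f'(3)[OF xy] by (simp add: fg[of x] fg[of y])
    then show "d (x \<otimes>\<^bsub>B\<^esub> y) = \<pi> x \<odot>\<^bsub>M\<^esub> d y \<oplus>\<^bsub>M\<^esub> \<pi> y \<odot>\<^bsub>M\<^esub> d x"
      by (simp add: plus_mult)
  next
    fix c x assume cx [simp]: "c \<in> carrier K" "x \<in> carrier B"
    have "q (d (c \<odot>\<^bsub>B\<^esub> x)) \<oplus>\<^bsub>X\<^esub> g (c \<odot>\<^bsub>B\<^esub> x) = c \<odot>\<^bsub>X\<^esub> (q (d x) \<oplus>\<^bsub>X\<^esub> g x)"
      using fg[of "c \<odot>\<^bsub>B\<^esub> x"] f'(5)[OF cx] by (simp add: fg[of x])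
    then show "d (c \<odot>\<^bsub>B\<^esub> x) = kscale A M c (d x)"
      by (simp add: plus_smult kscale_closed[OF A M])
  qed
qed

text \<open>Converse of \<open>difference_derivation\<close>: the \<open>plus_\<close> rules turn
  the laws of a derivation back into those of an algebra map, and \<open>d 1 = 0\<close> preserves
  the unit.\<close>

lemma add_derivation_hom:
  assumes B: "algebra K B" and f: "f \<in> alg_hom K B X" and \<pi>: "\<pi> \<in> alg_hom K B A"
    and d: "derivation K A M B \<pi> d"
    and pf: "\<And>b. b \<in> carrier B \<Longrightarrow> p (f b) = \<pi> b"
  shows "(\<lambda>b. q (d b) \<oplus>\<^bsub>X\<^esub> f b) \<in> alg_hom K B X"
proof -
  interpret B: algebra K B by fact
  note [simp] = alg_homD[OF f] derivationD[OF d] pf alg_homD(1)[OF \<pi>]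
  show ?thesis
    by (rule alg_homI)
       (simp_all add: plus_add plus_mult plus_smult derivation_one[OF M B \<pi> d])
qed

end

text \<open>Elements of \<open>X\<close> have the form \<open>q m \<oplus> f b\<close>.  The assignment \<open>q m \<oplus> f b \<mapsto> r m \<oplus> g b\<close> is well
  defined because \<open>f\<close> and \<open>g\<close> fail by the same \<open>u\<close> to factor through \<open>\<pi>\<close>.\<close>

lemma extension_comparison:
  assumes 1: "alg_extension K A M X q p" and 2: "alg_extension K A M Y r s"
    and B: "algebra K B" and f: "f \<in> alg_hom K B X" and g: "g \<in> alg_hom K B Y"
    and pf: "\<And>b. b \<in> carrier B \<Longrightarrow> p (f b) = \<pi> b"
    and sg: "\<And>b. b \<in> carrier B \<Longrightarrow> s (g b) = \<pi> b"
    and sec: "\<And>a. a \<in> carrier A \<Longrightarrow> \<sigma> a \<in> carrier B" "\<And>a. a \<in> carrier A \<Longrightarrow> \<pi> (\<sigma> a) = a"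
    and u: "\<And>b. b \<in> carrier B \<Longrightarrow> u b \<in> carrier M"
    and fu: "\<And>b. b \<in> carrier B \<Longrightarrow> f b = q (u b) \<oplus>\<^bsub>X\<^esub> f (\<sigma> (\<pi> b))"
    and gu: "\<And>b. b \<in> carrier B \<Longrightarrow> g b = r (u b) \<oplus>\<^bsub>Y\<^esub> g (\<sigma> (\<pi> b))"
  shows "\<exists>h\<in>alg_hom K X Y.
    (\<forall>m\<in>carrier M. \<forall>b\<in>carrier B. h (q m \<oplus>\<^bsub>X\<^esub> f b) = r m \<oplus>\<^bsub>Y\<^esub> g b) \<and>
    (\<forall>m\<in>carrier M. h (q m) = r m) \<and>
    (\<forall>x\<in>carrier X. s (h x) = p x \<and> (\<exists>m\<in>carrier M. \<exists>b\<in>carrier B. x = q m \<oplus>\<^bsub>X\<^esub> f b))"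
proof -
  interpret X: alg_extension K A M X q p by fact
  interpret Y: alg_extension K A M Y r s by fact
  interpret B: algebra K B by fact
  \<comment> \<open>Every \<open>x\<close> is uniquely \<open>q m + f (\<sigma> (p x))\<close>,
    since \<open>f (\<sigma> (p x))\<close> is one point of the fibre of \<open>x\<close> and
    \<open>q\<close> is injective. The map is read off from this normal form.\<close>
  define h where "h x = r (THE m. m \<in> carrier M \<and> x = q m \<oplus>\<^bsub>X\<^esub> f (\<sigma> (p x))) \<oplus>\<^bsub>Y\<^esub> g (\<sigma> (p x))" for x
  note fs [simp] = alg_homD[OF f] and gs [simp] = alg_homD[OF g]
  note [simp] = pf sg u sec
  have \<pi>c [simp]: "\<pi> b \<in> carrier A" if "b \<in> carrier B" for b
    using pf[OF that] X.p_simps(1)[OF fs(1)[OF that]] by simp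
  have h: "h (q m \<oplus>\<^bsub>X\<^esub> f b) = r m \<oplus>\<^bsub>Y\<^esub> g b" if [simp]: "m \<in> carrier M" "b \<in> carrier B" for m b
  proof -
    let ?x = "q m \<oplus>\<^bsub>X\<^esub> f b"
    have [simp]: "p ?x = \<pi> b" by simp
    \<comment> \<open>Passing to the normal form absorbs \<open>u b\<close> into the
      \<open>M\<close> part; on the other side \<open>gu\<close> takes the same \<open>u b\<close>
      out again, so the choice of \<open>b\<close> does not show in the result.\<close>
    have e: "?x = q (m \<oplus>\<^bsub>M\<^esub> u b) \<oplus>\<^bsub>X\<^esub> f (\<sigma> (\<pi> b))"
      by (subst fu) (simp_all add: X.q_add X.X.a_assoc)
    have "(THE n. n \<in> carrier M \<and> ?x = q n \<oplus>\<^bsub>X\<^esub> f (\<sigma> (\<pi> b))) = m \<oplus>\<^bsub>M\<^esub> u b"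
      unfolding e by (rule the_equality) (auto simp:)
    then have "h ?x = r (m \<oplus>\<^bsub>M\<^esub> u b) \<oplus>\<^bsub>Y\<^esub> g (\<sigma> (\<pi> b))" by (simp add: h_def)
    also have "\<dots> = r m \<oplus>\<^bsub>Y\<^esub> g b"
      by (subst (2) gu) (simp_all add: Y.q_add Y.X.a_assoc)
    finally show ?thesis .
  qed
  have ex: "\<exists>m\<in>carrier M. \<exists>b\<in>carrier B. x = q m \<oplus>\<^bsub>X\<^esub> f b" if "x \<in> carrier X" for x
    using X.same_fibre[OF that, of "f (\<sigma> (p x))"] that sec(1) by force
  moreover have "h \<in> alg_hom K X Y"
  proof (rule alg_homI)
    fix x assume x: "x \<in> carrier X"
    obtain m b where [simp]: "m \<in> carrier M" "b \<in> carrier B" and xe: "x = q m \<oplus>\<^bsub>X\<^esub> f b"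
      using ex[OF x] by blast
    show "h x \<in> carrier Y" by (simp add: xe h)
    show "h (c \<odot>\<^bsub>X\<^esub> x) = c \<odot>\<^bsub>Y\<^esub> h x" if [simp]: "c \<in> carrier K" for c
      using h[of "kscale A M c m" "c \<odot>\<^bsub>B\<^esub> b"]
      by (simp add: xe h X.plus_smult Y.plus_smult kscale_closed[OF X.A X.M])
    fix y assume y: "y \<in> carrier X"
    obtain n c where [simp]: "n \<in> carrier M" "c \<in> carrier B" and ye: "y = q n \<oplus>\<^bsub>X\<^esub> f c"
      using ex[OF y] by blast
    show "h (x \<oplus>\<^bsub>X\<^esub> y) = h x \<oplus>\<^bsub>Y\<^esub> h y"
      using h[of "m \<oplus>\<^bsub>M\<^esub> n" "b \<oplus>\<^bsub>B\<^esub> c"] by (simp add: xe ye h X.plus_add Y.plus_add)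
    show "h (x \<otimes>\<^bsub>X\<^esub> y) = h x \<otimes>\<^bsub>Y\<^esub> h y"
      using h[of "\<pi> b \<odot>\<^bsub>M\<^esub> n \<oplus>\<^bsub>M\<^esub> \<pi> c \<odot>\<^bsub>M\<^esub> m" "b \<otimes>\<^bsub>B\<^esub> c"]
      by (simp add: xe ye h X.plus_mult Y.plus_mult)
  next
    show "h \<one>\<^bsub>X\<^esub> = \<one>\<^bsub>Y\<^esub>" using h[of "\<zero>\<^bsub>M\<^esub>" "\<one>\<^bsub>B\<^esub>"] by simp
  qed
  moreover have "h (q m) = r m" if [simp]: "m \<in> carrier M" for m
    using h[of m "\<zero>\<^bsub>B\<^esub>"] by (simp add: alg_hom_zero[OF B X.X f] alg_hom_zero[OF B Y.X g])
  moreover have "s (h x) = p x" if "x \<in> carrier X" for x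
    using ex[OF that] by (auto simp: h)
  ultimately show ?thesis using h by blast
qed

section \<open>Extensions as quotients of a semidirect product\<close>

definition semidirect ::
    "('k, 'a) module \<Rightarrow> ('a, 'm) module \<Rightarrow> ('k, 'b) module \<Rightarrow> ('b \<Rightarrow> 'a) \<Rightarrow> ('k, 'm \<times> 'b) module" where
  "semidirect A M B \<pi> =
     \<lparr>carrier = carrier M \<times> carrier B,
      monoid.mult = (\<lambda>(m, y) (n, z). (\<pi> y \<odot>\<^bsub>M\<^esub> n \<oplus>\<^bsub>M\<^esub> \<pi> z \<odot>\<^bsub>M\<^esub> m, y \<otimes>\<^bsub>B\<^esub> z)),
      one = (\<zero>\<^bsub>M\<^esub>, \<one>\<^bsub>B\<^esub>),
      zero = (\<zero>\<^bsub>M\<^esub>, \<zero>\<^bsub>B\<^esub>),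
      add = (\<lambda>(m, y) (n, z). (m \<oplus>\<^bsub>M\<^esub> n, y \<oplus>\<^bsub>B\<^esub> z)),
      smult = (\<lambda>c (m, y). (kscale A M c m, c \<odot>\<^bsub>B\<^esub> y))\<rparr>"

lemma semidirect_simps [simp]:
  "carrier (semidirect A M B \<pi>) = carrier M \<times> carrier B"
  "(m, y) \<otimes>\<^bsub>semidirect A M B \<pi>\<^esub> (n, z) = (\<pi> y \<odot>\<^bsub>M\<^esub> n \<oplus>\<^bsub>M\<^esub> \<pi> z \<odot>\<^bsub>M\<^esub> m, y \<otimes>\<^bsub>B\<^esub> z)"
  "\<one>\<^bsub>semidirect A M B \<pi>\<^esub> = (\<zero>\<^bsub>M\<^esub>, \<one>\<^bsub>B\<^esub>)"
  "\<zero>\<^bsub>semidirect A M B \<pi>\<^esub> = (\<zero>\<^bsub>M\<^esub>, \<zero>\<^bsub>B\<^esub>)"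
  "(m, y) \<oplus>\<^bsub>semidirect A M B \<pi>\<^esub> (n, z) = (m \<oplus>\<^bsub>M\<^esub> n, y \<oplus>\<^bsub>B\<^esub> z)"
  "c \<odot>\<^bsub>semidirect A M B \<pi>\<^esub> (m, y) = (kscale A M c m, c \<odot>\<^bsub>B\<^esub> y)"
  by (simp_all add: semidirect_def)

text \<open>This is the split square-zero extension of \<open>B\<close> by \<open>M\<close>, with
  \<open>B\<close> acting through \<open>\<pi>\<close>. Only the \<open>M\<close> component needs
  thought, where the ring axioms become module axioms.\<close>

lemma semidirect_algebra:
  assumes A: "algebra K A" and M: "module A M" and B: "algebra K B" and \<pi>: "\<pi> \<in> alg_hom K B A"
  shows "algebra K (semidirect A M B \<pi>)"
proof -
  let ?S = "semidirect A M B \<pi>"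
  interpret A: algebra K A by fact
  interpret B: algebra K B by fact
  interpret M: module A M by fact
  note [simp] = alg_homD[OF \<pi>] kscale_closed[OF A M]
  have ag: "abelian_group ?S"
  proof (rule abelian_groupI, goal_cases)
    case (6 x)
    then show ?case
      by (intro bexI[of _ "(\<ominus>\<^bsub>M\<^esub> fst x, \<ominus>\<^bsub>B\<^esub> snd x)"]) (auto simp: M.l_neg B.l_neg)
  qed (auto simp: M.a_ac B.a_ac)
  have "cring ?S"
  proof (rule cringI[OF ag comm_monoidI], goal_cases)
    \<comment> \<open>Cases 3 and 6 are associativity and distributivity.\<close>
    case (3 x y z)
    then show ?case
      by (auto simp: B.m_assoc M.smult_r_distr M.smult_assoc1[symmetric] A.m_comm M.a_ac)
  next
    case (6 x y z)
    then show ?case by (auto simp: B.l_distr M.smult_l_distr M.smult_r_distr M.a_ac)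
  qed (auto simp: B.m_comm M.a_comm)
  \<comment> \<open>Acting on \<open>M\<close> by \<open>a\<close> in \<open>A\<close> and by
    \<open>c\<close> in \<open>K\<close>, in either order, is acting by \<open>c a\<close>. The two
    equations make scalars compatible with the product.\<close>
  moreover have "kscale A M c (a \<odot>\<^bsub>M\<^esub> m) = (c \<odot>\<^bsub>A\<^esub> a) \<odot>\<^bsub>M\<^esub> m" if "c \<in> carrier K" "a \<in> carrier A" "m \<in> carrier M" for c a m
    using that by (simp add: kscale_def M.smult_assoc1[symmetric] A.smult_assoc2)
  moreover have "a \<odot>\<^bsub>M\<^esub> kscale A M c m = (c \<odot>\<^bsub>A\<^esub> a) \<odot>\<^bsub>M\<^esub> m" if "c \<in> carrier K" "a \<in> carrier A" "m \<in> carrier M" for c a m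
    using that by (simp add: kscale_def M.smult_assoc1[symmetric] A.smult_assoc2 A.m_comm[of a])
  ultimately show ?thesis
    by (intro algebraI A.R.is_cring)
       (auto simp: B.smult_l_distr B.smult_r_distr B.smult_assoc1 B.smult_assoc2
         kscale_def A.smult_l_distr A.smult_assoc1 M.smult_l_distr M.smult_r_distr
         M.smult_assoc1[symmetric] A.smult_assoc2)
qed

text \<open>The quotient of \<open>R\<close> by the kernel relation of \<open>\<Phi>\<close>,
  realised on the values of \<open>\<Phi>\<close> instead of on classes so that the elements live in
  a prescribed type. Operations are computed on the representatives \<open>\<rho>\<close>.\<close>

definition image_alg ::
    "('k, 'b) module \<Rightarrow> ('b \<Rightarrow> 'x) \<Rightarrow> ('x \<Rightarrow> 'b) \<Rightarrow> ('k, 'x) module" where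
  "image_alg R \<Phi> \<rho> =
     \<lparr>carrier = \<Phi> ` carrier R,
      monoid.mult = (\<lambda>x y. \<Phi> (\<rho> x \<otimes>\<^bsub>R\<^esub> \<rho> y)),
      one = \<Phi> \<one>\<^bsub>R\<^esub>,
      zero = \<Phi> \<zero>\<^bsub>R\<^esub>,
      add = (\<lambda>x y. \<Phi> (\<rho> x \<oplus>\<^bsub>R\<^esub> \<rho> y)),
      smult = (\<lambda>c x. \<Phi> (c \<odot>\<^bsub>R\<^esub> \<rho> x))\<rparr>"

text \<open>The hypotheses say that the kernel relation of \<open>\<Phi>\<close> is a congruence, tested on the
  representatives chosen by \<open>\<rho>\<close>.\<close>

lemma image_alg:
  assumes R: "algebra K R"
    and add: "\<And>a b. a \<in> carrier R \<Longrightarrow> b \<in> carrier R \<Longrightarrow>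
      \<Phi> (\<rho> (\<Phi> a) \<oplus>\<^bsub>R\<^esub> \<rho> (\<Phi> b)) = \<Phi> (a \<oplus>\<^bsub>R\<^esub> b)"
    and mult: "\<And>a b. a \<in> carrier R \<Longrightarrow> b \<in> carrier R \<Longrightarrow>
      \<Phi> (\<rho> (\<Phi> a) \<otimes>\<^bsub>R\<^esub> \<rho> (\<Phi> b)) = \<Phi> (a \<otimes>\<^bsub>R\<^esub> b)"
    and smult: "\<And>c a. c \<in> carrier K \<Longrightarrow> a \<in> carrier R \<Longrightarrow>
      \<Phi> (c \<odot>\<^bsub>R\<^esub> \<rho> (\<Phi> a)) = \<Phi> (c \<odot>\<^bsub>R\<^esub> a)"
  shows "algebra K (image_alg R \<Phi> \<rho>)" and "\<Phi> \<in> alg_hom K R (image_alg R \<Phi> \<rho>)"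
proof -
  let ?X = "image_alg R \<Phi> \<rho>"
  interpret R: algebra K R by fact
  have [simp]: "\<Phi> a \<oplus>\<^bsub>?X\<^esub> \<Phi> b = \<Phi> (a \<oplus>\<^bsub>R\<^esub> b)" "\<Phi> a \<otimes>\<^bsub>?X\<^esub> \<Phi> b = \<Phi> (a \<otimes>\<^bsub>R\<^esub> b)"
    if "a \<in> carrier R" "b \<in> carrier R" for a b
    using that add mult by (simp_all add: image_alg_def)
  have [simp]: "c \<odot>\<^bsub>?X\<^esub> \<Phi> a = \<Phi> (c \<odot>\<^bsub>R\<^esub> a)" if "c \<in> carrier K" "a \<in> carrier R" for c a
    using that smult by (simp add: image_alg_def)
  have [simp]: "carrier ?X = \<Phi> ` carrier R" "\<one>\<^bsub>?X\<^esub> = \<Phi> \<one>\<^bsub>R\<^esub>" "\<zero>\<^bsub>?X\<^esub> = \<Phi> \<zero>\<^bsub>R\<^esub>"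
    by (simp_all add: image_alg_def)
  have ag: "abelian_group ?X"
  proof (rule abelian_groupI, goal_cases)
    case (6 x)
    then obtain a where "a \<in> carrier R" "x = \<Phi> a" by auto
    then show ?case by (intro bexI[of _ "\<Phi> (\<ominus>\<^bsub>R\<^esub> a)"]) (auto simp: R.l_neg)
  qed (auto simp: R.a_ac)
  have "cring ?X"
    by (rule cringI[OF ag comm_monoidI]) (auto simp: R.m_ac R.l_distr R.r_distr)
  then show "algebra K ?X"
    by (intro algebraI R.R.is_cring)
       (auto simp: R.smult_l_distr R.smult_r_distr R.smult_assoc1 R.smult_assoc2)
  show "\<Phi> \<in> alg_hom K R ?X" by (rule alg_homI) auto
qed

text \<open>
  Here \<open>u\<close> measures how far the canonical map \<open>B \<rightarrow> X\<close> is from factoring through \<open>\<pi>\<close>.  The conditions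
  on \<open>u\<close> say that \<open>(m, b) \<mapsto> (m \<oplus> u b, \<pi> b)\<close> identifies \<open>M \<times> A\<close> with a quotient algebra of the
  semidirect product of \<open>B\<close> by \<open>M\<close>.
\<close>

locale twisting =
  fixes K :: "'k ring" and A :: "('k, 'a) module" and M :: "('a, 'm) module"
    and B :: "('k, 'b) module" and \<pi> :: "'b \<Rightarrow> 'a" and \<sigma> :: "'a \<Rightarrow> 'b" and u :: "'b \<Rightarrow> 'm"
    and e :: "'m \<times> 'a \<Rightarrow> 'x"
  assumes A: "algebra K A" and M: "module A M" and B: "algebra K B" and \<pi>: "\<pi> \<in> alg_hom K B A"
    and \<sigma> [simp]: "\<And>a. a \<in> carrier A \<Longrightarrow> \<sigma> a \<in> carrier B" "\<And>a. a \<in> carrier A \<Longrightarrow> \<pi> (\<sigma> a) = a"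
    and u [simp]: "\<And>b. b \<in> carrier B \<Longrightarrow> u b \<in> carrier M"
    and u\<sigma> [simp]: "\<And>a. a \<in> carrier A \<Longrightarrow> u (\<sigma> a) = \<zero>\<^bsub>M\<^esub>"
    and u_add: "\<And>x y. x \<in> carrier B \<Longrightarrow> y \<in> carrier B \<Longrightarrow>
      u (x \<oplus>\<^bsub>B\<^esub> y) = (u x \<oplus>\<^bsub>M\<^esub> u y) \<oplus>\<^bsub>M\<^esub> u (\<sigma> (\<pi> x) \<oplus>\<^bsub>B\<^esub> \<sigma> (\<pi> y))"
    and u_mult: "\<And>x y. x \<in> carrier B \<Longrightarrow> y \<in> carrier B \<Longrightarrow>
      u (x \<otimes>\<^bsub>B\<^esub> y) = (\<pi> x \<odot>\<^bsub>M\<^esub> u y \<oplus>\<^bsub>M\<^esub> \<pi> y \<odot>\<^bsub>M\<^esub> u x) \<oplus>\<^bsub>M\<^esub> u (\<sigma> (\<pi> x) \<otimes>\<^bsub>B\<^esub> \<sigma> (\<pi> y))"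
    and u_smult: "\<And>c x. c \<in> carrier K \<Longrightarrow> x \<in> carrier B \<Longrightarrow>
      u (c \<odot>\<^bsub>B\<^esub> x) = kscale A M c (u x) \<oplus>\<^bsub>M\<^esub> u (c \<odot>\<^bsub>B\<^esub> \<sigma> (\<pi> x))"
    and inj_e: "inj e"
begin

sublocale A: algebra K A by (rule A)
sublocale M: module A M by (rule M)
sublocale B: algebra K B by (rule B)

abbreviation S where "S \<equiv> semidirect A M B \<pi>"

definition \<Phi> :: "'m \<times> 'b \<Rightarrow> 'x" where "\<Phi> = (\<lambda>(m, b). e (m \<oplus>\<^bsub>M\<^esub> u b, \<pi> b))"

text \<open>A section of \<open>\<Phi>\<close>: as \<open>u\<close> vanishes on
  \<open>\<sigma> a\<close>, the pair \<open>(m, \<sigma> a)\<close> is sent back to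
  \<open>e (m, a)\<close>.\<close>

definition \<rho> :: "'x \<Rightarrow> 'm \<times> 'b" where "\<rho> x = (fst (inv_into UNIV e x), \<sigma> (snd (inv_into UNIV e x)))"

definition X :: "('k, 'x) module" where "X = image_alg S \<Phi> \<rho>"

lemmas pi_simps [simp] = alg_homD[OF \<pi>] alg_hom_zero[OF B A \<pi>]

lemma \<rho>_\<Phi>: "\<rho> (\<Phi> (m, b)) = (m \<oplus>\<^bsub>M\<^esub> u b, \<sigma> (\<pi> b))"
  by (simp add: \<rho>_def \<Phi>_def inj_e)

lemma \<Phi>_eqI: "m \<oplus>\<^bsub>M\<^esub> u b = n \<oplus>\<^bsub>M\<^esub> u c \<Longrightarrow> \<pi> b = \<pi> c \<Longrightarrow> \<Phi> (m, b) = \<Phi> (n, c)"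
  by (simp add: \<Phi>_def)

text \<open>Replacing \<open>(m, b)\<close> by its representative
  \<open>(m + u b, \<sigma> (\<pi> b))\<close> leaves the value of \<open>\<Phi>\<close> on sums,
  products and scalar multiples unchanged; this is exactly what \<open>u_add\<close>,
  \<open>u_mult\<close> and \<open>u_smult\<close> provide for \<open>image_alg\<close>.\<close>

lemma X_algebra: "algebra K X" and \<Phi>_hom: "\<Phi> \<in> alg_hom K S X"
proof -
  have S: "algebra K S" by (rule semidirect_algebra[OF A M B \<pi>])
  note [simp] = kscale_closed[OF A M]
  have add: "\<Phi> (\<rho> (\<Phi> a) \<oplus>\<^bsub>S\<^esub> \<rho> (\<Phi> b)) = \<Phi> (a \<oplus>\<^bsub>S\<^esub> b)"
    if "a \<in> carrier S" "b \<in> carrier S" for a b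
  proof -
    obtain m x n y where [simp]: "a = (m, x)" "b = (n, y)" by (cases a, cases b) auto
    show ?thesis using that
      by (simp add: \<rho>_\<Phi>) (rule \<Phi>_eqI, simp_all add: u_add[of x y] M.a_ac)
  qed
  have mult: "\<Phi> (\<rho> (\<Phi> a) \<otimes>\<^bsub>S\<^esub> \<rho> (\<Phi> b)) = \<Phi> (a \<otimes>\<^bsub>S\<^esub> b)"
    if "a \<in> carrier S" "b \<in> carrier S" for a b
  proof -
    obtain m x n y where [simp]: "a = (m, x)" "b = (n, y)" by (cases a, cases b) auto
    show ?thesis using that
      by (simp add: \<rho>_\<Phi>) (rule \<Phi>_eqI, simp_all add: u_mult[of x y] M.smult_r_distr M.a_ac)
  qed
  have smult: "\<Phi> (c \<odot>\<^bsub>S\<^esub> \<rho> (\<Phi> a)) = \<Phi> (c \<odot>\<^bsub>S\<^esub> a)"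
    if "c \<in> carrier K" "a \<in> carrier S" for c a
  proof -
    obtain m x where [simp]: "a = (m, x)" by (cases a) auto
    have "kscale A M c (m \<oplus>\<^bsub>M\<^esub> u x) = kscale A M c m \<oplus>\<^bsub>M\<^esub> kscale A M c (u x)"
      using that by (simp add: kscale_def M.smult_r_distr)
    then show ?thesis using that
      by (simp add: \<rho>_\<Phi>) (rule \<Phi>_eqI, simp_all add: u_smult[of c x] M.a_ac)
  qed
  show "algebra K X" "\<Phi> \<in> alg_hom K S X"
    unfolding X_def using image_alg[of K S \<Phi> \<rho>] S add mult smult by blast+
qed

lemma X_carrier: "carrier X = \<Phi> ` (carrier M \<times> carrier B)"
  by (simp add: X_def image_alg_def)

definition q :: "'m \<Rightarrow> 'x" where "q m = \<Phi> (m, \<zero>\<^bsub>B\<^esub>)"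
definition p :: "'x \<Rightarrow> 'a" where "p x = snd (inv_into UNIV e x)"

lemma p_\<Phi> [simp]: "p (\<Phi> (m, b)) = \<pi> b"
  by (simp add: p_def \<Phi>_def inj_e)

text \<open>The algebraic axioms are inherited from the semidirect product through
  \<open>\<Phi>\<close>; injectivity of \<open>q\<close> rests on that of \<open>e\<close>.\<close>

lemma X_extension: "algebra_extension K A M X q p"
proof -
  interpret X: algebra K X by (rule X_algebra)
  note [simp] = kscale_closed[OF A M]
  have \<Phi>: "\<Phi> a \<oplus>\<^bsub>X\<^esub> \<Phi> b = \<Phi> (a \<oplus>\<^bsub>S\<^esub> b)" "\<Phi> a \<otimes>\<^bsub>X\<^esub> \<Phi> b = \<Phi> (a \<otimes>\<^bsub>S\<^esub> b)"
    if "a \<in> carrier M \<times> carrier B" "b \<in> carrier M \<times> carrier B" for a b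
    using alg_homD(2,3)[OF \<Phi>_hom] that by (simp_all del: semidirect_simps add: semidirect_simps(1))
  have \<Phi>c: "\<Phi> a \<in> carrier X" if "a \<in> carrier M \<times> carrier B" for a
    using alg_homD(1)[OF \<Phi>_hom] that by simp
  have \<Phi>s: "c \<odot>\<^bsub>X\<^esub> \<Phi> a = \<Phi> (c \<odot>\<^bsub>S\<^esub> a)"
    if "c \<in> carrier K" "a \<in> carrier M \<times> carrier B" for a c
    using alg_homD(5)[OF \<Phi>_hom] that by simp
  have \<Phi>1: "\<one>\<^bsub>X\<^esub> = \<Phi> (\<zero>\<^bsub>M\<^esub>, \<one>\<^bsub>B\<^esub>)"
    using alg_homD(4)[OF \<Phi>_hom] by simp
  have p: "p \<in> alg_hom K X A"
    by (rule alg_homI) (auto simp: X_carrier \<Phi> \<Phi>c \<Phi>s \<Phi>1)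
  have "inj_on q (carrier M)"
  proof (rule inj_onI)
    fix m n assume "m \<in> carrier M" "n \<in> carrier M" "q m = q n"
    moreover from this have "m \<oplus>\<^bsub>M\<^esub> u \<zero>\<^bsub>B\<^esub> = n \<oplus>\<^bsub>M\<^esub> u \<zero>\<^bsub>B\<^esub>"
      by (simp add: q_def \<Phi>_def inj_eq[OF inj_e])
    ultimately show "m = n" by simp
  qed
  moreover have "q ` carrier M = {x \<in> carrier X. p x = \<zero>\<^bsub>A\<^esub>}"
  proof (intro equalityI subsetI)
    fix x assume "x \<in> {x \<in> carrier X. p x = \<zero>\<^bsub>A\<^esub>}"
    then obtain m b where mb: "m \<in> carrier M" "b \<in> carrier B" "\<pi> b = \<zero>\<^bsub>A\<^esub>" and x: "x = \<Phi> (m, b)"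
      by (auto simp: X_carrier)
    \<comment> \<open>The first coordinate of \<open>q n\<close> is \<open>n + u 0\<close>, and
      \<open>u 0\<close> is not assumed to vanish; hence the correction term.\<close>
    have "x = q ((m \<oplus>\<^bsub>M\<^esub> u b) \<oplus>\<^bsub>M\<^esub> \<ominus>\<^bsub>M\<^esub> u \<zero>\<^bsub>B\<^esub>)"
      unfolding x q_def by (rule \<Phi>_eqI) (use mb in \<open>simp_all add: M.a_assoc M.l_neg\<close>)
    then show "x \<in> q ` carrier M" by (rule image_eqI) (use mb in simp)
  qed (auto simp: q_def \<Phi>c)
  moreover have "p ` carrier X = carrier A"
  proof (intro equalityI subsetI)
    fix a assume a: "a \<in> carrier A"
    then have "\<Phi> (\<zero>\<^bsub>M\<^esub>, \<sigma> a) \<in> carrier X" "p (\<Phi> (\<zero>\<^bsub>M\<^esub>, \<sigma> a)) = a" by (simp_all add: \<Phi>c)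
    then show "a \<in> p ` carrier X" by (metis image_eqI)
  qed (auto simp: X_carrier)
  moreover have "x \<otimes>\<^bsub>X\<^esub> q m = q (p x \<odot>\<^bsub>M\<^esub> m)" if "x \<in> carrier X" "m \<in> carrier M" for x m
    using that by (auto simp: X_carrier q_def \<Phi>)
  ultimately show ?thesis
    unfolding algebra_extension_def using p by (auto simp: q_def \<Phi> \<Phi>c \<Phi>s)
qed

lemma \<Phi>_split:
  assumes "m \<in> carrier M" "b \<in> carrier B"
  shows "\<Phi> (m, b) = q m \<oplus>\<^bsub>X\<^esub> \<Phi> (\<zero>\<^bsub>M\<^esub>, b)"
  using alg_homD(2)[OF \<Phi>_hom, of "(m, \<zero>\<^bsub>B\<^esub>)" "(\<zero>\<^bsub>M\<^esub>, b)"] assms by (simp add: q_def)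

text \<open>The inclusion of \<open>B\<close> into the semidirect product followed by the quotient
  map. For \<open>B = G(A)\<close> it becomes the lift of the counit.\<close>

lemma \<Phi>_base_hom: "(\<lambda>b. \<Phi> (\<zero>\<^bsub>M\<^esub>, b)) \<in> alg_hom K B X"
proof -
  have [simp]: "kscale A M c \<zero>\<^bsub>M\<^esub> = \<zero>\<^bsub>M\<^esub>" if "c \<in> carrier K" for c
    using that by (simp add: kscale_def)
  have "(\<lambda>b. (\<zero>\<^bsub>M\<^esub>, b)) \<in> alg_hom K B S"
    by (rule alg_homI) auto
  then show ?thesis by (rule alg_hom_comp[OF A.R.is_cring _ \<Phi>_hom])
qed

end

section \<open>Simplicial identities\<close>

lemma algebra_diagramD:
  assumes "algebra_diagram K I B"
  shows "i \<in> Obj I \<Longrightarrow> algebra K (ob B i)"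
    and "f \<in> Arr I \<Longrightarrow> ar B f \<in> alg_hom K (ob B (Dom I f)) (ob B (Cod I f))"
    and "functorial I B"
  using assms by (auto simp: algebra_diagram_def)

lemma diagram_homD:
  assumes "diagram_hom K I B C h"
  shows "i \<in> Obj I \<Longrightarrow> h i \<in> alg_hom K (ob B i) (ob C i)"
    and "i \<in> Obj I \<Longrightarrow> x \<in> carrier (ob B i) \<Longrightarrow> h i x \<in> carrier (ob C i)"
    and "natural I B C h"
  using assms by (auto simp: diagram_hom_def intro: alg_homD)

lemma naturalD:
  assumes "natural I B C h" "f \<in> Arr I" "x \<in> carrier (ob B (Dom I f))"
  shows "ar C f (h (Dom I f) x) = h (Cod I f) (ar B f x)"
  using assms by (auto simp: natural_def)

lemma functorialD:
  assumes "functorial I D"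
  shows "f \<in> Arr I \<Longrightarrow> x \<in> carrier (ob D (Dom I f)) \<Longrightarrow> ar D f x \<in> carrier (ob D (Cod I f))"
    and "i \<in> Obj I \<Longrightarrow> x \<in> carrier (ob D i) \<Longrightarrow> ar D (Ident I i) x = x"
    and "f \<in> Arr I \<Longrightarrow> g \<in> Arr I \<Longrightarrow> Dom I g = Cod I f \<Longrightarrow> x \<in> carrier (ob D (Dom I f)) \<Longrightarrow>
      ar D (Comp I g f) x = ar D g (ar D f x)"
  using assms by (auto simp: functorial_def)

locale diagram_shape =
  fixes K :: "'k ring" and I :: "('o, 'r) small_cat"
  assumes K: "cring K" and I: "small_category I"
begin

lemmas cat = small_categoryD[OF K I]

abbreviation G where "G \<equiv> G_obj K I"
abbreviation counit where "counit \<equiv> G_counit K I"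
abbreviation unit where "unit \<equiv> free_unit K I"

lemma diagram_hom_comp:
  assumes g: "diagram_hom K I B C g" and h: "diagram_hom K I C D h"
  shows "diagram_hom K I B D (\<lambda>i x. h i (g i x))"
  unfolding diagram_hom_def natural_def
proof (intro conjI ballI)
  show "(\<lambda>x. h i (g i x)) \<in> alg_hom K (ob B i) (ob D i)" if "i \<in> Obj I" for i
    using alg_hom_comp[OF K] diagram_homD(1)[OF g that] diagram_homD(1)[OF h that] .
  show "ar D f (h (Dom I f) (g (Dom I f) x)) = h (Cod I f) (g (Cod I f) (ar B f x))"
    if "f \<in> Arr I" "x \<in> carrier (ob B (Dom I f))" for f x
    using that naturalD[OF diagram_homD(3)[OF g]] naturalD[OF diagram_homD(3)[OF h]]
    by (simp add: diagram_homD(2)[OF g] cat(1))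
qed

context
  fixes B :: "('o, 'r, 'k, 'b) diagram"
  assumes B: "algebra_diagram K I B"
begin

lemma G_algebra: "algebra_diagram K I (G B)"
  unfolding G_obj_def by (rule free_diagram_algebra[OF K I])

lemma unit_closed: "i \<in> Obj I \<Longrightarrow> x \<in> carrier (ob B i) \<Longrightarrow> unit i x \<in> carrier (ob (G B) i)"
  by (auto simp: G_obj_def free_ob[OF K I] free_unit_def free_gens_def cat
      intro!: poly_var_closed[OF K])

lemma counit_hom: "diagram_hom K I (G B) B (counit B)"
  unfolding G_obj_def G_counit_def by (rule free_diagram_adjunction(1)[OF K I B]) auto

lemma counit_unit: "i \<in> Obj I \<Longrightarrow> x \<in> carrier (ob B i) \<Longrightarrow> counit B i (unit i x) = x"
  unfolding G_counit_def
  by (rule free_diagram_adjunction(2)[OF K I B, where S = "\<lambda>i. carrier (ob B i)"]) auto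

lemma lift_exists:
  assumes C: "algebra_diagram K I C"
    and s: "\<And>i x. i \<in> Obj I \<Longrightarrow> x \<in> carrier (ob B i) \<Longrightarrow> s i x \<in> carrier (ob C i)"
  shows "diagram_hom K I (G B) C (free_lift K I C s)"
    and "i \<in> Obj I \<Longrightarrow> x \<in> carrier (ob B i) \<Longrightarrow> free_lift K I C s i (unit i x) = s i x"
proof -
  have s': "s i \<in> carrier (ob B i) \<rightarrow> carrier (ob C i)" if "i \<in> Obj I" for i using s that by blast
  show "diagram_hom K I (G B) C (free_lift K I C s)"
    unfolding G_obj_def by (rule free_diagram_adjunction(1)[OF K I C s'])
  show "free_lift K I C s i (unit i x) = s i x" if "i \<in> Obj I" "x \<in> carrier (ob B i)"
    by (rule free_diagram_adjunction(2)[OF K I C s']) (use that in auto)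
qed

text \<open>Both maps are adjoint to the same family of functions, namely their common values on
  generators.\<close>

lemma G_hom_eqI:
  assumes C: "algebra_diagram K I C"
    and h: "diagram_hom K I (G B) C h" and h': "diagram_hom K I (G B) C h'"
    and eq: "\<And>i x. i \<in> Obj I \<Longrightarrow> x \<in> carrier (ob B i) \<Longrightarrow> h i (unit i x) = h' i (unit i x)"
    and i: "i \<in> Obj I" and x: "x \<in> carrier (ob (G B) i)"
  shows "h i x = h' i x"
proof -
  let ?u = "\<lambda>i x. h i (unit i x)"
  have u: "?u i \<in> carrier (ob B i) \<rightarrow> carrier (ob C i)" if "i \<in> Obj I" for i
    using diagram_homD(2)[OF h that] unit_closed[OF that] by blast
  note lift = free_diagram_adjunction(3)[OF K I C u _ _ i x[unfolded G_obj_def]]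
  show ?thesis
    using lift[OF _ h[unfolded G_obj_def]] lift[OF _ h'[unfolded G_obj_def]] eq by simp
qed

end

lemma G_map_hom:
  assumes B: "algebra_diagram K I B" and C: "algebra_diagram K I C" and h: "diagram_hom K I B C h"
  shows "diagram_hom K I (G B) (G C) (G_map K I C h)"
  unfolding G_map_def
  by (rule lift_exists(1)[OF B G_algebra[OF C]]) (simp add: unit_closed[OF C] diagram_homD(2)[OF h])

lemma G_map_unit:
  assumes B: "algebra_diagram K I B" and C: "algebra_diagram K I C" and h: "diagram_hom K I B C h"
    and "i \<in> Obj I" "x \<in> carrier (ob B i)"
  shows "G_map K I C h i (unit i x) = unit i (h i x)"
  unfolding G_map_def
  by (rule lift_exists(2)[OF B G_algebra[OF C]])
     (simp_all add: unit_closed[OF C] diagram_homD(2)[OF h] assms)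

text \<open>On generators both sides send \<open>unit x\<close> to \<open>h x\<close>.\<close>

lemma counit_natural:
  assumes B: "algebra_diagram K I B" and C: "algebra_diagram K I C" and h: "diagram_hom K I B C h"
    and "i \<in> Obj I" "x \<in> carrier (ob (G B) i)"
  shows "counit C i (G_map K I C h i x) = h i (counit B i x)"
proof (rule G_hom_eqI[OF B C _ _ _ assms(4,5)])
  show "diagram_hom K I (G B) C (\<lambda>i x. counit C i (G_map K I C h i x))"
    by (rule diagram_hom_comp[OF G_map_hom[OF B C h] counit_hom[OF C]])
  show "diagram_hom K I (G B) C (\<lambda>i x. h i (counit B i x))"
    by (rule diagram_hom_comp[OF counit_hom[OF B] h])
qed (simp add: G_map_unit[OF B C h] counit_unit[OF B] counit_unit[OF C] diagram_homD(2)[OF h])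

text \<open>Functoriality of \<open>G\<close> on composites, phrased as preservation of commuting
  squares. This form gives the face identity \<open>d1 e2 = d1 e1\<close> directly.\<close>

lemma G_map_square:
  assumes B: "algebra_diagram K I B" and C: "algebra_diagram K I C"
    and C': "algebra_diagram K I C'" and D: "algebra_diagram K I D"
    and g: "diagram_hom K I B C g" and h: "diagram_hom K I C D h"
    and g': "diagram_hom K I B C' g'" and h': "diagram_hom K I C' D h'"
    and eq: "\<And>i x. i \<in> Obj I \<Longrightarrow> x \<in> carrier (ob B i) \<Longrightarrow> h i (g i x) = h' i (g' i x)"
    and "i \<in> Obj I" "x \<in> carrier (ob (G B) i)"
  shows "G_map K I D h i (G_map K I C g i x) = G_map K I D h' i (G_map K I C' g' i x)"
proof (rule G_hom_eqI[OF B G_algebra[OF D] _ _ _ assms(10,11)])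
  show "diagram_hom K I (G B) (G D) (\<lambda>i x. G_map K I D h i (G_map K I C g i x))"
    by (rule diagram_hom_comp[OF G_map_hom[OF B C g] G_map_hom[OF C D h]])
  show "diagram_hom K I (G B) (G D) (\<lambda>i x. G_map K I D h' i (G_map K I C' g' i x))"
    by (rule diagram_hom_comp[OF G_map_hom[OF B C' g'] G_map_hom[OF C' D h']])
qed (simp add: G_map_unit[OF B C g] G_map_unit[OF C D h] G_map_unit[OF B C' g']
    G_map_unit[OF C' D h'] diagram_homD(2)[OF g] diagram_homD(2)[OF g'] eq)

end

locale diagram_with_module = diagram_shape K I
  for K :: "'k ring" and I :: "('o, 'r) small_cat" +
  fixes A :: "('o, 'r, 'k, 'a) diagram" and M :: "('o, 'r, 'a, 'm) diagram"
  assumes A: "algebra_diagram K I A" and M: "diagram_module I A M"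
begin

abbreviation "GA \<equiv> G A"
abbreviation "G2 \<equiv> G (G A)"
abbreviation "G3 \<equiv> G (G (G A))"
abbreviation "d0 \<equiv> face1_0 K I A"
abbreviation "d1 \<equiv> face1_1 K I A"
abbreviation "e0 \<equiv> face2_0 K I A"
abbreviation "e1 \<equiv> face2_1 K I A"
abbreviation "e2 \<equiv> face2_2 K I A"

lemmas GA = G_algebra[OF A] and G2 = G_algebra[OF G_algebra[OF A]]
  and G3 = G_algebra[OF G_algebra[OF G_algebra[OF A]]]

lemma aug1_hom: "diagram_hom K I GA A (aug1 K I A)"
  unfolding aug1_def by (rule counit_hom[OF A])

lemma face1_hom: "diagram_hom K I G2 GA d0" "diagram_hom K I G2 GA d1"
  unfolding face1_0_def face1_1_def
  by (rule counit_hom[OF GA], rule G_map_hom[OF GA A counit_hom[OF A]])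

lemma aug2_hom: "diagram_hom K I G2 A (aug2 K I A)"
  unfolding aug2_def by (rule diagram_hom_comp[OF counit_hom[OF GA] aug1_hom])

lemma face2_hom: "diagram_hom K I G3 G2 e0" "diagram_hom K I G3 G2 e1" "diagram_hom K I G3 G2 e2"
  unfolding face2_0_def face2_1_def face2_2_def
    apply (rule counit_hom[OF G2])
   apply (rule G_map_hom[OF G2 GA counit_hom[OF GA]])
  apply (rule G_map_hom[OF G2 GA face1_hom(2)[unfolded face1_1_def]])
  done

lemma aug3_hom: "diagram_hom K I G3 A (aug3 K I A)"
  unfolding aug3_def by (rule diagram_hom_comp[OF counit_hom[OF G2] aug2_hom])

text \<open>The first two identities are naturality of the counit, at the counit of
  \<open>G A\<close> and at \<open>d1\<close>; the third is \<open>G\<close> applied to naturality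
  of the counit at the counit of \<open>A\<close>.\<close>

lemma face_face:
  assumes "i \<in> Obj I" "w \<in> carrier (ob G3 i)"
  shows "d0 i (e1 i w) = d0 i (e0 i w)" "d0 i (e2 i w) = d1 i (e0 i w)" "d1 i (e2 i w) = d1 i (e1 i w)"
proof -
  show "d0 i (e1 i w) = d0 i (e0 i w)"
    unfolding face1_0_def face2_0_def face2_1_def
    by (rule counit_natural[OF G2 GA counit_hom[OF GA] assms])
  show "d0 i (e2 i w) = d1 i (e0 i w)"
    unfolding face1_0_def face2_0_def face2_2_def face1_1_def
    by (rule counit_natural[OF G2 GA face1_hom(2)[unfolded face1_1_def] assms])
  show "d1 i (e2 i w) = d1 i (e1 i w)"
    unfolding face1_1_def face2_1_def face2_2_def
    by (rule G_map_square[OF G2 GA GA A face1_hom(2)[unfolded face1_1_def] counit_hom[OF A]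
          counit_hom[OF GA] counit_hom[OF A] _ assms])
       (rule counit_natural[OF GA A counit_hom[OF A]])
qed

text \<open>\<open>aug2\<close> passes through \<open>d0\<close> by definition; passing through
  \<open>d1\<close> instead is naturality of the counit at the counit itself.\<close>

lemma aug1_face1:
  assumes "i \<in> Obj I" "z \<in> carrier (ob G2 i)"
  shows "aug1 K I A i (d0 i z) = aug2 K I A i z" "aug1 K I A i (d1 i z) = aug2 K I A i z"
  using counit_natural[OF GA A counit_hom[OF A] assms]
  by (simp_all add: aug1_def aug2_def face1_0_def face1_1_def)

lemma aug2_face2:
  assumes "i \<in> Obj I" "w \<in> carrier (ob G3 i)"
  shows "aug2 K I A i (e0 i w) = aug3 K I A i w" "aug2 K I A i (e1 i w) = aug3 K I A i w"
    "aug2 K I A i (e2 i w) = aug3 K I A i w"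
proof -
  note c = diagram_homD(2)[OF face2_hom(1) assms] diagram_homD(2)[OF face2_hom(2) assms]
    diagram_homD(2)[OF face2_hom(3) assms]
  note a = aug1_face1[OF assms(1)]
  show 0: "aug2 K I A i (e0 i w) = aug3 K I A i w"
    by (simp add: aug3_def face2_0_def)
  show "aug2 K I A i (e1 i w) = aug3 K I A i w"
    using a(1)[OF c(1)] a(1)[OF c(2)] 0 by (simp add: face_face[OF assms])
  show "aug2 K I A i (e2 i w) = aug3 K I A i w"
    using a(2)[OF c(1)] a(1)[OF c(3)] 0 by (simp add: face_face[OF assms])
qed

text \<open>On underlying sets \<open>unit\<close> is an extra degeneracy: it splits the zeroth
  face, and a higher face of \<open>unit\<close> is \<open>unit\<close> of the preceding face one
  degree down, the augmentation serving as the face in lowest degree.\<close>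

lemma face1_unit:
  assumes "i \<in> Obj I" "y \<in> carrier (ob GA i)"
  shows "d0 i (unit i y) = y" "d1 i (unit i y) = unit i (aug1 K I A i y)"
  using counit_unit[OF GA assms] G_map_unit[OF GA A counit_hom[OF A] assms]
  by (simp_all add: face1_0_def face1_1_def aug1_def)

lemma face2_unit:
  assumes "i \<in> Obj I" "z \<in> carrier (ob G2 i)"
  shows "e0 i (unit i z) = z" "e1 i (unit i z) = unit i (d0 i z)" "e2 i (unit i z) = unit i (d1 i z)"
  using counit_unit[OF G2 assms] G_map_unit[OF G2 GA counit_hom[OF GA] assms]
    G_map_unit[OF G2 GA face1_hom(2)[unfolded face1_1_def] assms]
  by (simp_all add: face2_0_def face2_1_def face2_2_def face1_0_def face1_1_def)

lemma aug1_unit: "i \<in> Obj I \<Longrightarrow> a \<in> carrier (ob A i) \<Longrightarrow> aug1 K I A i (unit i a) = a"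
  by (simp add: aug1_def counit_unit[OF A])

end

section \<open>Derivations of diagrams\<close>

lemma derivation_zero:
  assumes A: "algebra K A" and M: "module A M" and \<pi>: "\<And>x. x \<in> carrier B \<Longrightarrow> \<pi> x \<in> carrier A"
  shows "derivation K A M B \<pi> (\<lambda>_. \<zero>\<^bsub>M\<^esub>)"
proof -
  interpret A: algebra K A by fact
  interpret M: module A M by fact
  show ?thesis using \<pi> by (auto simp: derivation_def kscale_def)
qed

lemma derivation_add:
  assumes A: "algebra K A" and M: "module A M" and \<pi>: "\<And>x. x \<in> carrier B \<Longrightarrow> \<pi> x \<in> carrier A"
    and d: "derivation K A M B \<pi> d" and e: "derivation K A M B \<pi> e"
  shows "derivation K A M B \<pi> (\<lambda>x. d x \<oplus>\<^bsub>M\<^esub> e x)"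
proof -
  interpret A: algebra K A by fact
  interpret M: module A M by fact
  note [simp] = \<pi> derivationD[OF d] derivationD[OF e]
  show ?thesis
    unfolding derivation_def
    by (auto simp: kscale_def M.smult_r_distr M.a_ac)
qed

lemma derivation_minus:
  assumes A: "algebra K A" and M: "module A M" and \<pi>: "\<And>x. x \<in> carrier B \<Longrightarrow> \<pi> x \<in> carrier A"
    and d: "derivation K A M B \<pi> d"
  shows "derivation K A M B \<pi> (\<lambda>x. \<ominus>\<^bsub>M\<^esub> d x)"
proof -
  interpret A: algebra K A by fact
  interpret M: module A M by fact
  note [simp] = \<pi> derivationD[OF d]
  show ?thesis
    unfolding derivation_def
    by (auto simp: kscale_def M.smult_r_minus M.minus_add)
qed

lemma derivation_cong:
  assumes B: "algebra K B" and d: "derivation K A M B \<pi> d"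
    and eq: "\<And>x. x \<in> carrier B \<Longrightarrow> d x = d' x"
  shows "derivation K A M B \<pi> d'"
proof -
  interpret B: algebra K B by fact
  show ?thesis using d by (simp add: derivation_def eq[symmetric] Pi_def)
qed

lemma derivation_comp:
  assumes h: "h \<in> alg_hom K C B" and d: "derivation K A M B \<pi> d"
    and \<pi>: "\<And>x. x \<in> carrier C \<Longrightarrow> \<pi> (h x) = \<pi>' x"
  shows "derivation K A M C \<pi>' (\<lambda>x. d (h x))"
  unfolding derivation_def using alg_homD[OF h] derivationD[OF d] \<pi> by auto

context diagram_with_module
begin

lemma M_module: "i \<in> Obj I \<Longrightarrow> module (ob A i) (ob M i)"
  and M_functorial: "functorial I M"
  and ar_M_add: "f \<in> Arr I \<Longrightarrow> x \<in> carrier (ob M (Dom I f)) \<Longrightarrow> y \<in> carrier (ob M (Dom I f)) \<Longrightarrow>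
    ar M f (x \<oplus>\<^bsub>ob M (Dom I f)\<^esub> y) = ar M f x \<oplus>\<^bsub>ob M (Cod I f)\<^esub> ar M f y"
  and ar_M_smult: "f \<in> Arr I \<Longrightarrow> a \<in> carrier (ob A (Dom I f)) \<Longrightarrow> x \<in> carrier (ob M (Dom I f)) \<Longrightarrow>
    ar M f (a \<odot>\<^bsub>ob M (Dom I f)\<^esub> x) = ar A f a \<odot>\<^bsub>ob M (Cod I f)\<^esub> ar M f x"
  using M by (auto simp: diagram_module_def)

lemma M_group: "i \<in> Obj I \<Longrightarrow> abelian_group (ob M i)"
  using M_module module.axioms(2) by blast

lemma ar_M_closed: "f \<in> Arr I \<Longrightarrow> x \<in> carrier (ob M (Dom I f)) \<Longrightarrow> ar M f x \<in> carrier (ob M (Cod I f))"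
  using M_functorial by (auto simp: functorial_def)

lemma ar_M_zero:
  assumes f: "f \<in> Arr I"
  shows "ar M f \<zero>\<^bsub>ob M (Dom I f)\<^esub> = \<zero>\<^bsub>ob M (Cod I f)\<^esub>"
proof -
  interpret D: abelian_group "ob M (Dom I f)" using M_group cat(1) f by blast
  interpret C: abelian_group "ob M (Cod I f)" using M_group cat(2) f by blast
  show ?thesis
    using ar_M_add[OF f, of "\<zero>\<^bsub>ob M (Dom I f)\<^esub>" "\<zero>\<^bsub>ob M (Dom I f)\<^esub>"] ar_M_closed[OF f, of "\<zero>\<^bsub>ob M (Dom I f)\<^esub>"]
    by simp
qed

lemma ar_M_minus:
  assumes f: "f \<in> Arr I" and x: "x \<in> carrier (ob M (Dom I f))"
  shows "ar M f (\<ominus>\<^bsub>ob M (Dom I f)\<^esub> x) = \<ominus>\<^bsub>ob M (Cod I f)\<^esub> ar M f x"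
proof -
  interpret D: abelian_group "ob M (Dom I f)" using M_group cat(1) f by blast
  interpret C: abelian_group "ob M (Cod I f)" using M_group cat(2) f by blast
  show ?thesis
    using ar_M_add[OF f, of "\<ominus>\<^bsub>ob M (Dom I f)\<^esub> x" x] ar_M_closed[OF f] ar_M_zero[OF f] x
    by (intro C.minus_equality[symmetric]) (simp_all add: D.l_neg)
qed

section \<open>The abelian group of derivations of a diagram\<close>

context
  fixes B :: "('o, 'r, 'k, 'b) diagram" and \<pi> :: "'o \<Rightarrow> 'b \<Rightarrow> 'a"
  assumes B: "algebra_diagram K I B" and \<pi>: "diagram_hom K I B A \<pi>"
begin

lemma Der_carrierD:
  assumes "d \<in> carrier (Der K I A M B \<pi>)"
  shows "i \<in> Obj I \<Longrightarrow> derivation K (ob A i) (ob M i) (ob B i) (\<pi> i) (d i)"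
    and "i \<in> Obj I \<Longrightarrow> x \<in> carrier (ob B i) \<Longrightarrow> d i x \<in> carrier (ob M i)"
    and "natural I B M d"
  using assms by (auto simp: Der_def derivation_def)

text \<open>Members of \<open>Der\<close> are extensional in both arguments, so agreement on the
  carriers is equality.\<close>

lemma Der_eqI:
  assumes "d \<in> carrier (Der K I A M B \<pi>)" "e \<in> carrier (Der K I A M B \<pi>)"
    and "\<And>i x. i \<in> Obj I \<Longrightarrow> x \<in> carrier (ob B i) \<Longrightarrow> d i x = e i x"
  shows "d = e"
proof -
  have "d i = e i" if "i \<in> Obj I" for i
    using assms that by (intro PiE_ext[of "d i" "carrier (ob B i)" "\<lambda>_. carrier (ob M i)"]) (auto simp: Der_def)
  then show ?thesis
    using assms(1,2)
    by (intro PiE_ext[of d "Obj I" "\<lambda>i. carrier (ob B i) \<rightarrow>\<^sub>E carrier (ob M i)"]) (auto simp: Der_def)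
qed

text \<open>Restriction brings a natural family of derivations into the extensional form demanded by
  \<open>Der\<close>. Naturality survives because the arrows of \<open>B\<close> preserve
  carriers.\<close>

lemma Der_restrict:
  assumes d: "\<And>i. i \<in> Obj I \<Longrightarrow> derivation K (ob A i) (ob M i) (ob B i) (\<pi> i) (d i)"
    and nat: "natural I B M d"
  shows "(\<lambda>i\<in>Obj I. \<lambda>x\<in>carrier (ob B i). d i x) \<in> carrier (Der K I A M B \<pi>)"
proof -
  have "ar B f x \<in> carrier (ob B (Cod I f))" if "f \<in> Arr I" "x \<in> carrier (ob B (Dom I f))" for f x
    using alg_homD(1)[OF algebra_diagramD(2)[OF B]] that .
  then have "natural I B M (\<lambda>i\<in>Obj I. \<lambda>x\<in>carrier (ob B i). d i x)"
    using nat cat(1,2) by (simp add: natural_def)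
  moreover have "derivation K (ob A i) (ob M i) (ob B i) (\<pi> i) (\<lambda>x\<in>carrier (ob B i). d i x)"
    if "i \<in> Obj I" for i
    by (rule derivation_cong[OF algebra_diagramD(1)[OF B that] d[OF that]]) simp
  ultimately show ?thesis
    using derivationD(1)[OF d] by (auto simp: Der_def)
qed

lemma Der_ops:
  "\<one>\<^bsub>Der K I A M B \<pi>\<^esub> = (\<lambda>i\<in>Obj I. \<lambda>x\<in>carrier (ob B i). \<zero>\<^bsub>ob M i\<^esub>)"
  "d \<otimes>\<^bsub>Der K I A M B \<pi>\<^esub> e = (\<lambda>i\<in>Obj I. \<lambda>x\<in>carrier (ob B i). d i x \<oplus>\<^bsub>ob M i\<^esub> e i x)"
  by (simp_all add: Der_def)

lemma Der_apply:
  assumes "i \<in> Obj I" "x \<in> carrier (ob B i)"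
  shows "\<one>\<^bsub>Der K I A M B \<pi>\<^esub> i x = \<zero>\<^bsub>ob M i\<^esub>"
    and "(d \<otimes>\<^bsub>Der K I A M B \<pi>\<^esub> e) i x = d i x \<oplus>\<^bsub>ob M i\<^esub> e i x"
  using assms by (simp_all add: Der_ops)

lemma Der_one_closed: "\<one>\<^bsub>Der K I A M B \<pi>\<^esub> \<in> carrier (Der K I A M B \<pi>)"
  unfolding Der_ops
  by (rule Der_restrict)
     (auto intro!: derivation_zero M_module algebra_diagramD(1)[OF A] diagram_homD(2)[OF \<pi>]
       simp: natural_def ar_M_zero)

lemma Der_mult_closed:
  assumes d: "d \<in> carrier (Der K I A M B \<pi>)" and e: "e \<in> carrier (Der K I A M B \<pi>)"
  shows "d \<otimes>\<^bsub>Der K I A M B \<pi>\<^esub> e \<in> carrier (Der K I A M B \<pi>)"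
  unfolding Der_ops
proof (rule Der_restrict)
  show "derivation K (ob A i) (ob M i) (ob B i) (\<pi> i) (\<lambda>x. d i x \<oplus>\<^bsub>ob M i\<^esub> e i x)" if "i \<in> Obj I" for i
    using that by (auto intro!: derivation_add M_module algebra_diagramD(1)[OF A]
        diagram_homD(2)[OF \<pi>] Der_carrierD(1)[OF d] Der_carrierD(1)[OF e])
  show "natural I B M (\<lambda>i x. d i x \<oplus>\<^bsub>ob M i\<^esub> e i x)"
    using naturalD[OF Der_carrierD(3)[OF d]] naturalD[OF Der_carrierD(3)[OF e]]
    by (simp add: natural_def ar_M_add cat(1) Der_carrierD(2)[OF d] Der_carrierD(2)[OF e])
qed

lemma Der_minus_closed:
  assumes d: "d \<in> carrier (Der K I A M B \<pi>)"
  shows "(\<lambda>i\<in>Obj I. \<lambda>x\<in>carrier (ob B i). \<ominus>\<^bsub>ob M i\<^esub> d i x) \<in> carrier (Der K I A M B \<pi>)"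
proof (rule Der_restrict)
  show "derivation K (ob A i) (ob M i) (ob B i) (\<pi> i) (\<lambda>x. \<ominus>\<^bsub>ob M i\<^esub> d i x)" if "i \<in> Obj I" for i
    using that by (auto intro!: derivation_minus M_module algebra_diagramD(1)[OF A]
        diagram_homD(2)[OF \<pi>] Der_carrierD(1)[OF d])
  show "natural I B M (\<lambda>i x. \<ominus>\<^bsub>ob M i\<^esub> d i x)"
    using naturalD[OF Der_carrierD(3)[OF d]]
    by (simp add: natural_def ar_M_minus cat(1) Der_carrierD(2)[OF d])
qed

lemma Der_comm_group: "comm_group (Der K I A M B \<pi>)"
proof (rule comm_groupI, goal_cases)
  \<comment> \<open>Cases 3 to 6 are associativity, commutativity, unit and inverses;
    \<open>Der_eqI\<close> reduces each to the group \<open>M(i)\<close>.\<close>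
  case (3 x y z)
  show ?case
    by (rule Der_eqI)
       (use 3 in \<open>auto intro!: Der_mult_closed
          simp: Der_apply Der_carrierD(2) abelian_monoid.a_assoc[OF abelian_group.axioms(1)[OF M_group]]\<close>)
next
  case (4 x y)
  show ?case
    by (rule Der_eqI)
       (use 4 in \<open>auto intro!: Der_mult_closed
          simp: Der_apply Der_carrierD(2) abelian_monoid.a_comm[OF abelian_group.axioms(1)[OF M_group]]\<close>)
next
  case (5 x)
  show ?case
    by (rule Der_eqI)
       (use 5 in \<open>auto intro!: Der_mult_closed Der_one_closed
          simp: Der_apply Der_carrierD(2) abelian_monoid.l_zero[OF abelian_group.axioms(1)[OF M_group]]\<close>)
next
  case (6 x)
  show ?case
    by (rule bexI[OF _ Der_minus_closed[OF 6]], rule Der_eqI)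
       (use 6 in \<open>auto intro!: Der_mult_closed Der_minus_closed Der_one_closed
          simp: Der_apply Der_carrierD(2) abelian_group.l_neg[OF M_group]\<close>)
qed (auto intro: Der_one_closed Der_mult_closed)

lemma Der_inv:
  assumes d: "d \<in> carrier (Der K I A M B \<pi>)"
  shows "inv\<^bsub>Der K I A M B \<pi>\<^esub> d = (\<lambda>i\<in>Obj I. \<lambda>x\<in>carrier (ob B i). \<ominus>\<^bsub>ob M i\<^esub> d i x)"
proof -
  interpret D: comm_group "Der K I A M B \<pi>" by (rule Der_comm_group)
  show ?thesis
    by (rule D.inv_equality[OF _ d Der_minus_closed[OF d]], rule Der_eqI)
       (use d in \<open>auto intro!: Der_mult_closed Der_minus_closed Der_one_closed
          simp: Der_apply Der_carrierD(2) abelian_group.l_neg[OF M_group]\<close>)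
qed

end

section \<open>Pullback of derivations and the coboundary maps\<close>

lemma der_pull_closed:
  assumes B: "algebra_diagram K I B" and \<pi>: "diagram_hom K I B A \<pi>"
    and C: "algebra_diagram K I C" and h: "diagram_hom K I C B h" and \<pi>': "diagram_hom K I C A \<pi>'"
    and eq: "\<And>i x. i \<in> Obj I \<Longrightarrow> x \<in> carrier (ob C i) \<Longrightarrow> \<pi> i (h i x) = \<pi>' i x"
    and d: "d \<in> carrier (Der K I A M B \<pi>)"
  shows "der_pull I C h d \<in> carrier (Der K I A M C \<pi>')"
proof -
  note D = Der_carrierD[OF B \<pi> d]
  have "derivation K (ob A i) (ob M i) (ob C i) (\<pi>' i) (\<lambda>x. d i (h i x))" if i: "i \<in> Obj I" for i
    by (rule derivation_comp[OF diagram_homD(1)[OF h i] D(1)[OF i] eq[OF i]])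
  moreover have "natural I C M (\<lambda>i x. d i (h i x))"
    using naturalD[OF D(3)] naturalD[OF diagram_homD(3)[OF h]] cat(1)
    by (auto simp: natural_def diagram_homD(2)[OF h])
  ultimately show ?thesis
    unfolding der_pull_def by (rule Der_restrict[OF C \<pi>'])
qed

lemma cobd0_pointwise:
  assumes e: "e \<in> carrier (Der0 K I A M)"
  shows "cobd0 K I A M e \<in> carrier (Der1 K I A M)"
    and "i \<in> Obj I \<Longrightarrow> z \<in> carrier (ob G2 i) \<Longrightarrow>
      cobd0 K I A M e i z = e i (d0 i z) \<oplus>\<^bsub>ob M i\<^esub> \<ominus>\<^bsub>ob M i\<^esub> e i (d1 i z)"
proof -
  interpret D1: comm_group "Der1 K I A M"
    unfolding Der1_def by (rule Der_comm_group[OF G2 aug2_hom])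
  have c: "der_pull I G2 d0 e \<in> carrier (Der1 K I A M)" "der_pull I G2 d1 e \<in> carrier (Der1 K I A M)"
    unfolding Der1_def
    by (rule der_pull_closed[OF GA aug1_hom G2 face1_hom(1) aug2_hom _ e[unfolded Der0_def]],
        erule (1) aug1_face1,
        rule der_pull_closed[OF GA aug1_hom G2 face1_hom(2) aug2_hom _ e[unfolded Der0_def]],
        erule (1) aug1_face1)
  show "cobd0 K I A M e \<in> carrier (Der1 K I A M)"
    unfolding cobd0_def using c by simp
  show "cobd0 K I A M e i z = e i (d0 i z) \<oplus>\<^bsub>ob M i\<^esub> \<ominus>\<^bsub>ob M i\<^esub> e i (d1 i z)"
    if "i \<in> Obj I" "z \<in> carrier (ob G2 i)"
    unfolding cobd0_def Der1_def Der_apply(2)[OF G2 aug2_hom that]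
      Der_inv[OF G2 aug2_hom c(2)[unfolded Der1_def]]
    using that by (simp add: der_pull_def)
qed

text \<open>The middle term, which carries the minus sign, is moved across. What remains is an
  equation of pullbacks without inverses, and extensionality tests it pointwise.\<close>

lemma cobd1_eq_one_iff:
  assumes d: "d \<in> carrier (Der1 K I A M)"
  shows "cobd1 K I A M d = \<one>\<^bsub>Der2 K I A M\<^esub> \<longleftrightarrow>
    (\<forall>i\<in>Obj I. \<forall>w\<in>carrier (ob G3 i). d i (e1 i w) = d i (e0 i w) \<oplus>\<^bsub>ob M i\<^esub> d i (e2 i w))"
proof -
  interpret D2: comm_group "Der2 K I A M"
    unfolding Der2_def by (rule Der_comm_group[OF G3 aug3_hom])
  let ?p = "\<lambda>h. der_pull I G3 h d"
  have c: "?p e0 \<in> carrier (Der2 K I A M)" "?p e1 \<in> carrier (Der2 K I A M)" "?p e2 \<in> carrier (Der2 K I A M)"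
    unfolding Der2_def
    by (rule der_pull_closed[OF G2 aug2_hom G3 face2_hom(1) aug3_hom _ d[unfolded Der1_def]],
        erule (1) aug2_face2,
        rule der_pull_closed[OF G2 aug2_hom G3 face2_hom(2) aug3_hom _ d[unfolded Der1_def]],
        erule (1) aug2_face2,
        rule der_pull_closed[OF G2 aug2_hom G3 face2_hom(3) aug3_hom _ d[unfolded Der1_def]],
        erule (1) aug2_face2)
  have "cobd1 K I A M d = \<one>\<^bsub>Der2 K I A M\<^esub> \<longleftrightarrow> ?p e0 \<otimes>\<^bsub>Der2 K I A M\<^esub> ?p e2 = ?p e1"
  proof -
    have "cobd1 K I A M d = (?p e0 \<otimes>\<^bsub>Der2 K I A M\<^esub> ?p e2) \<otimes>\<^bsub>Der2 K I A M\<^esub> inv\<^bsub>Der2 K I A M\<^esub> ?p e1"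
      unfolding cobd1_def using c by (simp add: D2.m_ac)
    then show ?thesis using c by (metis D2.m_closed D2.inv_closed D2.inv_equality D2.inv_inv D2.r_inv)
  qed
  also have "\<dots> \<longleftrightarrow> (\<forall>i\<in>Obj I. \<forall>w\<in>carrier (ob G3 i).
      (?p e0 \<otimes>\<^bsub>Der2 K I A M\<^esub> ?p e2) i w = ?p e1 i w)"
    using Der_eqI[OF G3 aug3_hom] c D2.m_closed unfolding Der2_def by metis
  also have "\<dots> \<longleftrightarrow> (\<forall>i\<in>Obj I. \<forall>w\<in>carrier (ob G3 i).
      d i (e1 i w) = d i (e0 i w) \<oplus>\<^bsub>ob M i\<^esub> d i (e2 i w))"
    by (auto simp: Der2_def Der_apply(2)[OF G3 aug3_hom] der_pull_def)
  finally show ?thesis .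
qed

section \<open>The class of an extension\<close>

lemma ext_at:
  "is_extension K I A M E \<Longrightarrow> i \<in> Obj I \<Longrightarrow>
    alg_extension K (ob A i) (ob M i) (ob (mid E) i) (incl E i) (proj E i)"
  by (auto simp: is_extension_def alg_extension_def algebra_diagramD(1)[OF A] M_module
      dest: algebra_diagramD(1))

lemma extensionD:
  assumes "is_extension K I A M E"
  shows "algebra_diagram K I (mid E)" "natural I M (mid E) (incl E)" "diagram_hom K I (mid E) A (proj E)"
  using assms alg_extension.p_hom[OF ext_at[OF assms]]
  by (auto simp: is_extension_def diagram_hom_def)

definition is_lift ::
    "('o, 'r, 'k, 'a, 'm, 'x) extension \<Rightarrow> ('o \<Rightarrow> ('r, 'k, 'a) gpoly \<Rightarrow> 'x) \<Rightarrow> bool" where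
  "is_lift E \<phi> \<longleftrightarrow> diagram_hom K I GA (mid E) \<phi> \<and>
     (\<forall>i\<in>Obj I. \<forall>y\<in>carrier (ob GA i). proj E i (\<phi> i y) = aug1 K I A i y)"

text \<open>A relation and not a function of \<open>E\<close>: an extension has no preferred lift,
  and the cocycle depends on the lift.\<close>

definition classifies ::
    "('o \<Rightarrow> ('r, 'k, ('r, 'k, 'a) gpoly) gpoly \<Rightarrow> 'm) \<Rightarrow>
     ('o, 'r, 'k, 'a, 'm, 'x) extension \<Rightarrow> ('o \<Rightarrow> ('r, 'k, 'a) gpoly \<Rightarrow> 'x) \<Rightarrow> bool" where
  "classifies d E \<phi> \<longleftrightarrow> (\<forall>i\<in>Obj I. \<forall>z\<in>carrier (ob G2 i).
     \<phi> i (d0 i z) = incl E i (d i z) \<oplus>\<^bsub>ob (mid E) i\<^esub> \<phi> i (d1 i z))"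

definition cocycles where
  "cocycles = kernel (Der1 K I A M) (Der2 K I A M) (cobd1 K I A M)"

lemma cocycles_iff:
  "d \<in> cocycles \<longleftrightarrow> d \<in> carrier (Der1 K I A M) \<and>
    (\<forall>i\<in>Obj I. \<forall>w\<in>carrier (ob G3 i). d i (e1 i w) = d i (e0 i w) \<oplus>\<^bsub>ob M i\<^esub> d i (e2 i w))"
  using cobd1_eq_one_iff by (auto simp: cocycles_def kernel_def)

text \<open>A set-theoretic section \<open>s\<close> of the projection suffices: freeness of
  \<open>G(A)\<close> extends it to a map of diagrams, and the two resulting maps to
  \<open>A\<close> agree on generators.\<close>

lemma lift_exists_extension:
  assumes E: "is_extension K I A M E"
  shows "\<exists>\<phi>. is_lift E \<phi>"
proof -
  define s where "s i a = (SOME x. x \<in> carrier (ob (mid E) i) \<and> proj E i x = a)" for i a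
  have s: "s i a \<in> carrier (ob (mid E) i)" "proj E i (s i a) = a"
    if "i \<in> Obj I" "a \<in> carrier (ob A i)" for i a
  proof -
    have "a \<in> proj E i ` carrier (ob (mid E) i)"
      using E that by (simp add: is_extension_def algebra_extension_def)
    then have "\<exists>x. x \<in> carrier (ob (mid E) i) \<and> proj E i x = a" by blast
    from someI_ex[OF this] show "s i a \<in> carrier (ob (mid E) i)" "proj E i (s i a) = a"
      by (simp_all add: s_def)
  qed
  let ?\<phi> = "free_lift K I (mid E) s"
  note \<phi> = lift_exists[OF A extensionD(1)[OF E], of s]
  have h: "diagram_hom K I GA (mid E) ?\<phi>" by (rule \<phi>(1)) (rule s(1))
  have "proj E i (?\<phi> i y) = aug1 K I A i y" if "i \<in> Obj I" "y \<in> carrier (ob GA i)" for i y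
    by (rule G_hom_eqI[OF A A diagram_hom_comp[OF h extensionD(3)[OF E]] aug1_hom _ that])
       (simp add: \<phi>(2) s aug1_unit)
  then show ?thesis using h by (auto simp: is_lift_def)
qed

text \<open>Two maps into the middle diagram that agree in \<open>A\<close> differ pointwise by
  elements of \<open>M\<close>, and \<open>difference_derivation\<close> makes this difference a
  derivation. For naturality, an arrow is applied to the defining equation and \<open>g\<close> is
  cancelled.\<close>

lemma difference_Der:
  assumes E: "is_extension K I A M E" and B: "algebra_diagram K I B" and \<pi>: "diagram_hom K I B A \<pi>"
    and f: "diagram_hom K I B (mid E) f" and g: "diagram_hom K I B (mid E) g"
    and pf: "\<And>i x. i \<in> Obj I \<Longrightarrow> x \<in> carrier (ob B i) \<Longrightarrow> proj E i (f i x) = \<pi> i x"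
    and pg: "\<And>i x. i \<in> Obj I \<Longrightarrow> x \<in> carrier (ob B i) \<Longrightarrow> proj E i (g i x) = \<pi> i x"
  shows "\<exists>d\<in>carrier (Der K I A M B \<pi>). \<forall>i\<in>Obj I. \<forall>x\<in>carrier (ob B i).
    f i x = incl E i (d i x) \<oplus>\<^bsub>ob (mid E) i\<^esub> g i x"
proof -
  define d where "d i x = (SOME m. m \<in> carrier (ob M i) \<and> f i x = incl E i m \<oplus>\<^bsub>ob (mid E) i\<^esub> g i x)" for i x
  have d: "d i x \<in> carrier (ob M i)" "f i x = incl E i (d i x) \<oplus>\<^bsub>ob (mid E) i\<^esub> g i x"
    if "i \<in> Obj I" "x \<in> carrier (ob B i)" for i x
  proof -
    have "\<exists>m. m \<in> carrier (ob M i) \<and> f i x = incl E i m \<oplus>\<^bsub>ob (mid E) i\<^esub> g i x"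
      using alg_extension.same_fibre[OF ext_at[OF E that(1)] diagram_homD(2)[OF f that]
          diagram_homD(2)[OF g that]] pf[OF that] pg[OF that] by auto
    from someI_ex[OF this] show "d i x \<in> carrier (ob M i)" "f i x = incl E i (d i x) \<oplus>\<^bsub>ob (mid E) i\<^esub> g i x"
      by (simp_all add: d_def)
  qed
  have der: "derivation K (ob A i) (ob M i) (ob B i) (\<pi> i) (d i)" if i: "i \<in> Obj I" for i
    by (rule alg_extension.difference_derivation[OF ext_at[OF E i] algebra_diagramD(1)[OF B i]
          diagram_homD(1)[OF f i] diagram_homD(1)[OF g i]]) (use i d pf in auto)
  have "natural I B M d"
    unfolding natural_def
  proof (intro ballI)
    fix k x assume k: "k \<in> Arr I" and x: "x \<in> carrier (ob B (Dom I k))"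
    note i = cat(1)[OF k] and j = cat(2)[OF k]
    interpret X: alg_extension K "ob A (Cod I k)" "ob M (Cod I k)" "ob (mid E) (Cod I k)"
      "incl E (Cod I k)" "proj E (Cod I k)" by (rule ext_at[OF E j])
    interpret Y: alg_extension K "ob A (Dom I k)" "ob M (Dom I k)" "ob (mid E) (Dom I k)"
      "incl E (Dom I k)" "proj E (Dom I k)" by (rule ext_at[OF E i])
    note c = alg_homD(1)[OF algebra_diagramD(2)[OF B k] x]
    note dx = d[OF i x]
    have "f (Cod I k) (ar B k x) = ar (mid E) k (f (Dom I k) x)"
      by (rule naturalD[OF diagram_homD(3)[OF f] k x, symmetric])
    also have "\<dots> = ar (mid E) k (incl E (Dom I k) (d (Dom I k) x)) \<oplus>\<^bsub>ob (mid E) (Cod I k)\<^esub>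
        ar (mid E) k (g (Dom I k) x)"
      unfolding dx(2)
      by (rule alg_homD(2)[OF algebra_diagramD(2)[OF extensionD(1)[OF E] k]])
         (use dx diagram_homD(2)[OF g i x] in auto)
    also have "\<dots> = incl E (Cod I k) (ar M k (d (Dom I k) x)) \<oplus>\<^bsub>ob (mid E) (Cod I k)\<^esub>
        g (Cod I k) (ar B k x)"
      by (simp add: naturalD[OF extensionD(2)[OF E] k dx(1)] naturalD[OF diagram_homD(3)[OF g] k x])
    finally show "ar M k (d (Dom I k) x) = d (Cod I k) (ar B k x)"
      using d[OF j c] ar_M_closed[OF k dx(1)] diagram_homD(2)[OF g j c] by simp
  qed
  from Der_restrict[OF B \<pi> der this] d show ?thesis
    by (intro bexI[of _ "\<lambda>i\<in>Obj I. \<lambda>x\<in>carrier (ob B i). d i x"]) auto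
qed

lemma classifying_cocycle_exists:
  assumes E: "is_extension K I A M E" and \<phi>: "is_lift E \<phi>"
  shows "\<exists>d\<in>cocycles. classifies d E \<phi>"
proof -
  have h: "diagram_hom K I GA (mid E) \<phi>"
    and p: "\<And>i y. i \<in> Obj I \<Longrightarrow> y \<in> carrier (ob GA i) \<Longrightarrow> proj E i (\<phi> i y) = aug1 K I A i y"
    using \<phi> by (auto simp: is_lift_def)
  have "\<exists>d\<in>carrier (Der1 K I A M). classifies d E \<phi>"
    unfolding Der1_def classifies_def
    by (rule difference_Der[OF E G2 aug2_hom diagram_hom_comp[OF face1_hom(1) h]
          diagram_hom_comp[OF face1_hom(2) h]])
       (simp_all add: p diagram_homD(2)[OF face1_hom(1)] diagram_homD(2)[OF face1_hom(2)] aug1_face1)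
  then obtain d where d: "d \<in> carrier (Der1 K I A M)" and cl: "classifies d E \<phi>" by blast
  note cl' = cl[unfolded classifies_def, rule_format]
  have "d i (e1 i w) = d i (e0 i w) \<oplus>\<^bsub>ob M i\<^esub> d i (e2 i w)" if i: "i \<in> Obj I" and w: "w \<in> carrier (ob G3 i)" for i w
  proof -
    interpret X: alg_extension K "ob A i" "ob M i" "ob (mid E) i" "incl E i" "proj E i"
      by (rule ext_at[OF E i])
    note e = diagram_homD(2)[OF face2_hom(1) i w] diagram_homD(2)[OF face2_hom(2) i w]
      diagram_homD(2)[OF face2_hom(3) i w]
    note [simp] = Der_carrierD(2)[OF G2 aug2_hom d[unfolded Der1_def] i]
    \<comment> \<open>The common end point of two routes from
      \<open>\<phi> (d0 (e0 w)) = \<phi> (d0 (e1 w))\<close>: directly through \<open>e1 w\<close>,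
      or through \<open>e0 w\<close> and then \<open>e2 w\<close>. They meet because
      \<open>d1 e0 = d0 e2\<close> and \<open>d1 e2 = d1 e1\<close>.\<close>
    let ?c = "\<phi> i (d1 i (e1 i w))"
    have c: "?c \<in> carrier (ob (mid E) i)"
      by (intro diagram_homD(2)[OF h i] diagram_homD(2)[OF face1_hom(2) i] e)
    have "incl E i (d i (e1 i w)) \<oplus>\<^bsub>ob (mid E) i\<^esub> ?c = \<phi> i (d0 i (e0 i w))"
      using cl'[OF i e(2)] by (simp add: face_face[OF i w])
    also have "\<dots> = incl E i (d i (e0 i w)) \<oplus>\<^bsub>ob (mid E) i\<^esub> (incl E i (d i (e2 i w)) \<oplus>\<^bsub>ob (mid E) i\<^esub> ?c)"
      using cl'[OF i e(1)] cl'[OF i e(3)] by (simp add: face_face[OF i w])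
    also have "\<dots> = incl E i (d i (e0 i w) \<oplus>\<^bsub>ob M i\<^esub> d i (e2 i w)) \<oplus>\<^bsub>ob (mid E) i\<^esub> ?c"
      using c e by (simp add: X.q_add X.X.a_assoc)
    finally show ?thesis using c e by simp
  qed
  then show ?thesis using d cl by (auto simp: cocycles_iff)
qed

text \<open>Both lifts fail to factor through \<open>A\<close> by the same function
  \<open>u b = d (unit b)\<close>, so \<open>extension_comparison\<close> supplies an algebra map at
  every object, sending \<open>q m + \<phi> b\<close> to \<open>q' m + \<psi> b\<close>.\<close>

lemma equivalent_if_same_cocycle:
  assumes E: "is_extension K I A M E" and E': "is_extension K I A M E'"
    and \<phi>: "is_lift E \<phi>" and \<psi>: "is_lift E' \<psi>"
    and d: "d \<in> carrier (Der1 K I A M)" and cl: "classifies d E \<phi>" and cl': "classifies d E' \<psi>"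
  shows "(E, E') \<in> extension_equiv K I A M"
proof -
  have f: "diagram_hom K I GA (mid E) \<phi>"
    and pf: "\<And>i y. i \<in> Obj I \<Longrightarrow> y \<in> carrier (ob GA i) \<Longrightarrow> proj E i (\<phi> i y) = aug1 K I A i y"
    using \<phi> by (auto simp: is_lift_def)
  have g: "diagram_hom K I GA (mid E') \<psi>"
    and pg: "\<And>i y. i \<in> Obj I \<Longrightarrow> y \<in> carrier (ob GA i) \<Longrightarrow> proj E' i (\<psi> i y) = aug1 K I A i y"
    using \<psi> by (auto simp: is_lift_def)
  \<comment> \<open>The formula for \<open>h\<close> on elements \<open>q m + \<phi> b\<close> is
    kept in the predicate because naturality of the chosen maps is derived from it.\<close>
  let ?P = "\<lambda>i h. h \<in> alg_hom K (ob (mid E) i) (ob (mid E') i) \<and>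
    (\<forall>m\<in>carrier (ob M i). \<forall>b\<in>carrier (ob GA i).
       h (incl E i m \<oplus>\<^bsub>ob (mid E) i\<^esub> \<phi> i b) = incl E' i m \<oplus>\<^bsub>ob (mid E') i\<^esub> \<psi> i b) \<and>
    (\<forall>m\<in>carrier (ob M i). h (incl E i m) = incl E' i m) \<and>
    (\<forall>x\<in>carrier (ob (mid E) i). proj E' i (h x) = proj E i x \<and>
      (\<exists>m\<in>carrier (ob M i). \<exists>b\<in>carrier (ob GA i). x = incl E i m \<oplus>\<^bsub>ob (mid E) i\<^esub> \<phi> i b))"
  have "\<exists>h. ?P i h" if i: "i \<in> Obj I" for i
  proof -
    have u: "unit i b \<in> carrier (ob G2 i)" if "b \<in> carrier (ob GA i)" for b
      by (rule unit_closed[OF GA i that])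
    \<comment> \<open>This is \<open>classifies\<close> at \<open>unit b\<close>, where
      \<open>d0\<close> returns \<open>b\<close> and \<open>d1\<close> returns
      \<open>unit (aug1 b)\<close>.\<close>
    have "\<phi> i b = incl E i (d i (unit i b)) \<oplus>\<^bsub>ob (mid E) i\<^esub> \<phi> i (unit i (aug1 K I A i b))"
      and "\<psi> i b = incl E' i (d i (unit i b)) \<oplus>\<^bsub>ob (mid E') i\<^esub> \<psi> i (unit i (aug1 K I A i b))"
      and "d i (unit i b) \<in> carrier (ob M i)"
      if "b \<in> carrier (ob GA i)" for b
      using cl cl' i u[OF that] face1_unit[OF i that] Der_carrierD(2)[OF G2 aug2_hom d[unfolded Der1_def] i]
      by (force simp: classifies_def)+
    then show ?thesis
      unfolding Bex_def[symmetric]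
      by (intro extension_comparison[OF ext_at[OF E i] ext_at[OF E' i] algebra_diagramD(1)[OF GA i]
            diagram_homD(1)[OF f i] diagram_homD(1)[OF g i] pf[OF i] pg[OF i],
            where \<sigma> = "unit i" and u = "\<lambda>b. d i (unit i b)"])
         (simp_all add: unit_closed[OF A i] aug1_unit[OF i])
  qed
  then obtain h where h: "\<And>i. i \<in> Obj I \<Longrightarrow> ?P i (h i)" by metis
  have "natural I (mid E) (mid E') h"
    unfolding natural_def
  proof (intro ballI)
    fix k x assume k: "k \<in> Arr I" and x: "x \<in> carrier (ob (mid E) (Dom I k))"
    note i = cat(1)[OF k] and j = cat(2)[OF k]
    interpret X: alg_extension K "ob A (Dom I k)" "ob M (Dom I k)" "ob (mid E) (Dom I k)"
      "incl E (Dom I k)" "proj E (Dom I k)" by (rule ext_at[OF E i])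
    interpret Y: alg_extension K "ob A (Dom I k)" "ob M (Dom I k)" "ob (mid E') (Dom I k)"
      "incl E' (Dom I k)" "proj E' (Dom I k)" by (rule ext_at[OF E' i])
    obtain m b where m: "m \<in> carrier (ob M (Dom I k))" and b: "b \<in> carrier (ob GA (Dom I k))"
      and xe: "x = incl E (Dom I k) m \<oplus>\<^bsub>ob (mid E) (Dom I k)\<^esub> \<phi> (Dom I k) b"
      using h[OF i] x by blast
    have m': "ar M k m \<in> carrier (ob M (Cod I k))" by (rule ar_M_closed[OF k m])
    have b': "ar GA k b \<in> carrier (ob GA (Cod I k))"
      by (rule alg_homD(1)[OF algebra_diagramD(2)[OF GA k] b])
    have 1: "ar (mid E) k x = incl E (Cod I k) (ar M k m) \<oplus>\<^bsub>ob (mid E) (Cod I k)\<^esub> \<phi> (Cod I k) (ar GA k b)"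
      unfolding xe
      using alg_homD(2)[OF algebra_diagramD(2)[OF extensionD(1)[OF E] k] X.q_simps(1)[OF m] diagram_homD(2)[OF f i b]]
      by (simp add: naturalD[OF extensionD(2)[OF E] k m] naturalD[OF diagram_homD(3)[OF f] k b])
    have 2: "ar (mid E') k (h (Dom I k) x)
        = incl E' (Cod I k) (ar M k m) \<oplus>\<^bsub>ob (mid E') (Cod I k)\<^esub> \<psi> (Cod I k) (ar GA k b)"
      using alg_homD(2)[OF algebra_diagramD(2)[OF extensionD(1)[OF E'] k] Y.q_simps(1)[OF m] diagram_homD(2)[OF g i b]]
        h[OF i] m b unfolding xe
      by (simp add: naturalD[OF extensionD(2)[OF E'] k m] naturalD[OF diagram_homD(3)[OF g] k b])
    show "ar (mid E') k (h (Dom I k) x) = h (Cod I k) (ar (mid E) k x)"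
      using h[OF j] m' b' unfolding 1 2 by simp
  qed
  then show ?thesis
    using E E' h unfolding extension_equiv_def diagram_hom_def by blast
qed

definition cohomologous where
  "cohomologous d d' \<longleftrightarrow> (\<exists>e\<in>carrier (Der0 K I A M). \<forall>i\<in>Obj I. \<forall>z\<in>carrier (ob G2 i).
     d i z = (e i (d0 i z) \<oplus>\<^bsub>ob M i\<^esub> \<ominus>\<^bsub>ob M i\<^esub> e i (d1 i z)) \<oplus>\<^bsub>ob M i\<^esub> d' i z)"

text \<open>Adding \<open>e\<close> to the lift \<open>\<psi>\<close> yields another lift into the
  same \<open>E'\<close>, and its cocycle is \<open>d\<close> itself. The case of equal cocycles
  then applies.\<close>

lemma equivalent_if_cohomologous:
  assumes E: "is_extension K I A M E" and E': "is_extension K I A M E'"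
    and \<phi>: "is_lift E \<phi>" and \<psi>: "is_lift E' \<psi>"
    and d: "d \<in> carrier (Der1 K I A M)" and d': "d' \<in> carrier (Der1 K I A M)"
    and cl: "classifies d E \<phi>" and cl': "classifies d' E' \<psi>"
    and dd': "cohomologous d d'"
  shows "(E, E') \<in> extension_equiv K I A M"
proof -
  obtain e where e: "e \<in> carrier (Der0 K I A M)" and de: "\<And>i z. i \<in> Obj I \<Longrightarrow> z \<in> carrier (ob G2 i) \<Longrightarrow>
     d i z = (e i (d0 i z) \<oplus>\<^bsub>ob M i\<^esub> \<ominus>\<^bsub>ob M i\<^esub> e i (d1 i z)) \<oplus>\<^bsub>ob M i\<^esub> d' i z"
    using dd' by (auto simp: cohomologous_def)
  have g: "diagram_hom K I GA (mid E') \<psi>"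
    and pg: "\<And>i y. i \<in> Obj I \<Longrightarrow> y \<in> carrier (ob GA i) \<Longrightarrow> proj E' i (\<psi> i y) = aug1 K I A i y"
    using \<psi> by (auto simp: is_lift_def)
  note eD = Der_carrierD[OF GA aug1_hom e[unfolded Der0_def]]
  note dD = Der_carrierD(2)[OF G2 aug2_hom d[unfolded Der1_def]]
    and dD' = Der_carrierD(2)[OF G2 aug2_hom d'[unfolded Der1_def]]
  let ?\<chi> = "\<lambda>i y. incl E' i (e i y) \<oplus>\<^bsub>ob (mid E') i\<^esub> \<psi> i y"
  have "is_lift E' ?\<chi>"
    unfolding is_lift_def diagram_hom_def
  proof (intro conjI ballI)
    fix i assume i: "i \<in> Obj I"
    interpret Y: alg_extension K "ob A i" "ob M i" "ob (mid E') i" "incl E' i" "proj E' i"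
      by (rule ext_at[OF E' i])
    show "?\<chi> i \<in> alg_hom K (ob GA i) (ob (mid E') i)"
      by (rule Y.add_derivation_hom[OF algebra_diagramD(1)[OF GA i] diagram_homD(1)[OF g i]
            diagram_homD(1)[OF aug1_hom i] eD(1)[OF i] pg[OF i]])
    show "proj E' i (?\<chi> i y) = aug1 K I A i y" if y: "y \<in> carrier (ob GA i)" for y
      using eD(2)[OF i y] diagram_homD(2)[OF g i y] diagram_homD(2)[OF aug1_hom i y] pg[OF i y] by simp
  next
    show "natural I GA (mid E') ?\<chi>"
      unfolding natural_def
    proof (intro ballI)
      fix k x assume k: "k \<in> Arr I" and x: "x \<in> carrier (ob GA (Dom I k))"
      note i = cat(1)[OF k]
      interpret Y: alg_extension K "ob A (Dom I k)" "ob M (Dom I k)" "ob (mid E') (Dom I k)"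
        "incl E' (Dom I k)" "proj E' (Dom I k)" by (rule ext_at[OF E' i])
      show "ar (mid E') k (?\<chi> (Dom I k) x) = ?\<chi> (Cod I k) (ar GA k x)"
        using alg_homD(2)[OF algebra_diagramD(2)[OF extensionD(1)[OF E'] k]
            Y.q_simps(1)[OF eD(2)[OF i x]] diagram_homD(2)[OF g i x]]
        by (simp add: naturalD[OF extensionD(2)[OF E'] k eD(2)[OF i x]]
            naturalD[OF diagram_homD(3)[OF g] k x] naturalD[OF eD(3) k x])
    qed
  qed
  moreover have "classifies d E' ?\<chi>"
    unfolding classifies_def
  proof (intro ballI)
    fix i z assume i: "i \<in> Obj I" and z: "z \<in> carrier (ob G2 i)"
    interpret Y: alg_extension K "ob A i" "ob M i" "ob (mid E') i" "incl E' i" "proj E' i"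
      by (rule ext_at[OF E' i])
    note z0 = diagram_homD(2)[OF face1_hom(1) i z] and z1 = diagram_homD(2)[OF face1_hom(2) i z]
    note c = eD(2)[OF i z0] eD(2)[OF i z1] dD'[OF i z] dD[OF i z] diagram_homD(2)[OF g i z1]
    have "?\<chi> i (d0 i z) = incl E' i (e i (d0 i z) \<oplus>\<^bsub>ob M i\<^esub> d' i z) \<oplus>\<^bsub>ob (mid E') i\<^esub> \<psi> i (d1 i z)"
      using cl' i z c by (simp add: classifies_def Y.q_add Y.X.a_assoc)
    also have "e i (d0 i z) \<oplus>\<^bsub>ob M i\<^esub> d' i z = d i z \<oplus>\<^bsub>ob M i\<^esub> e i (d1 i z)"
      using c(1-3) by (simp add: de[OF i z] Y.M.a_ac Y.M.r_neg)
    also have "incl E' i \<dots> \<oplus>\<^bsub>ob (mid E') i\<^esub> \<psi> i (d1 i z) = incl E' i (d i z) \<oplus>\<^bsub>ob (mid E') i\<^esub> ?\<chi> i (d1 i z)"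
      using c by (simp add: Y.q_add Y.X.a_assoc)
    finally show "?\<chi> i (d0 i z) = incl E' i (d i z) \<oplus>\<^bsub>ob (mid E') i\<^esub> ?\<chi> i (d1 i z)" .
  qed
  ultimately show ?thesis
    by (rule equivalent_if_same_cocycle[OF E E' \<phi> _ d cl])
qed

text \<open>The composite \<open>h \<phi>\<close> and \<open>\<psi>\<close> are two lifts into
  \<open>E'\<close>; their difference is a derivation \<open>e\<close> of \<open>G(A)\<close>, and
  its coboundary is the difference of the cocycles.\<close>

lemma cohomologous_if_equivalent:
  assumes EE': "(E, E') \<in> extension_equiv K I A M"
    and \<phi>: "is_lift E \<phi>" and \<psi>: "is_lift E' \<psi>"
    and d: "d \<in> carrier (Der1 K I A M)" and d': "d' \<in> carrier (Der1 K I A M)"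
    and cl: "classifies d E \<phi>" and cl': "classifies d' E' \<psi>"
  shows "cohomologous d d'"
proof -
  obtain h where E: "is_extension K I A M E" and E': "is_extension K I A M E'"
    and h: "diagram_hom K I (mid E) (mid E') h"
    and hq: "\<And>i m. i \<in> Obj I \<Longrightarrow> m \<in> carrier (ob M i) \<Longrightarrow> h i (incl E i m) = incl E' i m"
    and hp: "\<And>i x. i \<in> Obj I \<Longrightarrow> x \<in> carrier (ob (mid E) i) \<Longrightarrow> proj E' i (h i x) = proj E i x"
    using EE' by (auto simp: extension_equiv_def)
  have f: "diagram_hom K I GA (mid E) \<phi>"
    and pf: "\<And>i y. i \<in> Obj I \<Longrightarrow> y \<in> carrier (ob GA i) \<Longrightarrow> proj E i (\<phi> i y) = aug1 K I A i y"
    using \<phi> by (auto simp: is_lift_def)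
  have g: "diagram_hom K I GA (mid E') \<psi>"
    and pg: "\<And>i y. i \<in> Obj I \<Longrightarrow> y \<in> carrier (ob GA i) \<Longrightarrow> proj E' i (\<psi> i y) = aug1 K I A i y"
    using \<psi> by (auto simp: is_lift_def)
  note dD = Der_carrierD(2)[OF G2 aug2_hom d[unfolded Der1_def]]
    and dD' = Der_carrierD(2)[OF G2 aug2_hom d'[unfolded Der1_def]]
  have "\<exists>e\<in>carrier (Der0 K I A M). \<forall>i\<in>Obj I. \<forall>y\<in>carrier (ob GA i).
      h i (\<phi> i y) = incl E' i (e i y) \<oplus>\<^bsub>ob (mid E') i\<^esub> \<psi> i y"
    unfolding Der0_def
    by (rule difference_Der[OF E' GA aug1_hom diagram_hom_comp[OF f h] g])
       (simp_all add: hp pf pg diagram_homD(2)[OF f])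
  then obtain e where e: "e \<in> carrier (Der0 K I A M)"
    and eh: "\<And>i y. i \<in> Obj I \<Longrightarrow> y \<in> carrier (ob GA i) \<Longrightarrow>
      h i (\<phi> i y) = incl E' i (e i y) \<oplus>\<^bsub>ob (mid E') i\<^esub> \<psi> i y"
    by blast
  note eD = Der_carrierD[OF GA aug1_hom e[unfolded Der0_def]]
  have "d i z = (e i (d0 i z) \<oplus>\<^bsub>ob M i\<^esub> \<ominus>\<^bsub>ob M i\<^esub> e i (d1 i z)) \<oplus>\<^bsub>ob M i\<^esub> d' i z"
    if i: "i \<in> Obj I" and z: "z \<in> carrier (ob G2 i)" for i z
  proof -
    interpret X: alg_extension K "ob A i" "ob M i" "ob (mid E) i" "incl E i" "proj E i"
      by (rule ext_at[OF E i])
    interpret Y: alg_extension K "ob A i" "ob M i" "ob (mid E') i" "incl E' i" "proj E' i"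
      by (rule ext_at[OF E' i])
    note z0 = diagram_homD(2)[OF face1_hom(1) i z] and z1 = diagram_homD(2)[OF face1_hom(2) i z]
    note c = eD(2)[OF i z0] eD(2)[OF i z1] dD'[OF i z] dD[OF i z] diagram_homD(2)[OF g i z1]
      diagram_homD(2)[OF f i z1]
    \<comment> \<open>The element \<open>h (\<phi> (d0 z))\<close> is computed twice, once by
      classifying \<open>\<phi>\<close> before applying \<open>h\<close> and once by passing to
      \<open>\<psi>\<close> first; comparing \<open>M\<close> parts gives the relation.\<close>
    have "incl E' i (d i z \<oplus>\<^bsub>ob M i\<^esub> e i (d1 i z)) \<oplus>\<^bsub>ob (mid E') i\<^esub> \<psi> i (d1 i z)
        = incl E' i (d i z) \<oplus>\<^bsub>ob (mid E') i\<^esub> h i (\<phi> i (d1 i z))"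
      using c by (simp add: eh[OF i z1] Y.q_add Y.X.a_assoc)
    also have "\<dots> = h i (\<phi> i (d0 i z))"
      using cl i z c alg_homD(2)[OF diagram_homD(1)[OF h i] X.q_simps(1)[OF c(4)] c(6)]
      by (simp add: classifies_def hq)
    also have "\<dots> = incl E' i (e i (d0 i z) \<oplus>\<^bsub>ob M i\<^esub> d' i z) \<oplus>\<^bsub>ob (mid E') i\<^esub> \<psi> i (d1 i z)"
      using cl' i z c by (simp add: eh[OF i z0] classifies_def Y.q_add Y.X.a_assoc)
    finally have *: "d i z \<oplus>\<^bsub>ob M i\<^esub> e i (d1 i z) = e i (d0 i z) \<oplus>\<^bsub>ob M i\<^esub> d' i z"
      using c by simp
    have "d i z = (d i z \<oplus>\<^bsub>ob M i\<^esub> e i (d1 i z)) \<oplus>\<^bsub>ob M i\<^esub> \<ominus>\<^bsub>ob M i\<^esub> e i (d1 i z)"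
      using c by (simp add: X.M.a_assoc X.M.r_neg)
    then show ?thesis unfolding * using c by (simp add: X.M.a_ac)
  qed
  then show ?thesis using e by (auto simp: cohomologous_def)
qed

section \<open>The extension of a cocycle\<close>

text \<open>The cocycle condition at \<open>w = unit z\<close>, whose faces are \<open>z\<close>,
  \<open>unit (d0 z)\<close> and \<open>unit (d1 z)\<close>.\<close>

lemma cocycle_difference:
  assumes d: "d \<in> cocycles" and i: "i \<in> Obj I" and z: "z \<in> carrier (ob G2 i)"
  shows "d i (unit i (d0 i z)) = d i z \<oplus>\<^bsub>ob M i\<^esub> d i (unit i (d1 i z))"
  using d i unit_closed[OF G2 i z] face2_unit[OF i z] by (fastforce simp: cocycles_iff)

text \<open>Each law for \<open>u\<close> is \<open>cocycle_difference\<close> at the corresponding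
  expression in \<open>unit x\<close> and \<open>unit y\<close> inside \<open>G2\<close>:
  \<open>d0\<close> removes the inner \<open>unit\<close>, \<open>d1\<close> replaces
  \<open>x\<close> by \<open>aug1 x\<close>, and \<open>d\<close> expands as a derivation.\<close>

lemma cocycle_twisting:
  assumes d: "d \<in> cocycles" and i: "i \<in> Obj I" and e: "inj e"
  shows "twisting K (ob A i) (ob M i) (ob GA i) (aug1 K I A i) (unit i) (\<lambda>y. d i (unit i y)) e"
proof -
  interpret B: algebra K "ob GA i" by (rule algebra_diagramD(1)[OF GA i])
  interpret C: algebra K "ob G2 i" by (rule algebra_diagramD(1)[OF G2 i])
  interpret M: abelian_group "ob M i" by (rule M_group[OF i])
  have d1: "d \<in> carrier (Der K I A M G2 (aug2 K I A))" using d by (simp add: cocycles_iff Der1_def)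
  note D [simp] = derivationD[OF Der_carrierD(1)[OF G2 aug2_hom d1 i]]
  note h0 [simp] = alg_homD[OF diagram_homD(1)[OF face1_hom(1) i]]
  note h1 [simp] = alg_homD[OF diagram_homD(1)[OF face1_hom(2) i]]
  note [simp] = unit_closed[OF A i] aug1_unit[OF i] face1_unit[OF i] unit_closed[OF GA i]
    cocycle_difference[OF d i] diagram_homD(2)[OF aug1_hom i]
  have a2: "aug2 K I A i (unit i y) = aug1 K I A i y" if "y \<in> carrier (ob GA i)" for y
    using aug1_face1(1)[OF i, of "unit i y"] that by simp
  \<comment> \<open>Both faces of \<open>unit (unit a)\<close> are \<open>unit a\<close>, so the
    difference formula reads \<open>v = v + v\<close>.\<close>
  have u\<sigma>: "d i (unit i (unit i a)) = \<zero>\<^bsub>ob M i\<^esub>" if "a \<in> carrier (ob A i)" for a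
    using cocycle_difference[OF d i, of "unit i (unit i a)"] that by simp
  have u_add: "d i (unit i (x \<oplus>\<^bsub>ob GA i\<^esub> y)) = (d i (unit i x) \<oplus>\<^bsub>ob M i\<^esub> d i (unit i y)) \<oplus>\<^bsub>ob M i\<^esub>
      d i (unit i (unit i (aug1 K I A i x) \<oplus>\<^bsub>ob GA i\<^esub> unit i (aug1 K I A i y)))"
    if "x \<in> carrier (ob GA i)" "y \<in> carrier (ob GA i)" for x y
    using cocycle_difference[OF d i, of "unit i x \<oplus>\<^bsub>ob G2 i\<^esub> unit i y"] that by simp
  have u_mult: "d i (unit i (x \<otimes>\<^bsub>ob GA i\<^esub> y)) = (aug1 K I A i x \<odot>\<^bsub>ob M i\<^esub> d i (unit i y) \<oplus>\<^bsub>ob M i\<^esub>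
      aug1 K I A i y \<odot>\<^bsub>ob M i\<^esub> d i (unit i x)) \<oplus>\<^bsub>ob M i\<^esub>
      d i (unit i (unit i (aug1 K I A i x) \<otimes>\<^bsub>ob GA i\<^esub> unit i (aug1 K I A i y)))"
    if "x \<in> carrier (ob GA i)" "y \<in> carrier (ob GA i)" for x y
    using cocycle_difference[OF d i, of "unit i x \<otimes>\<^bsub>ob G2 i\<^esub> unit i y"] that by (simp add: a2)
  have u_smult: "d i (unit i (c \<odot>\<^bsub>ob GA i\<^esub> x)) = kscale (ob A i) (ob M i) c (d i (unit i x)) \<oplus>\<^bsub>ob M i\<^esub>
      d i (unit i (c \<odot>\<^bsub>ob GA i\<^esub> unit i (aug1 K I A i x)))"
    if "c \<in> carrier K" "x \<in> carrier (ob GA i)" for c x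
    using cocycle_difference[OF d i, of "c \<odot>\<^bsub>ob G2 i\<^esub> unit i x"] that by simp
  have u: "d i (unit i y) \<in> carrier (ob M i)" if "y \<in> carrier (ob GA i)" for y
    using that by simp
  show ?thesis
    by (rule twisting.intro[OF algebra_diagramD(1)[OF A i] M_module[OF i] algebra_diagramD(1)[OF GA i]
          diagram_homD(1)[OF aug1_hom i]])
       (fact unit_closed[OF A i] aug1_unit[OF i] u u\<sigma> u_add u_mult u_smult e)+
qed

lemma kscale_natural:
  assumes f: "f \<in> Arr I" and c: "c \<in> carrier K" and m: "m \<in> carrier (ob M (Dom I f))"
  shows "ar M f (kscale (ob A (Dom I f)) (ob M (Dom I f)) c m)
       = kscale (ob A (Cod I f)) (ob M (Cod I f)) c (ar M f m)"
proof -
  interpret algebra K "ob A (Dom I f)" by (rule algebra_diagramD(1)[OF A cat(1)[OF f]])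
  note h = alg_homD[OF algebra_diagramD(2)[OF A f]]
  show ?thesis using c m by (simp add: kscale_def ar_M_smult[OF f] h)
qed

text \<open>The algebras come from \<open>twisting\<close> object by object. The new content is the
  action of arrows, whose compatibility rests on naturality of \<open>d\<close>.\<close>

lemma extension_of_cocycle:
  fixes e :: "'m \<times> 'a \<Rightarrow> 'x"
  assumes d: "d \<in> cocycles" and e: "inj e"
  shows "\<exists>(E :: ('o, 'r, 'k, 'a, 'm, 'x) extension) \<phi>.
    is_extension K I A M E \<and> is_lift E \<phi> \<and> classifies d E \<phi>"
proof -
  \<comment> \<open>The construction for a single algebra is carried out at every object with the
    same injection \<open>e\<close>; the projection reads the second coordinate through
    \<open>e\<close> and so is one function for all objects.\<close>
  define u where "u i y = d i (unit i y)" for i y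
  define \<Phi> where "\<Phi> i = twisting.\<Phi> (ob M i) (aug1 K I A i) (u i) e" for i
  define \<rho> where "\<rho> i = twisting.\<rho> (unit i) e" for i
  define X where "X i = twisting.X (ob A i) (ob M i) (ob GA i) (aug1 K I A i) (unit i) (u i) e" for i
  define q where "q i = twisting.q (ob M i) (ob GA i) (aug1 K I A i) (u i) e" for i
  define p where "p = twisting.p e"
  \<comment> \<open>An arrow acts componentwise on the representative chosen by
    \<open>\<rho>\<close>; the fact \<open>T\<close> below shows that any other representative gives
    the same value.\<close>
  define T where "T f x = \<Phi> (Cod I f) (ar M f (fst (\<rho> (Dom I f) x)), ar GA f (snd (\<rho> (Dom I f) x)))" for f x
  define E where "E = \<lparr>mid = \<lparr>ob = X, ar = T\<rparr>, incl = q, proj = (\<lambda>_. p)\<rparr>"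
  have tw: "twisting K (ob A i) (ob M i) (ob GA i) (aug1 K I A i) (unit i) (u i) e" if "i \<in> Obj I" for i
    using cocycle_twisting[OF d that e] by (simp add: u_def[abs_def])
  note X_alg = twisting.X_algebra[OF tw, folded X_def]
  note \<Phi>_hom = twisting.\<Phi>_hom[OF tw, folded X_def \<Phi>_def]
  note X_carrier = twisting.X_carrier[OF tw, folded X_def \<Phi>_def]
  note \<rho>_\<Phi> = twisting.\<rho>_\<Phi>[OF tw, folded \<rho>_def \<Phi>_def]
  note \<Phi>_eqI = twisting.\<Phi>_eqI[OF tw, folded \<Phi>_def]
  note X_ext = twisting.X_extension[OF tw, folded X_def, folded q_def p_def]
  note p_\<Phi> = twisting.p_\<Phi>[OF tw, folded p_def \<Phi>_def]
  note \<Phi>_base = twisting.\<Phi>_base_hom[OF tw, folded X_def \<Phi>_def]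
  note \<Phi>_split = twisting.\<Phi>_split[OF tw, folded X_def \<Phi>_def q_def]
  note q_eq = twisting.q_def[OF tw, folded q_def \<Phi>_def]
  have uc: "u i y \<in> carrier (ob M i)" if "i \<in> Obj I" "y \<in> carrier (ob GA i)" for i y
    using twisting.u[OF tw] that .
  have arG: "ar GA f b \<in> carrier (ob GA (Cod I f))"
    if "f \<in> Arr I" "b \<in> carrier (ob GA (Dom I f))" for f b
    using alg_homD(1)[OF algebra_diagramD(2)[OF GA]] that .
  have aug_nat: "aug1 K I A (Cod I f) (ar GA f b) = ar A f (aug1 K I A (Dom I f) b)"
    if "f \<in> Arr I" "b \<in> carrier (ob GA (Dom I f))" for f b
    using naturalD[OF diagram_homD(3)[OF aug1_hom] that] by simp
  have T: "T f (\<Phi> (Dom I f) (m, b)) = \<Phi> (Cod I f) (ar M f m, ar GA f b)"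
    if f: "f \<in> Arr I" and m: "m \<in> carrier (ob M (Dom I f))" and b: "b \<in> carrier (ob GA (Dom I f))" for f m b
  proof -
    note i = cat(1)[OF f] and j = cat(2)[OF f]
    interpret M: abelian_group "ob M (Cod I f)" by (rule M_group[OF j])
    have d1: "d \<in> carrier (Der K I A M G2 (aug2 K I A))" using d by (simp add: cocycles_iff Der1_def)
    note ub = unit_closed[OF GA i b]
    let ?a = "aug1 K I A (Dom I f) b" and ?z = "ar G2 f (unit (Dom I f) b)"
    have a: "?a \<in> carrier (ob A (Dom I f))" by (rule diagram_homD(2)[OF aug1_hom i b])
    note ua = unit_closed[OF A i a]
    have z: "?z \<in> carrier (ob G2 (Cod I f))" by (rule alg_homD(1)[OF algebra_diagramD(2)[OF G2 f] ub])
    \<comment> \<open>\<open>unit\<close> is not a map of diagrams, so \<open>u\<close> need not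
      commute with arrows. The difference formula at the image of \<open>unit b\<close> measures the
      defect, and it is precisely the correction incurred by replacing \<open>b\<close> with
      \<open>unit (aug1 b)\<close>.\<close>
    have "u (Cod I f) (ar GA f b) = ar M f (u (Dom I f) b) \<oplus>\<^bsub>ob M (Cod I f)\<^esub> u (Cod I f) (ar GA f (unit (Dom I f) ?a))"
      using cocycle_difference[OF d j z]
      by (simp add: naturalD[OF diagram_homD(3)[OF face1_hom(1)] f ub, symmetric]
          naturalD[OF diagram_homD(3)[OF face1_hom(2)] f ub, symmetric]
          naturalD[OF Der_carrierD(3)[OF G2 aug2_hom d1] f ub, symmetric] face1_unit[OF i b] u_def)
    then show ?thesis
      unfolding T_def \<rho>_\<Phi>[OF i] fst_conv snd_conv
      by (intro \<Phi>_eqI[OF j])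
         (use m b uc[OF i b] ua in \<open>simp_all add: ar_M_add[OF f] ar_M_closed[OF f] M.a_assoc
            uc[OF j arG[OF f]] aug_nat[OF f] aug1_unit[OF i a]\<close>)
  qed
  have \<Phi>c: "\<Phi> i (m, b) \<in> carrier (X i)" if "i \<in> Obj I" "m \<in> carrier (ob M i)" "b \<in> carrier (ob GA i)" for i m b
    using that by (simp add: X_carrier)
  have \<Phi>_surj: "\<exists>m\<in>carrier (ob M i). \<exists>b\<in>carrier (ob GA i). x = \<Phi> i (m, b)"
    if "i \<in> Obj I" "x \<in> carrier (X i)" for i x
    using that by (auto simp: X_carrier)
  have T_hom: "T f \<in> alg_hom K (X (Dom I f)) (X (Cod I f))" if f: "f \<in> Arr I" for f
  proof -
    note i = cat(1)[OF f] and j = cat(2)[OF f]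
    interpret MD: module "ob A (Dom I f)" "ob M (Dom I f)" by (rule M_module[OF i])
    interpret BD: algebra K "ob GA (Dom I f)" by (rule algebra_diagramD(1)[OF GA i])
    note [simp] = T[OF f] ar_M_closed[OF f] ar_M_zero[OF f] ar_M_add[OF f] ar_M_smult[OF f]
      alg_homD[OF algebra_diagramD(2)[OF GA f]] kscale_natural[OF f] aug_nat[OF f]
      diagram_homD(2)[OF aug1_hom i] kscale_closed[OF algebra_diagramD(1)[OF A i] M_module[OF i]]
    note opD = alg_homD(2,3,5)[OF \<Phi>_hom[OF i], symmetric] and opC = alg_homD(2,3,5)[OF \<Phi>_hom[OF j], symmetric]
    show ?thesis
    proof (rule alg_homI)
      have "\<one>\<^bsub>X (Dom I f)\<^esub> = \<Phi> (Dom I f) (\<zero>\<^bsub>ob M (Dom I f)\<^esub>, \<one>\<^bsub>ob GA (Dom I f)\<^esub>)"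
        "\<one>\<^bsub>X (Cod I f)\<^esub> = \<Phi> (Cod I f) (\<zero>\<^bsub>ob M (Cod I f)\<^esub>, \<one>\<^bsub>ob GA (Cod I f)\<^esub>)"
        using alg_homD(4)[OF \<Phi>_hom[OF i]] alg_homD(4)[OF \<Phi>_hom[OF j]] by simp_all
      then show "T f \<one>\<^bsub>X (Dom I f)\<^esub> = \<one>\<^bsub>X (Cod I f)\<^esub>" by simp
    next
      fix x assume "x \<in> carrier (X (Dom I f))"
      then obtain m b where mb [simp]: "m \<in> carrier (ob M (Dom I f))" "b \<in> carrier (ob GA (Dom I f))"
        "x = \<Phi> (Dom I f) (m, b)" using \<Phi>_surj[OF i] by blast
      show "T f x \<in> carrier (X (Cod I f))" by (simp add: \<Phi>c[OF j])
      show "T f (c \<odot>\<^bsub>X (Dom I f)\<^esub> x) = c \<odot>\<^bsub>X (Cod I f)\<^esub> T f x" if "c \<in> carrier K" for c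
        using that by (simp add: opD opC)
      fix y assume "y \<in> carrier (X (Dom I f))"
      then obtain n c where nc [simp]: "n \<in> carrier (ob M (Dom I f))" "c \<in> carrier (ob GA (Dom I f))"
        "y = \<Phi> (Dom I f) (n, c)" using \<Phi>_surj[OF i] by blast
      show "T f (x \<oplus>\<^bsub>X (Dom I f)\<^esub> y) = T f x \<oplus>\<^bsub>X (Cod I f)\<^esub> T f y"
        by (simp add: opD opC)
      show "T f (x \<otimes>\<^bsub>X (Dom I f)\<^esub> y) = T f x \<otimes>\<^bsub>X (Cod I f)\<^esub> T f y"
        by (simp add: opD opC)
    qed
  qed
  note GA_fun = functorialD[OF algebra_diagramD(3)[OF GA]] and M_fun = functorialD[OF M_functorial]
  have func: "functorial I (mid E)"
    unfolding functorial_def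
  proof (intro conjI ballI impI)
    show "ar (mid E) f \<in> carrier (ob (mid E) (Dom I f)) \<rightarrow> carrier (ob (mid E) (Cod I f))" if "f \<in> Arr I" for f
      using alg_homD(1)[OF T_hom[OF that]] by (simp add: E_def)
  next
    fix i x assume i: "i \<in> Obj I" and "x \<in> carrier (ob (mid E) i)"
    then have "x \<in> carrier (X i)" by (simp add: E_def)
    from \<Phi>_surj[OF i this] obtain m b where "m \<in> carrier (ob M i)" "b \<in> carrier (ob GA i)" "x = \<Phi> i (m, b)"
      by blast
    then show "ar (mid E) (Ident I i) x = x"
      using T[of "Ident I i" m b] GA_fun(2)[OF i] M_fun(2)[OF i] i by (simp add: E_def cat)
  next
    fix f g x assume f: "f \<in> Arr I" and g: "g \<in> Arr I" and fg: "Dom I g = Cod I f"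
      and "x \<in> carrier (ob (mid E) (Dom I f))"
    then have "x \<in> carrier (X (Dom I f))" by (simp add: E_def)
    from \<Phi>_surj[OF cat(1)[OF f] this] obtain m b where "m \<in> carrier (ob M (Dom I f))" "b \<in> carrier (ob GA (Dom I f))" "x = \<Phi> (Dom I f) (m, b)"
      by blast
    then show "ar (mid E) (Comp I g f) x = ar (mid E) g (ar (mid E) f x)"
      using T[OF f, of m b] T[OF g, of "ar M f m" "ar GA f b"] T[of "Comp I g f" m b]
        GA_fun(3)[OF f g fg] M_fun(3)[OF f g fg] f g fg GA_fun(1)[OF f] M_fun(1)[OF f]
      by (simp add: E_def cat)
  qed
  have alg: "algebra_diagram K I (mid E)"
    using func X_alg T_hom by (simp add: algebra_diagram_def E_def)
  have "natural I M (mid E) (incl E)"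
    unfolding natural_def
  proof (intro ballI)
    fix f m assume f: "f \<in> Arr I" and m: "m \<in> carrier (ob M (Dom I f))"
    note i = cat(1)[OF f] and j = cat(2)[OF f]
    interpret algebra K "ob GA (Dom I f)" by (rule algebra_diagramD(1)[OF GA i])
    have "ar GA f \<zero>\<^bsub>ob GA (Dom I f)\<^esub> = \<zero>\<^bsub>ob GA (Cod I f)\<^esub>"
      by (rule alg_hom_zero[OF algebra_diagramD(1)[OF GA i] algebra_diagramD(1)[OF GA j] algebra_diagramD(2)[OF GA f]])
    then show "ar (mid E) f (incl E (Dom I f) m) = incl E (Cod I f) (ar M f m)"
      using T[OF f m, of "\<zero>\<^bsub>ob GA (Dom I f)\<^esub>"] by (simp add: E_def q_eq[OF i] q_eq[OF j])
  qed
  moreover have "natural I (mid E) A (proj E)"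
    unfolding natural_def
  proof (intro ballI)
    fix f x assume f: "f \<in> Arr I" and "x \<in> carrier (ob (mid E) (Dom I f))"
    then have "x \<in> carrier (X (Dom I f))" by (simp add: E_def)
    from \<Phi>_surj[OF cat(1)[OF f] this] obtain m b where mb: "m \<in> carrier (ob M (Dom I f))" "b \<in> carrier (ob GA (Dom I f))" "x = \<Phi> (Dom I f) (m, b)"
      by blast
    then show "ar A f (proj E (Dom I f) x) = proj E (Cod I f) (ar (mid E) f x)"
      using T[OF f mb(1,2)] aug_nat[OF f mb(2)] by (simp add: E_def p_\<Phi>[OF cat(1)[OF f]] p_\<Phi>[OF cat(2)[OF f]])
  qed
  moreover have "algebra_extension K (ob A i) (ob M i) (ob (mid E) i) (incl E i) (proj E i)" if "i \<in> Obj I" for i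
    using X_ext[OF that] by (simp add: E_def)
  ultimately have "is_extension K I A M E"
    using alg by (simp add: is_extension_def)
  moreover define \<phi> where "\<phi> i b = \<Phi> i (\<zero>\<^bsub>ob M i\<^esub>, b)" for i b
  have "is_lift E \<phi>"
    unfolding is_lift_def diagram_hom_def natural_def
  proof (intro conjI ballI)
    show "\<phi> i \<in> alg_hom K (ob GA i) (ob (mid E) i)" if "i \<in> Obj I" for i
      using \<Phi>_base[OF that] by (simp add: E_def \<phi>_def[abs_def])
    show "proj E i (\<phi> i y) = aug1 K I A i y" if "i \<in> Obj I" for i y
      by (simp add: E_def \<phi>_def p_\<Phi>[OF that])
    show "ar (mid E) f (\<phi> (Dom I f) x) = \<phi> (Cod I f) (ar GA f x)"
      if f: "f \<in> Arr I" and x: "x \<in> carrier (ob GA (Dom I f))" for f x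
    proof -
      interpret abelian_group "ob M (Dom I f)" by (rule M_group[OF cat(1)[OF f]])
      show ?thesis using T[OF f _ x] by (simp add: E_def \<phi>_def ar_M_zero[OF f])
    qed
  qed
  moreover have "classifies d E \<phi>"
    unfolding classifies_def
  proof (intro ballI)
    fix i z assume i: "i \<in> Obj I" and z: "z \<in> carrier (ob G2 i)"
    interpret abelian_group "ob M i" by (rule M_group[OF i])
    have d1: "d \<in> carrier (Der K I A M G2 (aug2 K I A))" using d by (simp add: cocycles_iff Der1_def)
    note dz = Der_carrierD(2)[OF G2 aug2_hom d1 i z]
    note z0 = diagram_homD(2)[OF face1_hom(1) i z] and z1 = diagram_homD(2)[OF face1_hom(2) i z]
    \<comment> \<open>Under \<open>\<Phi>\<close> the claim becomes
      \<open>u (d0 z) = d z + u (d1 z)\<close>, which is the difference formula.\<close>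
    have "\<phi> i (d0 i z) = \<Phi> i (d i z, d1 i z)"
      unfolding \<phi>_def
      by (rule \<Phi>_eqI[OF i]) (use cocycle_difference[OF d i z] uc[OF i z0] in \<open>simp_all add: u_def aug1_face1[OF i z]\<close>)
    also have "\<dots> = q i (d i z) \<oplus>\<^bsub>X i\<^esub> \<phi> i (d1 i z)"
      unfolding \<phi>_def by (rule \<Phi>_split[OF i dz z1])
    finally show "\<phi> i (d0 i z) = incl E i (d i z) \<oplus>\<^bsub>ob (mid E) i\<^esub> \<phi> i (d1 i z)"
      by (simp add: E_def)
  qed
  ultimately show ?thesis by blast
qed

section \<open>Cohomology classes as cosets of coboundaries\<close>

lemma coboundaries_subgroup: "subgroup (cobd0 K I A M ` carrier (Der0 K I A M)) (Der1 K I A M)"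
proof -
  interpret D0: comm_group "Der0 K I A M"
    unfolding Der0_def by (rule Der_comm_group[OF GA aug1_hom])
  interpret D1: comm_group "Der1 K I A M"
    unfolding Der1_def by (rule Der_comm_group[OF G2 aug2_hom])
  have "cobd0 K I A M (d \<otimes>\<^bsub>Der0 K I A M\<^esub> e) = cobd0 K I A M d \<otimes>\<^bsub>Der1 K I A M\<^esub> cobd0 K I A M e"
    if d: "d \<in> carrier (Der0 K I A M)" and e: "e \<in> carrier (Der0 K I A M)" for d e
  proof (rule Der_eqI[OF G2 aug2_hom, folded Der1_def])
    fix i z assume i: "i \<in> Obj I" and z: "z \<in> carrier (ob G2 i)"
    interpret M: abelian_group "ob M i" by (rule M_group[OF i])
    note z0 = diagram_homD(2)[OF face1_hom(1) i z] and z1 = diagram_homD(2)[OF face1_hom(2) i z]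
    note Dd = Der_carrierD(2)[OF GA aug1_hom d[unfolded Der0_def] i]
      and De = Der_carrierD(2)[OF GA aug1_hom e[unfolded Der0_def] i]
    have m: "(d \<otimes>\<^bsub>Der0 K I A M\<^esub> e) i y = d i y \<oplus>\<^bsub>ob M i\<^esub> e i y" if "y \<in> carrier (ob GA i)" for y
      unfolding Der0_def by (rule Der_apply(2)[OF GA aug1_hom i that])
    have m1: "(f \<otimes>\<^bsub>Der1 K I A M\<^esub> g) i z = f i z \<oplus>\<^bsub>ob M i\<^esub> g i z" for f g
      unfolding Der1_def by (rule Der_apply(2)[OF G2 aug2_hom i z])
    show "cobd0 K I A M (d \<otimes>\<^bsub>Der0 K I A M\<^esub> e) i z
        = (cobd0 K I A M d \<otimes>\<^bsub>Der1 K I A M\<^esub> cobd0 K I A M e) i z"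
      using Dd[OF z0] Dd[OF z1] De[OF z0] De[OF z1] m[OF z0] m[OF z1]
      by (simp add: m1 cobd0_pointwise(2)[OF d i z] cobd0_pointwise(2)[OF e i z]
          cobd0_pointwise(2)[OF D0.m_closed[OF d e] i z] M.minus_add M.a_ac)
  qed (use d e in \<open>simp_all add: cobd0_pointwise(1)\<close>)
  then have "group_hom (Der0 K I A M) (Der1 K I A M) (cobd0 K I A M)"
    by unfold_locales (auto simp: hom_def cobd0_pointwise(1))
  then show ?thesis by (rule group_hom.img_is_subgroup)
qed

text \<open>Two cosets of a subgroup agree exactly when \<open>d\<close> lies in the coset of
  \<open>d'\<close>, that is, when \<open>d\<close> is a coboundary plus \<open>d'\<close>;
  pointwise this is \<open>cohomologous\<close>.\<close>

lemma coset_eq_iff_cohomologous: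
  assumes d: "d \<in> carrier (Der1 K I A M)" and d': "d' \<in> carrier (Der1 K I A M)"
  shows "(cobd0 K I A M ` carrier (Der0 K I A M)) #>\<^bsub>Der1 K I A M\<^esub> d
       = (cobd0 K I A M ` carrier (Der0 K I A M)) #>\<^bsub>Der1 K I A M\<^esub> d' \<longleftrightarrow> cohomologous d d'"
    (is "?B #>\<^bsub>_\<^esub> d = ?B #>\<^bsub>_\<^esub> d' \<longleftrightarrow> _")
proof -
  interpret D1: comm_group "Der1 K I A M"
    unfolding Der1_def by (rule Der_comm_group[OF G2 aug2_hom])
  have m1: "(f \<otimes>\<^bsub>Der1 K I A M\<^esub> g) i z = f i z \<oplus>\<^bsub>ob M i\<^esub> g i z"
    if "i \<in> Obj I" "z \<in> carrier (ob G2 i)" for f g i z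
    unfolding Der1_def by (rule Der_apply(2)[OF G2 aug2_hom that])
  have "?B #>\<^bsub>Der1 K I A M\<^esub> d = ?B #>\<^bsub>Der1 K I A M\<^esub> d' \<longleftrightarrow> d \<in> ?B #>\<^bsub>Der1 K I A M\<^esub> d'"
    using D1.rcos_self[OF d coboundaries_subgroup] D1.repr_independence[OF _ d' coboundaries_subgroup] by auto
  also have "\<dots> \<longleftrightarrow> (\<exists>e\<in>carrier (Der0 K I A M). d = cobd0 K I A M e \<otimes>\<^bsub>Der1 K I A M\<^esub> d')"
    by (auto simp: r_coset_def)
  also have "\<dots> \<longleftrightarrow> cohomologous d d'"
    unfolding cohomologous_def
  proof (rule bex_cong[OF refl])
    fix e assume e: "e \<in> carrier (Der0 K I A M)"
    have "d = cobd0 K I A M e \<otimes>\<^bsub>Der1 K I A M\<^esub> d' \<longleftrightarrow> (\<forall>i\<in>Obj I. \<forall>z\<in>carrier (ob G2 i).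
        d i z = (cobd0 K I A M e \<otimes>\<^bsub>Der1 K I A M\<^esub> d') i z)"
      using Der_eqI[OF G2 aug2_hom, folded Der1_def, OF d D1.m_closed[OF cobd0_pointwise(1)[OF e] d']] by auto
    then show "d = cobd0 K I A M e \<otimes>\<^bsub>Der1 K I A M\<^esub> d' \<longleftrightarrow> (\<forall>i\<in>Obj I. \<forall>z\<in>carrier (ob G2 i).
        d i z = (e i (d0 i z) \<oplus>\<^bsub>ob M i\<^esub> \<ominus>\<^bsub>ob M i\<^esub> e i (d1 i z)) \<oplus>\<^bsub>ob M i\<^esub> d' i z)"
      by (simp add: m1 cobd0_pointwise(2)[OF e])
  qed
  finally show ?thesis .
qed

text \<open>Restricting the carrier to the cocycles leaves the operation unchanged, so the cosets
  forming \<open>H1\<close> may be computed in the whole group \<open>Der1\<close>.\<close>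

lemma H1_carrier:
  "carrier (H1 K I A M) =
    (\<lambda>d. (cobd0 K I A M ` carrier (Der0 K I A M)) #>\<^bsub>Der1 K I A M\<^esub> d) ` cocycles"
  by (simp add: H1_def carrier_FactGroup r_coset_def cocycles_def)

end

text \<open>The hypothesis makes \<open>r\<close> the kernel relation of \<open>g\<close> on
  \<open>S\<close>, so the classes are the fibres of \<open>g\<close> over its image.\<close>

lemma quotient_eqpoll_image:
  assumes "\<And>x y. (x, y) \<in> r \<longleftrightarrow> x \<in> S \<and> y \<in> S \<and> g x = g y"
  shows "g ` S \<approx> S // r"
proof -
  have *: "r `` {x} = {y \<in> S. g y = g x}" if "x \<in> S" for x
    using assms that by auto
  have "bij_betw (\<lambda>c. {y \<in> S. g y = c}) (g ` S) (S // r)"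
    unfolding bij_betw_def
  proof (intro conjI)
    show "inj_on (\<lambda>c. {y \<in> S. g y = c}) (g ` S)" by (auto simp: inj_on_def)
    show "(\<lambda>c. {y \<in> S. g y = c}) ` g ` S = S // r"
      by (auto simp: quotient_def * image_iff)
  qed
  then show ?thesis by (auto simp: eqpoll_def)
qed

theorem theorem6p11:
  fixes K :: "'k ring"
    and I :: "('o, 'r) small_cat"
    and A :: "('o, 'r, 'k, 'a) diagram"
    and M :: "('o, 'r, 'a, 'm) diagram"
    and e :: "'m \<times> 'a \<Rightarrow> 'x"
  assumes "cring K"
    and "small_category I"
    and "algebra_diagram K I A"
    and "diagram_module I A M"
    and "inj e"
  shows "carrier (H1 K I A M) \<approx> (Ext K I A M :: ('o, 'r, 'k, 'a, 'm, 'x) extension set set)"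
proof -
  interpret diagram_with_module K I A M
    by (intro diagram_with_module.intro diagram_shape.intro diagram_with_module_axioms.intro) (fact assms)+
  let ?Ext = "{E :: ('o, 'r, 'k, 'a, 'm, 'x) extension. is_extension K I A M E}"
  let ?coset = "\<lambda>d. (cobd0 K I A M ` carrier (Der0 K I A M)) #>\<^bsub>Der1 K I A M\<^esub> d"
  have Z: "d \<in> carrier (Der1 K I A M)" if "d \<in> cocycles" for d
    using that by (simp add: cocycles_iff)
  have "\<forall>E\<in>?Ext. \<exists>d. d \<in> cocycles \<and> (\<exists>\<phi>. is_lift E \<phi> \<and> classifies d E \<phi>)"
    using lift_exists_extension classifying_cocycle_exists by blast
  \<comment> \<open>One classifying cocycle is chosen for each extension; the bijection is induced
    by \<open>E \<mapsto> ?coset (c E)\<close>.\<close>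
  then obtain c where c: "\<And>E. E \<in> ?Ext \<Longrightarrow> c E \<in> cocycles \<and> (\<exists>\<phi>. is_lift E \<phi> \<and> classifies (c E) E \<phi>)"
    by metis
  \<comment> \<open>Equivalence is the kernel relation of this map. In particular it is an
    equivalence relation, although its definition asks only for a map in one direction.\<close>
  have "(E, E') \<in> extension_equiv K I A M \<longleftrightarrow> E \<in> ?Ext \<and> E' \<in> ?Ext \<and> ?coset (c E) = ?coset (c E')" for E E'
  proof (cases "E \<in> ?Ext \<and> E' \<in> ?Ext")
    case True
    then obtain \<phi> \<psi> where "is_lift E \<phi>" "classifies (c E) E \<phi>" "is_lift E' \<psi>" "classifies (c E') E' \<psi>"
      using c by blast
    then show ?thesis
      using True c equivalent_if_cohomologous cohomologous_if_equivalent
      by (metis (no_types, lifting) Z coset_eq_iff_cohomologous mem_Collect_eq)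
  next
    case False
    then show ?thesis by (auto simp: extension_equiv_def)
  qed
  then have "(\<lambda>E. ?coset (c E)) ` ?Ext \<approx> ?Ext // extension_equiv K I A M"
    by (rule quotient_eqpoll_image)
  moreover have "(\<lambda>E. ?coset (c E)) ` ?Ext = ?coset ` cocycles"
  proof (intro equalityI subsetI)
    fix D assume "D \<in> ?coset ` cocycles"
    then obtain d where d: "d \<in> cocycles" and D: "D = ?coset d" by blast
    \<comment> \<open>Surjectivity: \<open>d\<close> is realised by an extension whose carriers fit
      into the type \<open>'x\<close> thanks to the injection \<open>e\<close>.\<close>
    obtain E :: "('o, 'r, 'k, 'a, 'm, 'x) extension" and \<phi>
      where E: "is_extension K I A M E" "is_lift E \<phi>" "classifies d E \<phi>"
      using extension_of_cocycle[OF d assms(5)] by blast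
    obtain \<psi> where \<psi>: "is_lift E \<psi>" "classifies (c E) E \<psi>" and cE: "c E \<in> cocycles"
      using c E(1) by blast
    \<comment> \<open>The chosen cocycle \<open>c E\<close> may differ from \<open>d\<close>. Both
      classify the same \<open>E\<close>, so reflexivity makes them cohomologous.\<close>
    have "(E, E) \<in> extension_equiv K I A M"
      by (rule equivalent_if_same_cocycle[OF E(1,1) E(2,2) Z[OF d] E(3,3)])
    then have "cohomologous d (c E)"
      by (rule cohomologous_if_equivalent[OF _ E(2) \<psi>(1) Z[OF d] Z[OF cE] E(3) \<psi>(2)])
    then have "D = ?coset (c E)"
      using coset_eq_iff_cohomologous[OF Z[OF d] Z[OF cE]] D by simp
    then show "D \<in> (\<lambda>E. ?coset (c E)) ` ?Ext" using E(1) by blast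
  qed (use c in auto)
  ultimately show ?thesis
    by (simp add: H1_carrier Ext_def)
qed

end
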